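(* Let $k$ be an algebraically closed field and $n\geq 3$ an integer. The affine variety $\mathcal{C}_n^2(k)$ has dimension \[\dim(\mathcal{C}_n^2(k))=n^2+1^2+(n-1)^2=2n^2-2n+2.\]
   Context: $\mathrm{Mat}_{n\times n}(k)^2$ is identified with the affine space $k^{2n^2}$. A matrix is scalar if it is a constant multiple of the identity. The commuting graph $\Gamma(\mathrm{Mat}_{n\times n}(k))$ has as vertices the non-scalar $n\times n$ matrices over $k$, with an edge between distinct $A$ and $B$ if and only if $AB=BA$. For non-scalar $A,B$, the commuting distance $d_k(A,B)$ is the graph distance between $A$ and $B$ (equal to $\infty$ if they lie in different connected components). It is extended to all matrices by $d_k(A,A)=0$ and $d_k(A,B)=d_k(B,A)=1$ whenever $A$ is scalar and $A\neq B$. Then $\mathcal{C}^{2}_n(k)=\{(A,B)\in\mathrm{Mat}_{n\times n}(k)^2\mid d_k(A,B)\leq 2\}$, which is a Zariski-closed subset of $k^{2n^2}$. The dimension of a variety is the largest dimension of an irreducible component. *)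

theory Defs
  imports
    "Jordan_Normal_Form.Matrix"
    "HOL-Computational_Algebra.Polynomial"
    "HOL-Library.Extended_Nat"
    "HOL-Analysis.Abstract_Topology"
begin

section \<open>The Zariski topology on affine space\<close>

text \<open>Affine \<open>N\<close>-space over \<open>'k\<close> is \<open>carrier_vec N\<close>. Polynomials enter only through the
  functions they induce on it.\<close>

inductive_set poly_funs :: "nat \<Rightarrow> ('k::comm_ring_1 vec \<Rightarrow> 'k) set" for N :: nat where
  const: "(\<lambda>_. c) \<in> poly_funs N"
| coord: "i < N \<Longrightarrow> (\<lambda>x. x $ i) \<in> poly_funs N"
| add: "f \<in> poly_funs N \<Longrightarrow> g \<in> poly_funs N \<Longrightarrow> (\<lambda>x. f x + g x) \<in> poly_funs N"
| mult: "f \<in> poly_funs N \<Longrightarrow> g \<in> poly_funs N \<Longrightarrow> (\<lambda>x. f x * g x) \<in> poly_funs N"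

definition zero_locus :: "nat \<Rightarrow> ('k::comm_ring_1 vec \<Rightarrow> 'k) set \<Rightarrow> 'k vec set" where
  "zero_locus N P = {x \<in> carrier_vec N. \<forall>f\<in>P. f x = 0}"

definition zariski_closed :: "nat \<Rightarrow> 'k::comm_ring_1 vec set \<Rightarrow> bool" where
  "zariski_closed N V \<longleftrightarrow> (\<exists>P \<subseteq> poly_funs N. V = zero_locus N P)"

definition zariski :: "nat \<Rightarrow> 'k::idom vec topology" where
  "zariski N = topology (\<lambda>U. U \<subseteq> carrier_vec N \<and> zariski_closed N (carrier_vec N - U))"

lemma zariski_closed_Un:
  fixes V W :: "'k::idom vec set"
  assumes "zariski_closed N V" "zariski_closed N W"
  shows "zariski_closed N (V \<union> W)"
proof -
  obtain P Q where P: "P \<subseteq> poly_funs N" "V = zero_locus N P"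
    and Q: "Q \<subseteq> poly_funs N" "W = zero_locus N Q"
    using assms unfolding zariski_closed_def by blast
  let ?R = "{\<lambda>x. f x * g x | f g. f \<in> P \<and> g \<in> Q}"
  have "?R \<subseteq> poly_funs N"
    using P(1) Q(1) by (auto intro!: poly_funs.mult)
  moreover have "V \<union> W = zero_locus N ?R"
  proof (intro equalityI subsetI)
    fix x assume "x \<in> V \<union> W"
    then show "x \<in> zero_locus N ?R"
      unfolding P(2) Q(2) zero_locus_def by auto
  next
    fix x assume x: "x \<in> zero_locus N ?R"
    have prod: "f x * g x = 0" if "f \<in> P" "g \<in> Q" for f g
    proof -
      have "(\<lambda>x. f x * g x) \<in> ?R" using that by auto
      then show ?thesis using x unfolding zero_locus_def by fastforce
    qed
    show "x \<in> V \<union> W"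
    proof (cases "\<exists>f\<in>P. f x \<noteq> 0")
      case True
      then have "\<forall>g\<in>Q. g x = 0" using prod by (meson mult_eq_0_iff)
      then show ?thesis using x unfolding Q(2) zero_locus_def by auto
    next
      case False
      then show ?thesis using x unfolding P(2) zero_locus_def by auto
    qed
  qed
  ultimately show ?thesis unfolding zariski_closed_def by blast
qed

lemma zariski_closed_Inter:
  assumes "\<And>V. V \<in> \<V> \<Longrightarrow> zariski_closed N V"
  shows "zariski_closed N (carrier_vec N \<inter> \<Inter>\<V>)"
proof -
  have "\<forall>V\<in>\<V>. \<exists>P. P \<subseteq> poly_funs N \<and> V = zero_locus N P"
    using assms unfolding zariski_closed_def by blast
  then obtain P where P: "\<And>V. V \<in> \<V> \<Longrightarrow> P V \<subseteq> poly_funs N \<and> V = zero_locus N (P V)"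
    by metis
  have "carrier_vec N \<inter> \<Inter>\<V> = zero_locus N (\<Union>V\<in>\<V>. P V)"
  proof (intro equalityI subsetI)
    fix x assume "x \<in> carrier_vec N \<inter> \<Inter>\<V>"
    then have "x \<in> carrier_vec N" "\<And>V. V \<in> \<V> \<Longrightarrow> x \<in> zero_locus N (P V)"
      using P by auto
    then show "x \<in> zero_locus N (\<Union>V\<in>\<V>. P V)"
      unfolding zero_locus_def by blast
  next
    fix x assume x: "x \<in> zero_locus N (\<Union>V\<in>\<V>. P V)"
    have "x \<in> V" if V: "V \<in> \<V>" for V
    proof -
      have "x \<in> zero_locus N (P V)" using x V unfolding zero_locus_def by auto
      with P[OF V] show ?thesis by simp
    qed
    moreover have "x \<in> carrier_vec N" using x unfolding zero_locus_def by simp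
    ultimately show "x \<in> carrier_vec N \<inter> \<Inter>\<V>" by simp
  qed
  moreover have "(\<Union>V\<in>\<V>. P V) \<subseteq> poly_funs N" using P by blast
  ultimately show ?thesis unfolding zariski_closed_def by blast
qed

lemma istopology_zariski:
  "istopology (\<lambda>U :: 'k::idom vec set. U \<subseteq> carrier_vec N \<and> zariski_closed N (carrier_vec N - U))"
  unfolding istopology_def
proof (intro conjI allI impI)
  fix S T :: "'k vec set"
  assume "S \<subseteq> carrier_vec N \<and> zariski_closed N (carrier_vec N - S)"
    "T \<subseteq> carrier_vec N \<and> zariski_closed N (carrier_vec N - T)"
  then show "zariski_closed N (carrier_vec N - S \<inter> T)"
    by (simp add: Diff_Int zariski_closed_Un)
next
  fix \<K> :: "'k vec set set"
  assume K: "\<forall>K\<in>\<K>. K \<subseteq> carrier_vec N \<and> zariski_closed N (carrier_vec N - K)"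
  have "zariski_closed N (carrier_vec N \<inter> \<Inter>((\<lambda>K. carrier_vec N - K) ` \<K>) :: 'k vec set)"
    by (rule zariski_closed_Inter) (use K in auto)
  moreover have "carrier_vec N \<inter> \<Inter>((\<lambda>K. carrier_vec N - K) ` \<K>) = carrier_vec N - \<Union>\<K>"
    by auto
  ultimately show "zariski_closed N (carrier_vec N - \<Union>\<K>)" by simp
qed auto

lemma openin_zariski:
  "openin (zariski N) U \<longleftrightarrow> U \<subseteq> carrier_vec N \<and> zariski_closed N (carrier_vec N - U)"
  by (simp add: zariski_def topology_inverse'[OF istopology_zariski])

lemma topspace_zariski [simp]: "topspace (zariski N) = carrier_vec N"
proof -
  have "zero_locus N {\<lambda>_. 1} = ({} :: 'a vec set)" by (auto simp: zero_locus_def)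
  then have "openin (zariski N) (carrier_vec N :: 'a vec set)"
    unfolding openin_zariski zariski_closed_def
    by (auto intro!: exI[of _ "{\<lambda>_. 1}"] poly_funs.const)
  moreover have "U \<subseteq> carrier_vec N" if "openin (zariski N) U" for U :: "'a vec set"
    using that by (simp add: openin_zariski)
  ultimately show ?thesis
    by (meson openin_subset openin_topspace subset_antisym)
qed

lemma closedin_zariski: "closedin (zariski N) V \<longleftrightarrow> zariski_closed N V"
proof -
  have "zariski_closed N V \<Longrightarrow> V \<subseteq> carrier_vec N"
    by (auto simp: zariski_closed_def zero_locus_def)
  then show ?thesis
    by (auto simp: closedin_def openin_zariski double_diff)
qed


section \<open>Dimension\<close>

definition irreducible_in :: "'a topology \<Rightarrow> 'a set \<Rightarrow> bool" where
  "irreducible_in X S \<longleftrightarrow> S \<subseteq> topspace X \<and> S \<noteq> {} \<and>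
     (\<forall>T U. closedin X T \<longrightarrow> closedin X U \<longrightarrow> S \<subseteq> T \<union> U \<longrightarrow> S \<subseteq> T \<or> S \<subseteq> U)"

definition irreducible_components :: "'a topology \<Rightarrow> 'a set set" where
  "irreducible_components X =
     {Z. irreducible_in X Z \<and> (\<forall>W. irreducible_in X W \<longrightarrow> Z \<subseteq> W \<longrightarrow> W = Z)}"

text \<open>The supremum of the lengths \<open>d\<close> of chains \<open>c 0 \<subset> \<dots> \<subset> c d\<close> of irreducible closed
  subsets; the empty space gets dimension \<open>0\<close>.\<close>

definition krull_dim :: "'a topology \<Rightarrow> enat" where
  "krull_dim X = Sup {enat d | d. \<exists>c :: nat \<Rightarrow> 'a set.
     (\<forall>i\<le>d. closedin X (c i) \<and> irreducible_in X (c i)) \<and> (\<forall>i<d. c i \<subset> c (Suc i))}"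

definition variety_dim :: "nat \<Rightarrow> 'k::idom vec set \<Rightarrow> enat" where
  "variety_dim N V =
     (SUP Z \<in> irreducible_components (subtopology (zariski N) V). krull_dim (subtopology (zariski N) Z))"


section \<open>The commuting distance\<close>

definition scalar_mat :: "nat \<Rightarrow> 'k::comm_ring_1 mat \<Rightarrow> bool" where
  "scalar_mat n A \<longleftrightarrow> (\<exists>c. A = c \<cdot>\<^sub>m 1\<^sub>m n)"

definition commuting_graph :: "nat \<Rightarrow> 'k::comm_ring_1 mat rel" where
  "commuting_graph n = {(A, B). A \<in> carrier_mat n n \<and> B \<in> carrier_mat n n \<and>
     \<not> scalar_mat n A \<and> \<not> scalar_mat n B \<and> A \<noteq> B \<and> A * B = B * A}"

text \<open>The least length of a walk from \<open>a\<close> to \<open>b\<close> along the edge relation \<open>E\<close>, which is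
  \<open>\<infinity> = Inf {}\<close> if there is none.\<close>

definition graph_dist :: "'a rel \<Rightarrow> 'a \<Rightarrow> 'a \<Rightarrow> enat" where
  "graph_dist E a b = Inf {enat l | l. (a, b) \<in> E ^^ l}"

definition commuting_dist :: "nat \<Rightarrow> 'k::comm_ring_1 mat \<Rightarrow> 'k mat \<Rightarrow> enat" where
  "commuting_dist n A B =
     (if A = B then 0
      else if scalar_mat n A \<or> scalar_mat n B then 1
      else graph_dist (commuting_graph n) A B)"

text \<open>The identification of pairs of \<open>n \<times> n\<close> matrices with affine \<open>2n\<^sup>2\<close>-space: the entries
  of \<open>A\<close> row by row, followed by those of \<open>B\<close>.\<close>

definition mat_pair_vec :: "nat \<Rightarrow> 'k mat \<times> 'k mat \<Rightarrow> 'k vec" where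
  "mat_pair_vec n = (\<lambda>(A, B). vec (2 * n\<^sup>2) (\<lambda>l.
     if l < n\<^sup>2 then A $$ (l div n, l mod n)
     else B $$ ((l - n\<^sup>2) div n, (l - n\<^sup>2) mod n)))"

definition commuting_variety2 :: "nat \<Rightarrow> ('k::comm_ring_1 mat \<times> 'k mat) set" where
  "commuting_variety2 n =
     {(A, B). A \<in> carrier_mat n n \<and> B \<in> carrier_mat n n \<and> commuting_dist n A B \<le> 2}"

lemma mat_pair_vec_entry:
  assumes "i < n" "j < n"
  shows "mat_pair_vec n (A, B) $ (i * n + j) = A $$ (i, j)"
    and "mat_pair_vec n (A, B) $ (n\<^sup>2 + (i * n + j)) = B $$ (i, j)"
proof -
  have "Suc i * n \<le> n * n" using assms(1) by (intro mult_le_mono1) simp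
  then have "i * n + j < n\<^sup>2" using assms(2) by (simp add: power2_eq_square)
  then show "mat_pair_vec n (A, B) $ (i * n + j) = A $$ (i, j)"
    and "mat_pair_vec n (A, B) $ (n\<^sup>2 + (i * n + j)) = B $$ (i, j)"
    using assms by (simp_all add: mat_pair_vec_def)
qed

lemma bij_betw_mat_pair_vec:
  "bij_betw (mat_pair_vec n) (carrier_mat n n \<times> carrier_mat n n) (carrier_vec (2 * n\<^sup>2))"
proof (rule bij_betwI[where g = "\<lambda>v. (mat n n (\<lambda>(i, j). v $ (i * n + j)),
    mat n n (\<lambda>(i, j). v $ (n\<^sup>2 + (i * n + j))))"])
  show "mat_pair_vec n \<in> carrier_mat n n \<times> carrier_mat n n \<rightarrow> carrier_vec (2 * n\<^sup>2)"
    by (auto simp: mat_pair_vec_def)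
next
  fix x :: "'a mat \<times> 'a mat" assume x: "x \<in> carrier_mat n n \<times> carrier_mat n n"
  obtain A B where AB: "x = (A, B)" by fastforce
  then have carr: "A \<in> carrier_mat n n" "B \<in> carrier_mat n n" using x by simp_all
  have "mat n n (\<lambda>(i, j). mat_pair_vec n (A, B) $ (i * n + j)) = A"
    by (rule eq_matI) (use carr in \<open>simp_all add: mat_pair_vec_entry(1)\<close>)
  moreover have "mat n n (\<lambda>(i, j). mat_pair_vec n (A, B) $ (n\<^sup>2 + (i * n + j))) = B"
    by (rule eq_matI) (use carr in \<open>simp_all add: mat_pair_vec_entry(2)\<close>)
  ultimately show "(mat n n (\<lambda>(i, j). mat_pair_vec n x $ (i * n + j)),
    mat n n (\<lambda>(i, j). mat_pair_vec n x $ (n\<^sup>2 + (i * n + j)))) = x"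
    unfolding AB by simp
next
  fix v :: "'a vec" assume v: "v \<in> carrier_vec (2 * n\<^sup>2)"
  have aux: "l div n < n \<and> l mod n < n" if "l < n\<^sup>2" for l
  proof -
    have "n > 0" using that by (cases n) auto
    then show ?thesis using that by (simp add: less_mult_imp_div_less power2_eq_square)
  qed
  show "mat_pair_vec n (mat n n (\<lambda>(i, j). v $ (i * n + j)),
    mat n n (\<lambda>(i, j). v $ (n\<^sup>2 + (i * n + j)))) = v"
  proof (rule eq_vecI)
    fix l assume "l < dim_vec v"
    then have l: "l < 2 * n\<^sup>2" using v by simp
    show "mat_pair_vec n (mat n n (\<lambda>(i, j). v $ (i * n + j)),
      mat n n (\<lambda>(i, j). v $ (n\<^sup>2 + (i * n + j)))) $ l = v $ l"
    proof (cases "l < n\<^sup>2")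
      case True
      then show ?thesis using l aux[OF True] by (simp add: mat_pair_vec_def)
    next
      case False
      then have "l - n\<^sup>2 < n\<^sup>2" using l by simp
      from aux[OF this] show ?thesis using l False by (simp add: mat_pair_vec_def)
    qed
  qed (use v in \<open>simp add: mat_pair_vec_def\<close>)
qed (rule funcsetI, simp)

end

theory Submission
  imports Defs "Jordan_Normal_Form.Char_Poly"
begin

text \<open>Dimension is controlled by counting: call \<open>d\<close> a growth exponent of a set \<open>S\<close> of points if the
  polynomial functions of degree at most \<open>m\<close> span a space of dimension \<open>O(m ^ d)\<close> of functions on
  \<open>S\<close>. Passing to a proper closed subset of an irreducible set lowers the exponent by one, so it bounds
  the length of chains; and the image of affine \<open>d\<close>-space under a polynomial map has exponent \<open>d\<close>.

  A pair \<open>(A, B)\<close> lies in the variety iff some non-scalar \<open>C\<close> commutes with \<open>A\<close> and \<open>B\<close>. Subtracting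
  an eigenvalue from \<open>C\<close> gives a singular \<open>M \<noteq> 0\<close> of some rank \<open>r\<close>. A rational deformation over a
  line turns the common invariant subspaces \<open>im M\<close> and \<open>ker M\<close> into complementary ones, so \<open>(A, B)\<close>
  is a limit of pairs that are simultaneously block diagonal with blocks of sizes \<open>r\<close> and \<open>s = n - r\<close>.
  A generic such pair is conjugate to a block diagonal one by a product of a lower and an upper
  unipotent block matrix, and this parametrization uses
  \<open>2rs + 2r\<^sup>2 + 2s\<^sup>2 = n\<^sup>2 + r\<^sup>2 + s\<^sup>2 \<le> n\<^sup>2 + 1 + (n - 1)\<^sup>2\<close> parameters.

  For the lower bound take \<open>r = 1\<close> and release the parameters one by one. Each step is strict, as
  the parameters are rational functions of the pair: the commutator of the two matrices has a
  one-dimensional kernel and cokernel, which determine the two unipotent factors. This needs an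
  invertible commutator of size \<open>n - 1\<close>, hence \<open>n \<ge> 3\<close>.\<close>

section \<open>Polynomial functions in a set of generators\<close>

text \<open>Growth exponents stand in for transcendence degree: only upper bounds on them are ever
  needed, and they pass to closures, so a closed set can be handled through a dense parametrized
  part. The obstacle in the upper bound is that \<open>im M\<close> and \<open>ker M\<close> need
  not be complementary (\<open>M\<close> may be nilpotent), so \<open>(A, B)\<close> itself may fail
  to be block diagonalizable. The deformation of \<open>M\<close> does not depend on
  \<open>A\<close> or \<open>B\<close>, so both deformed matrices become block diagonal in one
  common basis. Inverses are replaced by adjugates over a determinant that is nonzero at
  \<open>t = 0\<close>; a polynomial function that vanishes at almost all points of such a curve
  vanishes at its start. The conjugating matrix costs only \<open>2rs\<close> parameters because its
  block diagonal factor is absorbed into the blocks. In the lower bound the order of release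
  matters: the blocks come first, then \<open>Y\<close>, and \<open>X\<close> last, because the
  formula for \<open>Y\<close> is used while \<open>X = 0\<close>, whereas the formula for
  \<open>X\<close> holds throughout.\<close>

inductive poly_le :: "('a \<Rightarrow> 'k::comm_ring_1) set \<Rightarrow> nat \<Rightarrow> ('a \<Rightarrow> 'k) \<Rightarrow> bool"
  for G :: "('a \<Rightarrow> 'k) set" where
  const: "poly_le G m (\<lambda>_. c)"
| gen: "g \<in> G \<Longrightarrow> poly_le G (Suc m) g"
| add: "poly_le G m f \<Longrightarrow> poly_le G m g \<Longrightarrow> poly_le G m (\<lambda>x. f x + g x)"
| mult: "poly_le G m f \<Longrightarrow> poly_le G l g \<Longrightarrow> poly_le G (m + l) (\<lambda>x. f x * g x)"

text \<open>The generators are left open because three cases occur: the coordinates of affine space,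
  the parameters of a parametrization, and the single variable of a line.\<close>

definition polys :: "('a \<Rightarrow> 'k::comm_ring_1) set \<Rightarrow> ('a \<Rightarrow> 'k) set" where
  "polys G = {f. \<exists>m. poly_le G m f}"

definition coords :: "nat \<Rightarrow> ('k vec \<Rightarrow> 'k) set" where
  "coords N = (\<lambda>i x. x $ i) ` {..<N}"

lemma poly_le_mono:
  assumes "poly_le G m f" "m \<le> m'"
  shows "poly_le G m' f"
  using assms
proof (induction arbitrary: m' rule: poly_le.induct)
  case (gen g m)
  then show ?case by (cases m') (auto intro: poly_le.gen)
next
  case (mult m f l g)
  \<comment> \<open>All the slack in the degree is given to the second factor.\<close>
  have "poly_le G m f" "poly_le G (m' - m) g" using mult by auto
  from poly_le.mult[OF this] show ?case using mult by simp
qed (auto intro: poly_le.intros)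

lemma polys_const [intro, simp]: "(\<lambda>_. c) \<in> polys G"
  by (auto simp: polys_def intro: poly_le.const)

lemma polys_gen: "g \<in> G \<Longrightarrow> g \<in> polys G"
  by (auto simp: polys_def intro: poly_le.gen)

lemma polys_add [intro]:
  assumes "f \<in> polys G" "g \<in> polys G"
  shows "(\<lambda>x. f x + g x) \<in> polys G"
proof -
  obtain m l where "poly_le G m f" "poly_le G l g" using assms by (auto simp: polys_def)
  then have "poly_le G (max m l) f" "poly_le G (max m l) g"
    by (auto elim: poly_le_mono)
  then show ?thesis unfolding polys_def by (blast intro: poly_le.add)
qed

lemma polys_mult [intro]:
  assumes "f \<in> polys G" "g \<in> polys G"
  shows "(\<lambda>x. f x * g x) \<in> polys G"
  using assms unfolding polys_def by (blast intro: poly_le.mult)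

lemma polys_uminus [intro]: "f \<in> polys G \<Longrightarrow> (\<lambda>x. - f x) \<in> polys G"
  using polys_mult[OF polys_const[of "-1"], of f G] by simp

lemma polys_diff [intro]: "f \<in> polys G \<Longrightarrow> g \<in> polys G \<Longrightarrow> (\<lambda>x. f x - g x) \<in> polys G"
  using polys_add[OF _ polys_uminus, of f G g] by simp

lemma polys_sum [intro]: "(\<And>i. i \<in> I \<Longrightarrow> f i \<in> polys G) \<Longrightarrow> (\<lambda>x. \<Sum>i\<in>I. f i x) \<in> polys G"
  by (induction I rule: infinite_finite_induct) auto

lemma polys_prod [intro]: "(\<And>i. i \<in> I \<Longrightarrow> f i \<in> polys G) \<Longrightarrow> (\<lambda>x. \<Prod>i\<in>I. f i x) \<in> polys G"
  by (induction I rule: infinite_finite_induct) auto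

lemma polys_power [intro]: "f \<in> polys G \<Longrightarrow> (\<lambda>x. f x ^ k) \<in> polys G"
  by (induction k) auto

lemma poly_le_power: "poly_le G e f \<Longrightarrow> poly_le G (e * j) (\<lambda>x. f x ^ j)"
  by (induction j) (auto intro: poly_le.const dest: poly_le.mult)

lemma polys_coords: "polys (coords N) = poly_funs N"
proof (intro equalityI subsetI)
  fix f :: "'a vec \<Rightarrow> 'a" assume "f \<in> polys (coords N)"
  then obtain m where "poly_le (coords N) m f" by (auto simp: polys_def)
  then show "f \<in> poly_funs N"
    by induction (auto simp: coords_def intro: poly_funs.intros)
next
  fix f :: "'a vec \<Rightarrow> 'a" assume "f \<in> poly_funs N"
  then show "f \<in> polys (coords N)"
  proof induction
    case (coord i)
    then show ?case by (intro polys_gen) (auto simp: coords_def)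
  qed auto
qed

lemma poly_le_compose:
  assumes "poly_le G m f" "\<And>g. g \<in> G \<Longrightarrow> poly_le H e (\<lambda>w. g (\<phi> w))"
  shows "poly_le H (e * m) (\<lambda>w. f (\<phi> w))"
  using assms(1)
proof induction
  case (gen g m)
  then show ?case by (auto intro: poly_le_mono[OF assms(2)])
next
  case (mult m f l g)
  then show ?case by (auto simp: distrib_left intro: poly_le.mult)
qed (auto intro: poly_le.intros)

lemma polys_compose:
  assumes "f \<in> polys G" "\<And>g. g \<in> G \<Longrightarrow> (\<lambda>w. g (\<phi> w)) \<in> polys H"
  shows "(\<lambda>w. f (\<phi> w)) \<in> polys H"
proof -
  obtain m where "poly_le G m f" using assms(1) by (auto simp: polys_def)
  then show ?thesis by induction (auto intro: assms(2))
qed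

section \<open>Polynomials in one variable and generic parameter values\<close>

lemma polys_univariate:
  assumes "h \<in> polys {\<lambda>t. t}"
  shows "\<exists>p. \<forall>t. h t = poly p t"
proof -
  obtain m where "poly_le {\<lambda>t. t} m h" using assms by (auto simp: polys_def)
  then show ?thesis
  proof induction
    case (const m c)
    show ?case by (rule exI[of _ "[:c:]"]) simp
  next
    case (gen g m)
    then show ?case by (intro exI[of _ "[:0, 1:]"]) simp
  next
    case (add m f g)
    then obtain p q where "\<forall>t. f t = poly p t" "\<forall>t. g t = poly q t" by blast
    then show ?case by (intro exI[of _ "p + q"]) simp
  next
    case (mult m f l g)
    then obtain p q where "\<forall>t. f t = poly p t" "\<forall>t. g t = poly q t" by blast
    then show ?case by (intro exI[of _ "p * q"]) simp
  qed
qed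

text \<open>Finiteness of the root set. \<open>MOST\<close> serves as the quantifier for a generic
  parameter: finitely many such conditions hold at once, and over an infinite field some parameter
  satisfies them.\<close>

lemma MOST_polys_neq_0:
  fixes h :: "'k::idom \<Rightarrow> 'k"
  assumes "h \<in> polys {\<lambda>t. t}" "h s \<noteq> 0"
  shows "MOST t. h t \<noteq> 0"
proof -
  obtain p where p: "\<And>t. h t = poly p t" using polys_univariate[OF assms(1)] by blast
  have "p \<noteq> 0" using assms(2) p by auto
  then show ?thesis using poly_roots_finite[of p] by (simp add: MOST_iff_cofinite p)
qed

lemma infinite_UNIV_alg_closed_field: "infinite (UNIV :: 'k::alg_closed_field set)"
proof
  assume fin: "finite (UNIV :: 'k set)"
  \<comment> \<open>Euclid's argument: one plus the product of all linear factors is nonconstant but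
    takes the value 1 everywhere.\<close>
  define p :: "'k poly" where "p = (\<Prod>a\<in>UNIV. [:- a, 1:]) + 1"
  have val: "poly p x = 1" for x
    using fin by (auto simp: p_def poly_prod intro!: prod_zero bexI[of _ x])
  have "degree (\<Prod>a\<in>UNIV. [:- a, 1::'k:]) = (\<Sum>a\<in>(UNIV::'k set). degree [:- a, 1::'k:])"
    by (rule degree_prod_eq_sum_degree) auto
  also have "\<dots> > 0" using fin by (simp add: finite_UNIV_card_ge_0)
  finally have "degree p > 0" unfolding p_def by (subst degree_add_eq_left) auto
  then obtain x where "poly p x = 0" using alg_closed_imp_poly_has_root by blast
  then show False using val by simp
qed

lemma MOST_alg_closed_field_ex:
  assumes "MOST t. P (t :: 'k::alg_closed_field)"
  shows "\<exists>t. P t"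
  using eventually_happens'[OF _ assms] infinite_UNIV_alg_closed_field by (auto simp: cofinite_bot)

section \<open>Counting linearly independent polynomial functions\<close>

text \<open>A homogeneous system with more unknowns than equations, solved by elimination: each
  equation \<open>e\<close> is used up together with one pivot unknown \<open>k\<close>.\<close>

lemma ex_linear_dependency:
  fixes a :: "'i \<Rightarrow> 'e \<Rightarrow> 'k::field"
  assumes "finite E" "finite I" "card I > card E"
  shows "\<exists>c. (\<exists>i\<in>I. c i \<noteq> 0) \<and> (\<forall>e\<in>E. (\<Sum>i\<in>I. c i * a i e) = 0)"
  using assms
proof (induction E arbitrary: I a rule: finite_induct)
  case empty
  then obtain i where "i \<in> I" by (auto simp: card_gt_0_iff)
  then show ?case by (intro exI[of _ "\<lambda>_. 1"]) auto
next
  case (insert e E)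
  show ?case
  proof (cases "\<forall>i\<in>I. a i e = 0")
    case True
    obtain c where "\<exists>i\<in>I. c i \<noteq> 0" "\<forall>e\<in>E. (\<Sum>i\<in>I. c i * a i e) = 0"
      using insert.IH[of I a] insert.prems insert.hyps by auto
    then show ?thesis using True by (intro exI[of _ c]) auto
  next
    case False
    then obtain k where k: "k \<in> I" "a k e \<noteq> 0" by blast
    \<comment> \<open>Subtracting a multiple of row \<open>k\<close> clears column \<open>e\<close>.
      A dependency among the remaining rows then extends to \<open>k\<close> with the coefficient
      \<open>- s\<close>.\<close>
    define b where "b i e' = a i e' - a i e / a k e * a k e'" for i e'
    have "card (I - {k}) > card E" using insert k by simp
    then obtain c where c: "\<exists>i\<in>I - {k}. c i \<noteq> 0"
      "\<And>e'. e' \<in> E \<Longrightarrow> (\<Sum>i\<in>I - {k}. c i * b i e') = 0"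
      using insert.IH[of "I - {k}" b] insert.prems by auto
    define s where "s = (\<Sum>i\<in>I - {k}. c i * (a i e / a k e))"
    define c' where "c' = c(k := - s)"
    have split: "(\<Sum>i\<in>I. c' i * a i e') = (\<Sum>i\<in>I - {k}. c i * b i e')" for e'
    proof -
      have "(\<Sum>i\<in>I. c' i * a i e') = - s * a k e' + (\<Sum>i\<in>I - {k}. c' i * a i e')"
        using k(1) insert.prems(1) by (subst sum.remove[of _ k]) (auto simp: c'_def)
      also have "(\<Sum>i\<in>I - {k}. c' i * a i e') = (\<Sum>i\<in>I - {k}. c i * a i e')"
        by (rule sum.cong) (auto simp: c'_def)
      also have "- s * a k e' + (\<Sum>i\<in>I - {k}. c i * a i e') = (\<Sum>i\<in>I - {k}. c i * b i e')"
        by (simp add: s_def b_def sum_distrib_right right_diff_distrib sum_subtractf mult.assoc)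
      finally show ?thesis .
    qed
    have "b i e = 0" for i using k by (simp add: b_def)
    then have "(\<Sum>i\<in>I. c' i * a i e') = 0" if "e' \<in> insert e E" for e'
      using that c(2) by (auto simp: split)
    moreover have "\<exists>i\<in>I. c' i \<noteq> 0" using c(1) by (auto simp: c'_def)
    ultimately show ?thesis by blast
  qed
qed

definition indep_on :: "'a set \<Rightarrow> 'i set \<Rightarrow> ('i \<Rightarrow> 'a \<Rightarrow> 'k::comm_ring_1) \<Rightarrow> bool" where
  "indep_on S I F \<longleftrightarrow> (\<forall>c. (\<forall>x\<in>S. (\<Sum>i\<in>I. c i * F i x) = 0) \<longrightarrow> (\<forall>i\<in>I. c i = 0))"

lemma indep_on_reindex:
  assumes "bij_betw h J I" "indep_on S I F"
  shows "indep_on S J (\<lambda>j. F (h j))"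
  unfolding indep_on_def
proof (intro allI impI ballI)
  fix c j
  assume *: "\<forall>x\<in>S. (\<Sum>j\<in>J. c j * F (h j) x) = 0" and j: "j \<in> J"
  let ?g = "inv_into J h"
  have "(\<Sum>i\<in>I. c (?g i) * F i x) = (\<Sum>j\<in>J. c j * F (h j) x)" for x
    by (subst sum.reindex_bij_betw[OF assms(1), symmetric], rule sum.cong)
      (use assms(1) in \<open>auto simp: bij_betw_def\<close>)
  then have "\<forall>x\<in>S. (\<Sum>i\<in>I. c (?g i) * F i x) = 0" using * by simp
  then have "\<forall>i\<in>I. c (?g i) = 0"
    using assms(2)[unfolded indep_on_def, rule_format, of "\<lambda>i. c (?g i)"] by blast
  moreover have "h j \<in> I" "?g (h j) = j" using j assms(1) by (auto simp: bij_betw_def)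
  ultimately show "c j = 0" by force
qed

text \<open>The dimension of the space of functions on \<open>S\<close> of degree at most \<open>m\<close> is bounded through the
  size of independent families, so that no vector space of functions has to be formed.\<close>

definition growth_le :: "('a \<Rightarrow> 'k::comm_ring_1) set \<Rightarrow> 'a set \<Rightarrow> nat \<Rightarrow> bool" where
  "growth_le G S d \<longleftrightarrow> (\<exists>C. \<forall>m a (F :: nat \<Rightarrow> 'a \<Rightarrow> 'k).
     (\<forall>i<a. poly_le G m (F i)) \<longrightarrow> indep_on S {..<a} F \<longrightarrow> a \<le> C * (m + 1) ^ d)"

text \<open>The definition quantifies over families indexed by an initial segment of the naturals;
  the products \<open>f ^ j * g i\<close> used later are indexed by pairs.\<close>

lemma growth_le_finite_family:
  assumes "growth_le G S d"
  obtains C where "\<And>m (I :: 'i set) F. finite I \<Longrightarrow> (\<And>i. i \<in> I \<Longrightarrow> poly_le G m (F i)) \<Longrightarrow>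
    indep_on S I F \<Longrightarrow> card I \<le> C * (m + 1) ^ d"
proof -
  obtain C where C: "\<And>m a F. (\<forall>i<a. poly_le G m (F i)) \<Longrightarrow> indep_on S {..<a} F \<Longrightarrow>
    a \<le> C * (m + 1) ^ d"
    using assms unfolding growth_le_def by blast
  have "card I \<le> C * (m + 1) ^ d"
    if "finite I" "\<And>i. i \<in> I \<Longrightarrow> poly_le G m (F i)" "indep_on S I F" for m and I :: "'i set" and F
  proof -
    obtain h where h: "bij_betw h {..<card I} I"
      using ex_bij_betw_nat_finite[OF \<open>finite I\<close>] by (metis atLeast0LessThan)
    show ?thesis
      by (rule C[OF _ indep_on_reindex[OF h that(3)]]) (use h that(2) in \<open>auto simp: bij_betw_def\<close>)
  qed
  then show ?thesis by (rule that)
qed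

lemma growth_le_mono:
  assumes "growth_le G S d" "d \<le> d'"
  shows "growth_le G S d'"
proof -
  obtain C where C: "\<And>m a F. (\<forall>i<a. poly_le G m (F i)) \<Longrightarrow> indep_on S {..<a} F \<Longrightarrow>
    a \<le> C * (m + 1) ^ d"
    using assms unfolding growth_le_def by blast
  show ?thesis unfolding growth_le_def
  proof (intro exI[of _ C] allI impI)
    fix m a and F :: "nat \<Rightarrow> 'a \<Rightarrow> 'b"
    assume "\<forall>i<a. poly_le G m (F i)" "indep_on S {..<a} F"
    from C[OF this] show "a \<le> C * (m + 1) ^ d'"
      using power_increasing[OF assms(2), of "m + 1"] by (meson le_add2 le_trans mult_le_mono2)
  qed
qed

lemma sum_indicator_mult:
  fixes h :: "'e \<Rightarrow> 'k::comm_ring_1"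
  assumes "finite A" "z \<in> A"
  shows "(\<Sum>e\<in>A. (if e = z then b else 0) * h e) = b * h z"
  using assms by (subst sum.remove[of A z]) (auto intro!: sum.neutral)

text \<open>Exponents are bounded one generator at a time instead of by total degree. The resulting
  box has exactly \<open>(m + 1) ^ card G\<close> elements, a crude count with the right order of
  growth.\<close>

lemma poly_le_monomial_sum:
  fixes G :: "('a \<Rightarrow> 'k::comm_ring_1) set"
  assumes "finite G" "poly_le G m f"
  shows "\<exists>c. \<forall>x. f x = (\<Sum>e\<in>G \<rightarrow>\<^sub>E {..m}. c e * (\<Prod>g\<in>G. g x ^ e g))"
  using assms(2)
proof induction
  case (const m b)
  let ?z = "\<lambda>g\<in>G. 0 :: nat"
  have z: "?z \<in> G \<rightarrow>\<^sub>E {..m}" by auto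
  have "b = (\<Sum>e\<in>G \<rightarrow>\<^sub>E {..m}. (if e = ?z then b else 0) * (\<Prod>g\<in>G. g x ^ e g))" for x
    by (subst sum_indicator_mult) (use z assms(1) in \<open>auto simp: finite_PiE\<close>)
  then show ?case by (intro exI[of _ "\<lambda>e. if e = ?z then b else 0"]) blast
next
  case (gen g m)
  let ?z = "\<lambda>h\<in>G. if h = g then 1 else 0 :: nat"
  have z: "?z \<in> G \<rightarrow>\<^sub>E {..Suc m}" by auto
  have "(\<Prod>h\<in>G. h x ^ ?z h) = (\<Prod>h\<in>G. if h = g then h x else 1)" for x
    by (rule prod.cong) auto
  then have "(\<Prod>h\<in>G. h x ^ ?z h) = g x" for x
    using gen assms(1) by (simp add: prod.delta)
  then have "g x = (\<Sum>e\<in>G \<rightarrow>\<^sub>E {..Suc m}. (if e = ?z then 1 else 0) * (\<Prod>g\<in>G. g x ^ e g))" for x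
    by (subst sum_indicator_mult) (use z assms(1) in \<open>auto simp: finite_PiE\<close>)
  then show ?case by (intro exI[of _ "\<lambda>e. if e = ?z then 1 else 0"]) blast
next
  case (add m f g)
  then obtain c d where "\<forall>x. f x = (\<Sum>e\<in>G \<rightarrow>\<^sub>E {..m}. c e * (\<Prod>g\<in>G. g x ^ e g))"
    "\<forall>x. g x = (\<Sum>e\<in>G \<rightarrow>\<^sub>E {..m}. d e * (\<Prod>g\<in>G. g x ^ e g))" by blast
  then show ?case
    by (intro exI[of _ "\<lambda>e. c e + d e"]) (simp add: distrib_right sum.distrib)
next
  case (mult m f l g)
  then obtain c d where c: "\<And>x. f x = (\<Sum>e\<in>G \<rightarrow>\<^sub>E {..m}. c e * (\<Prod>g\<in>G. g x ^ e g))"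
    and d: "\<And>x. g x = (\<Sum>e\<in>G \<rightarrow>\<^sub>E {..l}. d e * (\<Prod>g\<in>G. g x ^ e g))" by blast
  let ?A = "(G \<rightarrow>\<^sub>E {..m}) \<times> (G \<rightarrow>\<^sub>E {..l})"
  let ?p = "\<lambda>(e, e'). \<lambda>g\<in>G. e g + e' g :: nat"
  \<comment> \<open>Convolution of the two coefficient families: all pairs of exponents with sum
    \<open>e\<close> are collected.\<close>
  let ?c = "\<lambda>e. \<Sum>p\<in>{p \<in> ?A. ?p p = e}. c (fst p) * d (snd p)"
  have fin: "finite ?A" using assms(1) by (intro finite_cartesian_product finite_PiE) auto
  have img: "?p ` ?A \<subseteq> G \<rightarrow>\<^sub>E {..m + l}" by (auto simp: PiE_iff intro!: add_mono)
  have "f x * g x = (\<Sum>e\<in>G \<rightarrow>\<^sub>E {..m + l}. ?c e * (\<Prod>g\<in>G. g x ^ e g))" for x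
  proof -
    let ?M = "\<lambda>e. \<Prod>g\<in>G. g x ^ e g"
    have "f x * g x = (\<Sum>p\<in>?A. (c (fst p) * d (snd p)) * ?M (?p p))"
      unfolding c d sum_product sum.cartesian_product
      by (rule sum.cong) (auto simp: power_add prod.distrib mult_ac)
    also have "\<dots> = (\<Sum>e\<in>G \<rightarrow>\<^sub>E {..m + l}. \<Sum>p\<in>{p \<in> ?A. ?p p = e}. (c (fst p) * d (snd p)) * ?M (?p p))"
      using fin img assms(1) by (intro sum.group[symmetric]) (auto intro!: finite_PiE)
    also have "\<dots> = (\<Sum>e\<in>G \<rightarrow>\<^sub>E {..m + l}. ?c e * ?M e)"
      unfolding sum_distrib_right by (intro sum.cong refl) auto
    finally show ?thesis .
  qed
  then show ?case by (intro exI[of _ ?c]) blast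
qed

lemma indep_on_card_le:
  fixes G :: "('a \<Rightarrow> 'k::field) set"
  assumes "finite G" "finite I" "\<And>i. i \<in> I \<Longrightarrow> poly_le G m (F i)" "indep_on S I F"
  shows "card I \<le> (m + 1) ^ card G"
proof (rule ccontr)
  assume "\<not> ?thesis"
  then have lt: "card (G \<rightarrow>\<^sub>E {..m}) < card I" using assms(1) by (simp add: card_PiE)
  have fin: "finite (G \<rightarrow>\<^sub>E {..m})" using assms(1) by (intro finite_PiE) auto
  have "\<forall>i\<in>I. \<exists>c. \<forall>x. F i x = (\<Sum>e\<in>G \<rightarrow>\<^sub>E {..m}. c e * (\<Prod>g\<in>G. g x ^ e g))"
    using poly_le_monomial_sum[OF assms(1) assms(3)] by simp
  from bchoice[OF this] obtain a where a: "\<And>i x. i \<in> I \<Longrightarrow> F i x = (\<Sum>e\<in>G \<rightarrow>\<^sub>E {..m}. a i e * (\<Prod>g\<in>G. g x ^ e g))"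
    by blast
  obtain c where c: "\<exists>i\<in>I. c i \<noteq> 0" "\<And>e. e \<in> G \<rightarrow>\<^sub>E {..m} \<Longrightarrow> (\<Sum>i\<in>I. c i * a i e) = 0"
    using ex_linear_dependency[OF fin assms(2) lt, of a] by blast
  have "(\<Sum>i\<in>I. c i * F i x) = 0" for x
  proof -
    have "(\<Sum>i\<in>I. c i * F i x) = (\<Sum>i\<in>I. \<Sum>e\<in>G \<rightarrow>\<^sub>E {..m}. c i * a i e * (\<Prod>g\<in>G. g x ^ e g))"
      by (rule sum.cong) (auto simp: a sum_distrib_left mult.assoc)
    also have "\<dots> = (\<Sum>e\<in>G \<rightarrow>\<^sub>E {..m}. (\<Sum>i\<in>I. c i * a i e) * (\<Prod>g\<in>G. g x ^ e g))"
      by (subst sum.swap) (simp add: sum_distrib_right)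
    also have "\<dots> = 0" by (rule sum.neutral) (simp add: c)
    finally show ?thesis .
  qed
  then show False using c(1) assms(4) unfolding indep_on_def by blast
qed

text \<open>Functions independent on the image pull back to functions independent on the parameter
  space, where monomials can be counted. The pullback multiplies degrees by a constant, so the
  exponent is just the number of parameters.\<close>

lemma growth_le_image:
  fixes \<phi> :: "'b \<Rightarrow> 'k::field vec"
  assumes "finite H" "\<And>i. i < N \<Longrightarrow> (\<lambda>w. \<phi> w $ i) \<in> polys H"
  shows "growth_le (coords N) (range \<phi>) (card H)"
proof -
  have "\<exists>e. \<forall>i<N. poly_le H e (\<lambda>w. \<phi> w $ i)"
    using assms(2)
  proof (induction N)
    case (Suc N)
    then obtain e where "\<forall>i<N. poly_le H e (\<lambda>w. \<phi> w $ i)" by force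
    moreover obtain e' where "poly_le H e' (\<lambda>w. \<phi> w $ N)"
      using Suc.prems[of N] by (auto simp: polys_def)
    ultimately have "\<forall>i<Suc N. poly_le H (max e e') (\<lambda>w. \<phi> w $ i)"
      by (metis less_Suc_eq max.cobounded1 max.cobounded2 poly_le_mono)
    then show ?case by blast
  qed simp
  then obtain e where e: "\<And>i. i < N \<Longrightarrow> poly_le H e (\<lambda>w. \<phi> w $ i)" by blast
  show ?thesis unfolding growth_le_def
  proof (intro exI[of _ "(e + 1) ^ card H"] allI impI)
    fix m a and F :: "nat \<Rightarrow> 'k vec \<Rightarrow> 'k"
    assume F: "\<forall>i<a. poly_le (coords N) m (F i)" and ind: "indep_on (range \<phi>) {..<a} F"
    have "card {..<a} \<le> (e * m + 1) ^ card H"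
    proof (rule indep_on_card_le[OF assms(1), where F = "\<lambda>i w. F i (\<phi> w)" and S = UNIV])
      show "poly_le H (e * m) (\<lambda>w. F i (\<phi> w))" if "i \<in> {..<a}" for i
        using that F e by (intro poly_le_compose[of "coords N"]) (auto simp: coords_def)
      show "indep_on UNIV {..<a} (\<lambda>i w. F i (\<phi> w))" using ind by (auto simp: indep_on_def)
    qed auto
    \<comment> \<open>\<open>e * m + 1\<close> is at most \<open>(e + 1) * (m + 1)\<close>, which
      moves the degree of the parametrization into the constant.\<close>
    also have "\<dots> \<le> ((e + 1) * (m + 1)) ^ card H" by (intro power_mono) auto
    finally show "a \<le> (e + 1) ^ card H * (m + 1) ^ card H" by (simp only: power_mult_distrib card_lessThan)
  qed
qed

section \<open>Irreducible sets and chains\<close>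

text \<open>The Zariski closure, written as the zero locus of the vanishing ideal.\<close>

definition zcl :: "nat \<Rightarrow> 'k::comm_ring_1 vec set \<Rightarrow> 'k vec set" where
  "zcl N S = zero_locus N {f \<in> poly_funs N. \<forall>x\<in>S. f x = 0}"

lemma closedin_zcl: "closedin (zariski N) (zcl N S)"
  unfolding closedin_zariski zariski_closed_def zcl_def
  by (rule exI[of _ "{f \<in> poly_funs N. \<forall>x\<in>S. f x = 0}"]) simp

lemma zcl_superset: "S \<subseteq> carrier_vec N \<Longrightarrow> S \<subseteq> zcl N S"
  by (auto simp: zcl_def zero_locus_def)

lemma zcl_least:
  assumes "closedin (zariski N) T" "S \<subseteq> T"
  shows "zcl N S \<subseteq> T"
proof -
  obtain P where "P \<subseteq> poly_funs N" "T = zero_locus N P"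
    using assms(1) by (auto simp: closedin_zariski zariski_closed_def)
  then show ?thesis using assms(2) by (fastforce simp: zcl_def zero_locus_def)
qed

lemma zcl_eqD: "x \<in> zcl N S \<Longrightarrow> f \<in> poly_funs N \<Longrightarrow> (\<And>y. y \<in> S \<Longrightarrow> f y = 0) \<Longrightarrow> f x = 0"
  by (simp add: zcl_def zero_locus_def)

lemma closedin_zeros: "f \<in> poly_funs N \<Longrightarrow> closedin (zariski N) {x \<in> carrier_vec N. f x = 0}"
  unfolding closedin_zariski zariski_closed_def
  by (rule exI[of _ "{f}"]) (auto simp: zero_locus_def)

text \<open>The vanishing ideal of an irreducible set is prime;
  \<open>irreducible_in_zariskiI\<close> is the converse.\<close>

lemma irreducible_in_mult_eq_0:
  fixes f g :: "'k::idom vec \<Rightarrow> 'k"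
  assumes "irreducible_in (zariski N) Z" "f \<in> poly_funs N" "g \<in> poly_funs N"
    "\<And>x. x \<in> Z \<Longrightarrow> f x * g x = 0"
  shows "(\<forall>x\<in>Z. f x = 0) \<or> (\<forall>x\<in>Z. g x = 0)"
proof -
  have "Z \<subseteq> carrier_vec N" using assms(1) by (auto simp: irreducible_in_def)
  then have "Z \<subseteq> {x \<in> carrier_vec N. f x = 0} \<union> {x \<in> carrier_vec N. g x = 0}"
    using assms(4) by fastforce
  then show ?thesis
    using assms(1) closedin_zeros[OF assms(2)] closedin_zeros[OF assms(3)]
    unfolding irreducible_in_def by blast
qed

lemma irreducible_in_zariskiI:
  fixes Z :: "'k::idom vec set"
  assumes "Z \<subseteq> carrier_vec N" "Z \<noteq> {}"
    and "\<And>f g. f \<in> poly_funs N \<Longrightarrow> g \<in> poly_funs N \<Longrightarrow> (\<And>x. x \<in> Z \<Longrightarrow> f x * g x = 0) \<Longrightarrow>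
      (\<forall>x\<in>Z. f x = 0) \<or> (\<forall>x\<in>Z. g x = 0)"
  shows "irreducible_in (zariski N) Z"
  unfolding irreducible_in_def
proof (intro conjI allI impI)
  fix T U :: "'k vec set"
  assume T: "closedin (zariski N) T" and U: "closedin (zariski N) U" and sub: "Z \<subseteq> T \<union> U"
  obtain P Q where P: "P \<subseteq> poly_funs N" "T = zero_locus N P"
    and Q: "Q \<subseteq> poly_funs N" "U = zero_locus N Q"
    using T U by (auto simp: closedin_zariski zariski_closed_def)
  show "Z \<subseteq> T \<or> Z \<subseteq> U"
  proof (rule ccontr)
    assume "\<not> ?thesis"
    then obtain x y f g where *: "x \<in> Z" "f \<in> P" "f x \<noteq> 0" "y \<in> Z" "g \<in> Q" "g y \<noteq> 0"
      using assms(1) unfolding P Q zero_locus_def by blast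
    have "f z * g z = 0" if "z \<in> Z" for z
      using that sub * unfolding P Q zero_locus_def by fastforce
    then show False using assms(3)[of f g] * P(1) Q(1) by blast
  qed
qed (use assms in auto)

lemma irreducible_inD:
  assumes "irreducible_in X S" "closedin X T" "closedin X U" "S \<subseteq> T \<union> U"
  shows "S \<subseteq> T \<or> S \<subseteq> U"
  using assms by (simp add: irreducible_in_def)

lemma irreducible_in_subtopology_iff:
  "irreducible_in (subtopology X V) S \<longleftrightarrow> S \<subseteq> V \<and> irreducible_in X S"
proof
  assume *: "irreducible_in (subtopology X V) S"
  then have S: "S \<subseteq> V" "S \<subseteq> topspace X" "S \<noteq> {}" by (auto simp: irreducible_in_def)
  have "S \<subseteq> T \<or> S \<subseteq> U" if "closedin X T" "closedin X U" "S \<subseteq> T \<union> U" for T U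
  proof -
    have "closedin (subtopology X V) (T \<inter> V)" "closedin (subtopology X V) (U \<inter> V)"
      using that by (auto simp: closedin_subtopology)
    moreover have "S \<subseteq> (T \<inter> V) \<union> (U \<inter> V)" using that(3) S(1) by blast
    ultimately have "S \<subseteq> T \<inter> V \<or> S \<subseteq> U \<inter> V" by (rule irreducible_inD[OF *])
    then show ?thesis by blast
  qed
  then show "S \<subseteq> V \<and> irreducible_in X S" using S by (auto simp: irreducible_in_def)
next
  assume *: "S \<subseteq> V \<and> irreducible_in X S"
  have "S \<subseteq> T \<or> S \<subseteq> U"
    if T: "closedin (subtopology X V) T" and U: "closedin (subtopology X V) U" and "S \<subseteq> T \<union> U" for T U
  proof -
    obtain T' U' where T': "closedin X T'" "T = T' \<inter> V" and U': "closedin X U'" "U = U' \<inter> V"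
      using T U by (auto simp: closedin_subtopology)
    have "S \<subseteq> T' \<or> S \<subseteq> U'"
      by (rule irreducible_inD[OF _ T'(1) U'(1)]) (use * that(3) T' U' in auto)
    then show ?thesis using * T' U' by auto
  qed
  then show "irreducible_in (subtopology X V) S" using * by (auto simp: irreducible_in_def)
qed

lemma irreducible_in_finite_UN:
  assumes "irreducible_in X S" "finite I" "\<And>i. i \<in> I \<Longrightarrow> closedin X (T i)" "S \<subseteq> (\<Union>i\<in>I. T i)"
  shows "\<exists>i\<in>I. S \<subseteq> T i"
  using assms(2,3,4)
proof (induction I rule: finite_induct)
  case empty
  then show ?case using assms(1) by (auto simp: irreducible_in_def)
next
  case (insert i I)
  have "closedin X (\<Union>i\<in>I. T i)" using insert by (intro closedin_Union) auto
  then have "S \<subseteq> T i \<or> S \<subseteq> (\<Union>i\<in>I. T i)"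
    using irreducible_inD[OF assms(1)] insert.prems by simp
  then show ?case using insert by auto
qed

lemma irreducible_in_between:
  assumes "irreducible_in (zariski N) S" "S \<subseteq> T" "T \<subseteq> zcl N S"
  shows "irreducible_in (zariski N) T"
proof -
  have "T \<subseteq> carrier_vec N" using assms(3) by (auto simp: zcl_def zero_locus_def)
  moreover have "T \<subseteq> A \<or> T \<subseteq> B"
    if "closedin (zariski N) A" "closedin (zariski N) B" "T \<subseteq> A \<union> B" for A B
  proof -
    have "S \<subseteq> A \<or> S \<subseteq> B"
      using irreducible_inD[OF assms(1) that(1,2)] that(3) assms(2) by blast
    then show ?thesis using that zcl_least assms(3) by blast
  qed
  ultimately show ?thesis using assms by (auto simp: irreducible_in_def)
qed

text \<open>Zorn's lemma. The union of a chain of irreducible sets is irreducible, because points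
  outside \<open>T\<close> and outside \<open>U\<close> would both occur in the larger of two
  members of the chain.\<close>

lemma ex_irreducible_component:
  assumes "irreducible_in X S"
  shows "\<exists>Z\<in>irreducible_components X. S \<subseteq> Z"
proof -
  define \<A> where "\<A> = {W. irreducible_in X W \<and> S \<subseteq> W}"
  have "\<exists>M\<in>\<A>. \<forall>W\<in>\<A>. M \<subseteq> W \<longrightarrow> W = M"
  proof (rule subset_Zorn_nonempty)
    show "\<A> \<noteq> {}" using assms by (auto simp: \<A>_def)
    fix \<C> assume ne: "\<C> \<noteq> {}" and chain: "subset.chain \<A> \<C>"
    then have sub: "\<C> \<subseteq> \<A>" and tot: "\<And>W W'. W \<in> \<C> \<Longrightarrow> W' \<in> \<C> \<Longrightarrow> W \<subseteq> W' \<or> W' \<subseteq> W"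
      by (auto simp: subset_chain_def)
    have irr: "irreducible_in X W" "S \<subseteq> W" if "W \<in> \<C>" for W
      using that sub by (auto simp: \<A>_def)
    have "\<Union>\<C> \<subseteq> T \<or> \<Union>\<C> \<subseteq> U"
      if T: "closedin X T" and U: "closedin X U" and cov: "\<Union>\<C> \<subseteq> T \<union> U" for T U
    proof (rule ccontr)
      assume "\<not> ?thesis"
      then obtain W W' where W: "W \<in> \<C>" "\<not> W \<subseteq> T" "W' \<in> \<C>" "\<not> W' \<subseteq> U" by blast
      then obtain W'' where W'': "W'' \<in> \<C>" "W \<subseteq> W''" "W' \<subseteq> W''" using tot by blast
      have "W'' \<subseteq> T \<union> U" using W''(1) cov by blast
      then have "W'' \<subseteq> T \<or> W'' \<subseteq> U"
        using irreducible_inD[OF irr(1)[OF W''(1)] T U] by simp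
      then show False using W W'' by blast
    qed
    moreover have "\<Union>\<C> \<subseteq> topspace X" using irr(1) by (fastforce simp: irreducible_in_def)
    moreover obtain W where W: "W \<in> \<C>" using ne by blast
    moreover have "\<Union>\<C> \<noteq> {}" "S \<subseteq> \<Union>\<C>"
      using irr[OF W] W by (auto simp: irreducible_in_def)
    ultimately show "\<Union>\<C> \<in> \<A>" by (auto simp: \<A>_def irreducible_in_def)
  qed
  then obtain M where M: "M \<in> \<A>" "\<forall>W\<in>\<A>. M \<subseteq> W \<longrightarrow> W = M" by auto
  then have "irreducible_in X M" "S \<subseteq> M" by (auto simp: \<A>_def)
  moreover have "W = M" if "irreducible_in X W" "M \<subseteq> W" for W
    using M(2)[rule_format, of W] that \<open>S \<subseteq> M\<close> by (simp add: \<A>_def)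
  ultimately show ?thesis by (intro bexI[of _ M]) (auto simp: irreducible_components_def)
qed

text \<open>If \<open>f\<close> vanishes on \<open>Z'\<close> but not on \<open>Z\<close>, then a family \<open>g i\<close> that is independent on \<open>Z'\<close>
  gives the family \<open>f ^ j * g i\<close> independent on \<open>Z\<close>: compare the coefficients of the powers of
  \<open>f\<close> one after the other. With \<open>j\<close> up to the degree bound, this costs one in the exponent.\<close>

lemma indep_on_powers:
  fixes f :: "'k::idom vec \<Rightarrow> 'k"
  assumes "irreducible_in (zariski N) Z" "Z' \<subseteq> Z" "f \<in> poly_funs N" "\<And>x. x \<in> Z' \<Longrightarrow> f x = 0"
    "y \<in> Z" "f y \<noteq> 0" "\<And>i. i \<in> I \<Longrightarrow> g i \<in> poly_funs N" "indep_on Z' I g"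
  shows "indep_on Z ({..<J} \<times> I) (\<lambda>(j, i) x. f x ^ j * g i x)"
proof -
  have main: "\<forall>j<J. \<forall>i\<in>I. c j i = 0"
    if "\<forall>x\<in>Z. (\<Sum>j<J. f x ^ j * (\<Sum>i\<in>I. c j i * g i x)) = 0" for c :: "nat \<Rightarrow> 'a \<Rightarrow> 'k"
    using that
  proof (induction J arbitrary: c)
    case (Suc J)
    let ?h = "\<lambda>x. \<Sum>j<J. f x ^ j * (\<Sum>i\<in>I. c (Suc j) i * g i x)"
    have split: "(\<Sum>j<Suc J. f x ^ j * (\<Sum>i\<in>I. c j i * g i x)) = (\<Sum>i\<in>I. c 0 i * g i x) + f x * ?h x" for x
      by (simp add: sum.lessThan_Suc_shift sum_distrib_left mult.assoc del: sum.lessThan_Suc)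
    have "\<forall>x\<in>Z'. (\<Sum>i\<in>I. c 0 i * g i x) = 0"
      using Suc.prems assms(2,4) unfolding split by fastforce
    then have c0: "\<forall>i\<in>I. c 0 i = 0" using assms(8) by (auto simp: indep_on_def)
    have "?h \<in> poly_funs N"
      using assms(3,7) unfolding polys_coords[symmetric] by (intro polys_sum polys_mult polys_power) auto
    moreover have "f x * ?h x = 0" if "x \<in> Z" for x
      using Suc.prems that c0 unfolding split by simp
    \<comment> \<open>The factor \<open>f\<close> is cancelled on \<open>Z\<close>, which is where
      irreducibility enters.\<close>
    ultimately have "\<forall>x\<in>Z. ?h x = 0"
      using irreducible_in_mult_eq_0[OF assms(1,3)] assms(5,6) by blast
    from Suc.IH[OF this] c0 show ?case by (auto simp: less_Suc_eq_0_disj)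
  qed simp
  show ?thesis unfolding indep_on_def
  proof (intro allI impI)
    fix c assume *: "\<forall>x\<in>Z. (\<Sum>p\<in>{..<J} \<times> I. c p * (case p of (j, i) \<Rightarrow> \<lambda>x. f x ^ j * g i x) x) = 0"
    have "(\<Sum>j<J. f x ^ j * (\<Sum>i\<in>I. c (j, i) * g i x)) =
      (\<Sum>p\<in>{..<J} \<times> I. c p * (case p of (j, i) \<Rightarrow> \<lambda>x. f x ^ j * g i x) x)" for x
      unfolding sum_distrib_left sum.cartesian_product by (rule sum.cong) (auto simp: mult_ac)
    then show "\<forall>p\<in>{..<J} \<times> I. c p = 0" using main[of "\<lambda>j i. c (j, i)"] * by auto
  qed
qed

lemma growth_le_drop:
  fixes f :: "'k::idom vec \<Rightarrow> 'k"
  assumes "irreducible_in (zariski N) Z" "Z' \<subseteq> Z" "Z' \<noteq> {}" "f \<in> poly_funs N"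
    "\<And>x. x \<in> Z' \<Longrightarrow> f x = 0" "y \<in> Z" "f y \<noteq> 0" "growth_le (coords N) Z d"
  shows "\<exists>d'. d = Suc d' \<and> growth_le (coords N) Z' d'"
proof -
  obtain C where C: "\<And>m (I :: (nat \<times> nat) set) F. finite I \<Longrightarrow>
      (\<And>i. i \<in> I \<Longrightarrow> poly_le (coords N) m (F i)) \<Longrightarrow> indep_on Z I F \<Longrightarrow> card I \<le> C * (m + 1) ^ d"
    using growth_le_finite_family[OF assms(8)] by blast
  obtain e where e: "poly_le (coords N) e f"
    using assms(4) by (auto simp: polys_coords[symmetric] polys_def)
  have bound: "J * a \<le> C * (e * J + m + 1) ^ d"
    if g: "\<forall>i<a. poly_le (coords N) m (g i)" and ind: "indep_on Z' {..<a} g" for a m J g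
  proof -
    have "card ({..<J} \<times> {..<a}) \<le> C * (e * J + m + 1) ^ d"
    proof (rule C)
      have "g i \<in> poly_funs N" if "i \<in> {..<a}" for i
        using g that by (auto simp: polys_coords[symmetric] polys_def)
      then show "indep_on Z ({..<J} \<times> {..<a}) (\<lambda>(j, i) x. f x ^ j * g i x)"
        by (intro indep_on_powers[OF assms(1,2,4,5,6,7) _ ind])
    next
      fix p assume "p \<in> {..<J} \<times> {..<a}"
      then obtain j i where p: "p = (j, i)" "j < J" "i < a" by auto
      have "poly_le (coords N) (e * j + m) (\<lambda>x. f x ^ j * g i x)"
        using p g by (intro poly_le.mult poly_le_power e) auto
      then show "poly_le (coords N) (e * J + m) (case p of (j, i) \<Rightarrow> \<lambda>x. f x ^ j * g i x)"
        using p by (auto elim: poly_le_mono)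
    qed auto
    then show ?thesis by simp
  qed
  have one: "indep_on Z' {..<1::nat} (\<lambda>_ _. 1 :: 'k)"
    using assms(3) by (auto simp: indep_on_def)
  show ?thesis
  proof (cases d)
    case 0
    \<comment> \<open>Exponent 0 is impossible: the powers of \<open>f\<close> alone, multiplied by
      the constant 1, already give \<open>C + 1\<close> independent functions.\<close>
    have "Suc C * 1 \<le> C * (e * Suc C + 0 + 1) ^ d"
      by (rule bound[OF _ one]) (auto intro: poly_le.const)
    then show ?thesis using 0 by simp
  next
    case (Suc d')
    have "growth_le (coords N) Z' d'" unfolding growth_le_def
    proof (intro exI[of _ "C * (e + 1) ^ d"] allI impI)
      fix m a and g :: "nat \<Rightarrow> 'k vec \<Rightarrow> 'k"
      assume "\<forall>i<a. poly_le (coords N) m (g i)" "indep_on Z' {..<a} g"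
      \<comment> \<open>The bound is taken with \<open>J = m + 1\<close> powers of \<open>f\<close>:
        the degrees still grow linearly in \<open>m\<close>, and one factor \<open>m + 1\<close>
        cancels.\<close>
      then have "(m + 1) * a \<le> C * (e * (m + 1) + m + 1) ^ d" by (rule bound)
      also have "e * (m + 1) + m + 1 = (e + 1) * (m + 1)" by simp
      finally have "(m + 1) * a \<le> (m + 1) * (C * (e + 1) ^ d * (m + 1) ^ d')"
        unfolding Suc power_mult_distrib power_Suc by (simp only: mult_ac)
      then show "a \<le> C * (e + 1) ^ d * (m + 1) ^ d'" by (rule mult_left_le_imp_le) simp
    qed
    then show ?thesis using Suc by blast
  qed
qed

section \<open>Chains of irreducible sets and bounds on the dimension\<close>

lemma chain_length_le_growth:
  fixes c :: "nat \<Rightarrow> 'k::idom vec set"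
  assumes "\<forall>i\<le>d. closedin (subtopology (zariski N) Z) (c i) \<and> irreducible_in (zariski N) (c i)"
    "\<forall>i<d. c i \<subset> c (Suc i)" "growth_le (coords N) (c d) D"
  shows "d \<le> D"
  using assms
proof (induction d arbitrary: D)
  case (Suc d)
  obtain y where y: "y \<in> c (Suc d)" "y \<notin> c d" using Suc.prems(2) by blast
  have "c (Suc d) \<subseteq> Z" using Suc.prems(1) closedin_subset by fastforce
  obtain T where T: "closedin (zariski N) T" "c d = T \<inter> Z"
    using Suc.prems(1)[rule_format, of d] by (auto simp: closedin_subtopology)
  then obtain P where P: "P \<subseteq> poly_funs N" "T = zero_locus N P"
    by (auto simp: closedin_zariski zariski_closed_def)
  have irr: "irreducible_in (zariski N) (c (Suc d))" "irreducible_in (zariski N) (c d)"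
    using Suc.prems(1) by auto
  have "y \<in> carrier_vec N" using irr y by (auto simp: irreducible_in_def)
  \<comment> \<open>Since \<open>y\<close> lies in \<open>Z\<close> but not in \<open>c d\<close>,
    it lies outside \<open>T\<close>, so one of the equations of \<open>T\<close> separates it from
    \<open>c d\<close>.\<close>
  then obtain f where f: "f \<in> P" "f y \<noteq> 0"
    using y \<open>c (Suc d) \<subseteq> Z\<close> T P unfolding zero_locus_def by blast
  have "\<exists>D'. D = Suc D' \<and> growth_le (coords N) (c d) D'"
  proof (rule growth_le_drop[where f = f and y = y, OF irr(1) _ _ _ _ y(1) f(2) Suc.prems(3)])
    show "c d \<subseteq> c (Suc d)" using Suc.prems(2) by blast
    show "c d \<noteq> {}" using irr by (auto simp: irreducible_in_def)
    show "f \<in> poly_funs N" using f P by auto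
    show "f x = 0" if "x \<in> c d" for x using that f T P by (auto simp: zero_locus_def)
  qed
  then obtain D' where "D = Suc D'" "growth_le (coords N) (c d) D'" by blast
  then show ?case using Suc.IH[of D'] Suc.prems by auto
qed simp

text \<open>A linear relation between polynomial functions that holds on \<open>S\<close> persists
  on its closure, so independence on \<open>T\<close> implies independence on
  \<open>S\<close>.\<close>

lemma growth_le_zcl:
  fixes S T :: "'k::idom vec set"
  assumes "growth_le (coords N) S d" "T \<subseteq> zcl N S"
  shows "growth_le (coords N) T d"
proof -
  obtain C where C: "\<And>m a F. (\<forall>i<a. poly_le (coords N) m (F i)) \<Longrightarrow> indep_on S {..<a} F \<Longrightarrow>
    a \<le> C * (m + 1) ^ d"
    using assms unfolding growth_le_def by blast
  show ?thesis unfolding growth_le_def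
  proof (intro exI[of _ C] allI impI)
    fix m a and F :: "nat \<Rightarrow> 'k vec \<Rightarrow> 'k"
    assume F: "\<forall>i<a. poly_le (coords N) m (F i)" and ind: "indep_on T {..<a} F"
    have "indep_on S {..<a} F" unfolding indep_on_def
    proof (intro allI impI)
      fix c assume *: "\<forall>x\<in>S. (\<Sum>i<a. c i * F i x) = 0"
      have "(\<lambda>x. \<Sum>i<a. c i * F i x) \<in> poly_funs N"
        using F unfolding polys_coords[symmetric] by (intro polys_sum polys_mult polys_const) (auto simp: polys_def)
      then have "\<forall>x\<in>T. (\<Sum>i<a. c i * F i x) = 0" using zcl_eqD * assms(2) by blast
      then show "\<forall>i\<in>{..<a}. c i = 0" using ind by (auto simp: indep_on_def)
    qed
    then show "a \<le> C * (m + 1) ^ d" using C F by blast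
  qed
qed

text \<open>The largest member of a chain is irreducible, hence contained in a single one of the
  finitely many closures, and inherits the exponent of that one.\<close>

lemma variety_dim_le:
  fixes V :: "'k::idom vec set"
  assumes "finite I" "V \<subseteq> (\<Union>i\<in>I. zcl N (S i))" "\<And>i. i \<in> I \<Longrightarrow> growth_le (coords N) (S i) D"
  shows "variety_dim N V \<le> enat D"
  unfolding variety_dim_def
proof (rule SUP_least)
  fix Z assume "Z \<in> irreducible_components (subtopology (zariski N) V)"
  then have Z: "Z \<subseteq> V"
    by (auto simp: irreducible_components_def irreducible_in_subtopology_iff)
  show "krull_dim (subtopology (zariski N) Z) \<le> enat D"
    unfolding krull_dim_def
  proof (rule Sup_least, clarify)
    fix d and c :: "nat \<Rightarrow> 'k vec set"
    assume c: "\<forall>i\<le>d. closedin (subtopology (zariski N) Z) (c i) \<and>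
        irreducible_in (subtopology (zariski N) Z) (c i)"
      and strict: "\<forall>i<d. c i \<subset> c (Suc i)"
    have irr: "irreducible_in (zariski N) (c d)" "c d \<subseteq> V"
      using c Z by (auto simp: irreducible_in_subtopology_iff)
    have "\<exists>i\<in>I. c d \<subseteq> zcl N (S i)"
      by (rule irreducible_in_finite_UN[OF irr(1) assms(1) closedin_zcl]) (use irr(2) assms(2) in blast)
    then obtain i where "i \<in> I" "c d \<subseteq> zcl N (S i)" by blast
    then have "growth_le (coords N) (c d) D" using growth_le_zcl assms(3) by blast
    moreover have "\<forall>i\<le>d. closedin (subtopology (zariski N) Z) (c i) \<and> irreducible_in (zariski N) (c i)"
      using c by (auto simp: irreducible_in_subtopology_iff)
    ultimately show "enat d \<le> enat D" using chain_length_le_growth[OF _ strict] by auto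
  qed
qed

text \<open>The sets \<open>S i\<close> need not be closed, which suits images of polynomial maps. A
  polynomial that vanishes on \<open>S i\<close> also vanishes on its closure, so strictness
  survives when closures are taken.\<close>

lemma variety_dim_ge:
  fixes V :: "'k::idom vec set"
  assumes irr: "\<And>i. i \<le> D \<Longrightarrow> irreducible_in (zariski N) (S i)"
    and mono: "\<And>i. i < D \<Longrightarrow> S i \<subseteq> S (Suc i)" and "S D \<subseteq> V"
    and strict: "\<And>i. i < D \<Longrightarrow> \<exists>f\<in>poly_funs N. (\<forall>x\<in>S i. f x = 0) \<and> (\<exists>x\<in>S (Suc i). f x \<noteq> 0)"
  shows "enat D \<le> variety_dim N V"
proof -
  have "irreducible_in (subtopology (zariski N) V) (S D)"
    using irr[of D] assms(3) by (simp add: irreducible_in_subtopology_iff)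
  then obtain Z where Z: "Z \<in> irreducible_components (subtopology (zariski N) V)" "S D \<subseteq> Z"
    using ex_irreducible_component by blast
  have mono': "S i \<subseteq> S j" if "i \<le> j" "j \<le> D" for i j
    using that(1,2)
  proof (induction j rule: dec_induct)
    case (step j)
    then show ?case using mono[of j] by auto
  qed simp
  \<comment> \<open>Intersecting with the component makes the sets closed in it; they lie between
    \<open>S i\<close> and its closure and so remain irreducible.\<close>
  define c where "c i = Z \<inter> zcl N (S i)" for i
  have carr: "S i \<subseteq> carrier_vec N" if "i \<le> D" for i
    using irr[OF that] by (auto simp: irreducible_in_def)
  have sub: "S i \<subseteq> c i" if "i \<le> D" for i
    using mono'[OF that] Z(2) zcl_superset[OF carr[OF that]] by (auto simp: c_def)
  have "closedin (subtopology (zariski N) Z) (c i) \<and> irreducible_in (subtopology (zariski N) Z) (c i)"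
    if "i \<le> D" for i
  proof
    show "closedin (subtopology (zariski N) Z) (c i)"
      unfolding c_def closedin_subtopology using closedin_zcl by blast
    show "irreducible_in (subtopology (zariski N) Z) (c i)"
      using irreducible_in_between[OF irr[OF that] sub[OF that]]
      by (auto simp: irreducible_in_subtopology_iff c_def)
  qed
  moreover have "c i \<subset> c (Suc i)" if i: "i < D" for i
  proof
    have "S i \<subseteq> zcl N (S (Suc i))"
      using mono[OF i] zcl_superset[OF carr[of "Suc i"]] i by auto
    then show "c i \<subseteq> c (Suc i)"
      using zcl_least[OF closedin_zcl, of "S i"] by (auto simp: c_def)
    obtain f x where f: "f \<in> poly_funs N" "\<forall>x\<in>S i. f x = 0" "x \<in> S (Suc i)" "f x \<noteq> 0"
      using strict[OF i] by blast
    then have "x \<in> c (Suc i)" "x \<notin> c i"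
      using sub[of "Suc i"] i zcl_eqD[of x N "S i" f] by (auto simp: c_def)
    then show "c i \<noteq> c (Suc i)" by blast
  qed
  ultimately have "enat D \<le> krull_dim (subtopology (zariski N) Z)"
    unfolding krull_dim_def by (intro Sup_upper CollectI exI[of _ D] exI[of _ c]) auto
  also have "\<dots> \<le> variety_dim N V"
    unfolding variety_dim_def using Z(1) by (rule SUP_upper)
  finally show ?thesis .
qed

section \<open>Curves\<close>

text \<open>Two parameter points where \<open>f\<close> and \<open>g\<close> respectively do not
  vanish are joined by a line inside the linear space; both functions are then nonzero at almost all
  points of that line.\<close>

lemma irreducible_in_range_linear_space:
  fixes \<phi> :: "('p \<Rightarrow> 'k::alg_closed_field) \<Rightarrow> 'k vec"
  assumes "\<And>w. \<phi> w \<in> carrier_vec N" "\<And>i. i < N \<Longrightarrow> (\<lambda>w. \<phi> w $ i) \<in> polys (range (\<lambda>p w. w p))"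
  shows "irreducible_in (zariski N) (\<phi> ` {w. \<forall>p\<in>Q. w p = 0})"
proof -
  define W where "W = {w :: 'p \<Rightarrow> 'k. \<forall>p\<in>Q. w p = 0}"
  have "irreducible_in (zariski N) (\<phi> ` W)"
  proof (rule irreducible_in_zariskiI)
    have "(\<lambda>_. 0) \<in> W" by (simp add: W_def)
    then show "\<phi> ` W \<noteq> {}" by auto
  next
    fix f g :: "'k vec \<Rightarrow> 'k"
    assume f: "f \<in> poly_funs N" and g: "g \<in> poly_funs N"
      and fg: "\<And>x. x \<in> \<phi> ` W \<Longrightarrow> f x * g x = 0"
    show "(\<forall>x\<in>\<phi> ` W. f x = 0) \<or> (\<forall>x\<in>\<phi> ` W. g x = 0)"
    proof (rule ccontr)
      assume "\<not> ?thesis"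
      then obtain u v where u: "u \<in> W" "f (\<phi> u) \<noteq> 0" and v: "v \<in> W" "g (\<phi> v) \<noteq> 0"
        by auto
      define l where "l t p = u p + t * (v p - u p)" for t p
      have l: "l 0 = u" "l 1 = v" by (auto simp: l_def)
      have lin: "(\<lambda>t. l t p) \<in> polys {\<lambda>t. t}" for p
        unfolding l_def by (intro polys_add polys_mult polys_const polys_gen) auto
      have "(\<lambda>t. \<phi> (l t) $ i) \<in> polys {\<lambda>t. t}" if "i < N" for i
        using polys_compose[where \<phi> = l, OF assms(2)[OF that]] lin by auto
      then have "(\<lambda>t. h (\<phi> (l t))) \<in> polys {\<lambda>t. t}" if "h \<in> poly_funs N" for h
        using polys_compose[where \<phi> = "\<lambda>t. \<phi> (l t)", OF that[folded polys_coords]]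
        by (auto simp: coords_def)
      then have "MOST t. f (\<phi> (l t)) \<noteq> 0" "MOST t. g (\<phi> (l t)) \<noteq> 0"
        using MOST_polys_neq_0[of _ 0] MOST_polys_neq_0[of _ 1] f g l u v by auto
      then have "MOST t. f (\<phi> (l t)) * g (\<phi> (l t)) \<noteq> 0"
        by eventually_elim simp
      then obtain t where "f (\<phi> (l t)) * g (\<phi> (l t)) \<noteq> 0"
        using MOST_alg_closed_field_ex by blast
      moreover have "l t \<in> W" using u v by (auto simp: l_def W_def)
      ultimately show False using fg[of "\<phi> (l t)"] by auto
    qed
  qed (use assms in auto)
  then show ?thesis by (simp add: W_def)
qed

text \<open>Along a curve with common denominator \<open>q\<close>, a polynomial function becomes
  polynomial in \<open>t\<close> after multiplication by a power of \<open>q\<close>. The identity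
  is claimed only off the zeros of \<open>q\<close>, where the division is meaningful.\<close>

lemma poly_funs_clear_denominator:
  fixes x :: "'k::idom \<Rightarrow> 'k vec"
  assumes "f \<in> poly_funs N" "q \<in> polys {\<lambda>t. t}"
    "\<And>i. i < N \<Longrightarrow> \<exists>p\<in>polys {\<lambda>t. t}. \<forall>t. q t \<noteq> 0 \<longrightarrow> q t * x t $ i = p t"
  shows "\<exists>k. \<exists>h\<in>polys {\<lambda>t. t}. \<forall>t. q t \<noteq> 0 \<longrightarrow> q t ^ k * f (x t) = h t"
  using assms(1)
proof induction
  case (const c)
  show ?case by (intro exI[of _ 0] bexI[of _ "\<lambda>_. c"]) auto
next
  case (coord i)
  from assms(3)[OF this] show ?case by (intro exI[of _ 1]) simp
next
  case (add f g)
  then obtain k h k' h' where *: "h \<in> polys {\<lambda>t. t}" "\<And>t. q t \<noteq> 0 \<Longrightarrow> q t ^ k * f (x t) = h t"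
    "h' \<in> polys {\<lambda>t. t}" "\<And>t. q t \<noteq> 0 \<Longrightarrow> q t ^ k' * g (x t) = h' t" by blast
  have "q t ^ (k + k') * (f (x t) + g (x t)) = q t ^ k' * h t + q t ^ k * h' t" if "q t \<noteq> 0" for t
    using *(2,4)[OF that, symmetric] by (simp add: power_add algebra_simps)
  moreover have "(\<lambda>t. q t ^ k' * h t + q t ^ k * h' t) \<in> polys {\<lambda>t. t}"
    by (intro polys_add polys_mult polys_power * assms(2))
  ultimately show ?case
    by (intro exI[of _ "k + k'"] bexI[of _ "\<lambda>t. q t ^ k' * h t + q t ^ k * h' t"]) simp_all
next
  case (mult f g)
  then obtain k h k' h' where *: "h \<in> polys {\<lambda>t. t}" "\<And>t. q t \<noteq> 0 \<Longrightarrow> q t ^ k * f (x t) = h t"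
    "h' \<in> polys {\<lambda>t. t}" "\<And>t. q t \<noteq> 0 \<Longrightarrow> q t ^ k' * g (x t) = h' t" by blast
  have "q t ^ (k + k') * (f (x t) * g (x t)) = h t * h' t" if "q t \<noteq> 0" for t
    using *(2,4)[OF that, symmetric] by (simp add: power_add algebra_simps)
  moreover have "(\<lambda>t. h t * h' t) \<in> polys {\<lambda>t. t}" by (intro polys_mult *)
  ultimately show ?case
    by (intro exI[of _ "k + k'"] bexI[of _ "\<lambda>t. h t * h' t"]) simp_all
qed

text \<open>A substitute for taking limits: the numerator of an equation of the closure has
  infinitely many zeros along the curve, hence is the zero polynomial and vanishes at 0, where the
  denominator does not.\<close>

lemma rational_curve_in_zcl:
  fixes x :: "'k::alg_closed_field \<Rightarrow> 'k vec"
  assumes "x 0 \<in> carrier_vec N" "q \<in> polys {\<lambda>t. t}" "q 0 \<noteq> 0"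
    "\<And>i. i < N \<Longrightarrow> \<exists>p\<in>polys {\<lambda>t. t}. \<forall>t. q t \<noteq> 0 \<longrightarrow> q t * x t $ i = p t"
    "MOST t. x t \<in> zcl N S"
  shows "x 0 \<in> zcl N S"
proof -
  have "f (x 0) = 0" if f: "f \<in> poly_funs N" and van: "\<forall>y\<in>S. f y = 0" for f
  proof -
    obtain k h where h: "h \<in> polys {\<lambda>t. t}" "\<And>t. q t \<noteq> 0 \<Longrightarrow> q t ^ k * f (x t) = h t"
      using poly_funs_clear_denominator[OF f assms(2,4)] by blast
    have van': "h t = 0" if "q t \<noteq> 0" "x t \<in> zcl N S" for t
      using h(2)[OF that(1)] zcl_eqD[OF that(2) f] van by simp
    have "MOST t. q t \<noteq> 0" by (rule MOST_polys_neq_0[OF assms(2,3)])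
    then have "MOST t. h t = 0" using assms(5) by eventually_elim (rule van')
    have "h 0 = 0"
    proof (rule ccontr)
      assume "h 0 \<noteq> 0"
      then have "MOST t. h t \<noteq> 0" by (rule MOST_polys_neq_0[OF h(1)])
      with \<open>MOST t. h t = 0\<close> have "MOST t :: 'k. False" by eventually_elim simp
      then show False using MOST_alg_closed_field_ex by blast
    qed
    then show ?thesis using h(2)[OF assms(3)] assms(3) by auto
  qed
  then show ?thesis using assms(1) by (auto simp: zcl_def zero_locus_def)
qed

section \<open>Matrix algebra\<close>

text \<open>The ring laws are stated with side conditions on the dimensions of the arguments only, so
  that the simplifier can discharge them.\<close>

lemma mat_dim_laws:
  fixes A B C :: "'k::comm_ring_1 mat"
  shows mult_assoc_dim: "dim_col A = dim_row B \<Longrightarrow> dim_col B = dim_row C \<Longrightarrow> A * B * C = A * (B * C)"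
    and add_mult_dim: "dim_row A = dim_row B \<Longrightarrow> dim_col A = dim_col B \<Longrightarrow> dim_col A = dim_row C \<Longrightarrow>
      (A + B) * C = A * C + B * C"
    and mult_add_dim: "dim_row A = dim_row B \<Longrightarrow> dim_col A = dim_col B \<Longrightarrow> dim_col C = dim_row A \<Longrightarrow>
      C * (A + B) = C * A + C * B"
    and add_assoc_dim: "dim_row A = dim_row B \<Longrightarrow> dim_col A = dim_col B \<Longrightarrow> dim_row B = dim_row C \<Longrightarrow>
      dim_col B = dim_col C \<Longrightarrow> A + B + C = A + (B + C)"
    and add_comm_dim: "dim_row A = dim_row B \<Longrightarrow> dim_col A = dim_col B \<Longrightarrow> A + B = B + A"
    and add_left_comm_dim: "dim_row A = dim_row B \<Longrightarrow> dim_col A = dim_col B \<Longrightarrow> dim_row B = dim_row C \<Longrightarrow>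
      dim_col B = dim_col C \<Longrightarrow> A + (B + C) = B + (A + C)"
    and uminus_mult_dim: "dim_col A = dim_row B \<Longrightarrow> - A * B = - (A * B)"
    and mult_uminus_dim: "dim_col A = dim_row B \<Longrightarrow> A * - B = - (A * B)"
    and uminus_add_dim: "dim_row A = dim_row B \<Longrightarrow> dim_col A = dim_col B \<Longrightarrow> - (A + B) = - A + - B"
    and minus_dim: "dim_row A = dim_row B \<Longrightarrow> dim_col A = dim_col B \<Longrightarrow> A - B = A + - B"
    and add_uminus_dim: "A + - A = 0\<^sub>m (dim_row A) (dim_col A)"
    and uminus_add_self_dim: "- A + A = 0\<^sub>m (dim_row A) (dim_col A)"
    and add_uminus_cancel_dim: "dim_row A = dim_row B \<Longrightarrow> dim_col A = dim_col B \<Longrightarrow> A + (- A + B) = B"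
    and uminus_add_cancel_dim: "dim_row A = dim_row B \<Longrightarrow> dim_col A = dim_col B \<Longrightarrow> - A + (A + B) = B"
    and smult_mult_dim: "dim_col A = dim_row B \<Longrightarrow> (k \<cdot>\<^sub>m A) * B = k \<cdot>\<^sub>m (A * B)"
    and mult_smult_dim: "dim_col A = dim_row B \<Longrightarrow> A * (k \<cdot>\<^sub>m B) = k \<cdot>\<^sub>m (A * B)"
    and smult_add_dim: "dim_row A = dim_row B \<Longrightarrow> dim_col A = dim_col B \<Longrightarrow>
      k \<cdot>\<^sub>m (A + B) = k \<cdot>\<^sub>m A + k \<cdot>\<^sub>m B"
    and smult_smult_dim: "k \<cdot>\<^sub>m (l \<cdot>\<^sub>m A) = (k * l) \<cdot>\<^sub>m A"
    and smult_uminus_dim: "k \<cdot>\<^sub>m (- A) = - (k \<cdot>\<^sub>m A)"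
    and one_mult_dim: "dim_row A = n \<Longrightarrow> 1\<^sub>m n * A = A"
    and mult_one_dim: "dim_col A = n \<Longrightarrow> A * 1\<^sub>m n = A"
    and zero_mult_dim: "dim_row A = m \<Longrightarrow> 0\<^sub>m n m * A = 0\<^sub>m n (dim_col A)"
    and mult_zero_dim: "dim_col A = m \<Longrightarrow> A * 0\<^sub>m m n = 0\<^sub>m (dim_row A) n"
    and zero_add_dim: "dim_row A = n \<Longrightarrow> dim_col A = m \<Longrightarrow> 0\<^sub>m n m + A = A"
    and add_zero_dim: "dim_row A = n \<Longrightarrow> dim_col A = m \<Longrightarrow> A + 0\<^sub>m n m = A"
    and uminus_uminus_dim: "- (- A) = A"
    and uminus_zero_dim: "- (0\<^sub>m n m :: 'k mat) = 0\<^sub>m n m"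
    and one_smult_dim: "1 \<cdot>\<^sub>m A = A"
proof -
  show "dim_col A = dim_row B \<Longrightarrow> dim_col B = dim_row C \<Longrightarrow> A * B * C = A * (B * C)"
    by (rule assoc_mult_mat[of _ "dim_row A" "dim_col A" _ "dim_col B" _ "dim_col C"]) auto
  show "dim_row A = dim_row B \<Longrightarrow> dim_col A = dim_col B \<Longrightarrow> dim_col A = dim_row C \<Longrightarrow>
      (A + B) * C = A * C + B * C"
    by (rule add_mult_distrib_mat[of _ "dim_row A" "dim_col A" _ _ "dim_col C"]) auto
  show "dim_row A = dim_row B \<Longrightarrow> dim_col A = dim_col B \<Longrightarrow> dim_col C = dim_row A \<Longrightarrow>
      C * (A + B) = C * A + C * B"
    by (rule mult_add_distrib_mat[of _ "dim_row C" "dim_col C" _ "dim_col A"]) auto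
  show "dim_col A = dim_row B \<Longrightarrow> - A * B = - (A * B)"
    by (rule uminus_mult_left_mat) auto
  show "dim_col A = dim_row B \<Longrightarrow> A * - B = - (A * B)"
    by (rule uminus_mult_right_mat) auto
  show "dim_col A = dim_row B \<Longrightarrow> (k \<cdot>\<^sub>m A) * B = k \<cdot>\<^sub>m (A * B)"
    by (rule mult_smult_assoc_mat[of _ "dim_row A" "dim_col A" _ "dim_col B"]) auto
  show "dim_col A = dim_row B \<Longrightarrow> A * (k \<cdot>\<^sub>m B) = k \<cdot>\<^sub>m (A * B)"
    by (rule mult_smult_distrib[of _ "dim_row A" "dim_col A" _ "dim_col B"]) auto
  show "dim_row A = n \<Longrightarrow> 1\<^sub>m n * A = A" by (rule left_mult_one_mat[of _ _ "dim_col A"]) auto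
  show "dim_col A = n \<Longrightarrow> A * 1\<^sub>m n = A" by (rule right_mult_one_mat[of _ "dim_row A"]) auto
  show "dim_row A = m \<Longrightarrow> 0\<^sub>m n m * A = 0\<^sub>m n (dim_col A)"
    by (rule left_mult_zero_mat[of _ _ "dim_col A"]) auto
  show "dim_col A = m \<Longrightarrow> A * 0\<^sub>m m n = 0\<^sub>m (dim_row A) n"
    by (rule right_mult_zero_mat[of _ "dim_row A"]) auto
qed (auto simp: algebra_simps intro!: eq_matI)

lemma mult_mat_entry:
  assumes "i < dim_row A" "j < dim_col B" "dim_col A = dim_row B"
  shows "(A * B) $$ (i, j) = (\<Sum>k<dim_col A. A $$ (i, k) * B $$ (k, j))"
  using assms by (simp add: scalar_prod_def atLeast0LessThan)

definition inverse_pair :: "nat \<Rightarrow> 'k::comm_ring_1 mat \<Rightarrow> 'k mat \<Rightarrow> bool" where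
  "inverse_pair n P P' \<longleftrightarrow> P \<in> carrier_mat n n \<and> P' \<in> carrier_mat n n \<and> P * P' = 1\<^sub>m n \<and> P' * P = 1\<^sub>m n"

text \<open>The last two facts cancel a factor against its inverse inside products associated to the
  right, the form into which \<open>mat_dim_laws\<close> rewrites products.\<close>

lemma inverse_pairD:
  assumes "inverse_pair n P P'"
  shows "P \<in> carrier_mat n n" "P' \<in> carrier_mat n n" "dim_row P = n" "dim_col P = n"
    "dim_row P' = n" "dim_col P' = n" "P * P' = 1\<^sub>m n" "P' * P = 1\<^sub>m n"
    "dim_row A = n \<Longrightarrow> P * (P' * A) = A" "dim_row A = n \<Longrightarrow> P' * (P * A) = A"
proof -
  show *: "P \<in> carrier_mat n n" "P' \<in> carrier_mat n n" "P * P' = 1\<^sub>m n" "P' * P = 1\<^sub>m n"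
    using assms by (auto simp: inverse_pair_def)
  then show dims: "dim_row P = n" "dim_col P = n" "dim_row P' = n" "dim_col P' = n" by auto
  show "P * (P' * A) = A" "P' * (P * A) = A" if "dim_row A = n"
    using that * dims mult_assoc_dim[of P P' A] mult_assoc_dim[of P' P A] one_mult_dim[of A n] by auto
qed

lemma inverse_pair_mult:
  assumes "inverse_pair n P P'" "inverse_pair n Q Q'"
  shows "inverse_pair n (P * Q) (Q' * P')"
  unfolding inverse_pair_def
  using inverse_pairD[OF assms(1)] inverse_pairD[OF assms(2)] by (auto simp: mat_dim_laws)

lemma inverse_pair_one: "inverse_pair n (1\<^sub>m n) (1\<^sub>m n)"
  by (auto simp: inverse_pair_def)

lemma inverse_pair_adj_mat:
  fixes P :: "'k::field mat"
  assumes "P \<in> carrier_mat n n" "det P \<noteq> 0"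
  shows "inverse_pair n P ((1 / det P) \<cdot>\<^sub>m adj_mat P)"
proof -
  note adj = adj_mat[OF assms(1)]
  have "dim_row P = n" "dim_col P = n" "dim_row (adj_mat P) = n" "dim_col (adj_mat P) = n"
    using assms(1) adj(1) by auto
  then show ?thesis unfolding inverse_pair_def
    using assms adj by (auto simp: mat_dim_laws)
qed

lemma inverse_pair_unique:
  assumes "inverse_pair n P P'" "inverse_pair n P P''"
  shows "P' = P''"
proof -
  have "P' = P' * (P * P'')"
    using inverse_pairD[OF assms(1)] inverse_pairD[OF assms(2)] by (simp add: mult_one_dim)
  also have "\<dots> = P''" using inverse_pairD(10)[OF assms(1)] inverse_pairD(5)[OF assms(2)] .
  finally show ?thesis .
qed

lemma inverse_pair_det:
  fixes P :: "'k::field mat"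
  assumes "inverse_pair n P P'"
  shows "det P \<noteq> 0"
  using det_mult[of P n P'] inverse_pairD[OF assms] by auto

section \<open>Block matrices\<close>

definition block_diag :: "nat \<Rightarrow> nat \<Rightarrow> 'k::comm_ring_1 mat \<Rightarrow> 'k mat \<Rightarrow> 'k mat" where
  "block_diag r s a d = four_block_mat a (0\<^sub>m r s) (0\<^sub>m s r) d"

definition block_lower :: "nat \<Rightarrow> nat \<Rightarrow> 'k::comm_ring_1 mat \<Rightarrow> 'k mat" where
  "block_lower r s X = four_block_mat (1\<^sub>m r) (0\<^sub>m r s) X (1\<^sub>m s)"

definition block_upper :: "nat \<Rightarrow> nat \<Rightarrow> 'k::comm_ring_1 mat \<Rightarrow> 'k mat" where
  "block_upper r s Y = four_block_mat (1\<^sub>m r) Y (0\<^sub>m s r) (1\<^sub>m s)"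

lemmas block_defs = block_diag_def block_lower_def block_upper_def

lemma mult_four_block_dim:
  assumes "dim_row A = r" "dim_col A = r" "dim_row B = r" "dim_col B = s"
    "dim_row C = s" "dim_col C = r" "dim_row D = s" "dim_col D = s"
    "dim_row A' = r" "dim_col A' = r" "dim_row B' = r" "dim_col B' = s"
    "dim_row C' = s" "dim_col C' = r" "dim_row D' = s" "dim_col D' = s"
  shows "four_block_mat A B C D * four_block_mat A' B' C' D' =
    four_block_mat (A * A' + B * C') (A * B' + B * D') (C * A' + D * C') (C * B' + D * D' :: 'k::comm_ring_1 mat)"
  by (rule mult_four_block_mat[of _ r r _ s _ s]) (use assms in auto)

lemma block_dims:
  "dim_row (block_diag r s a d) = dim_row a + dim_row d"
  "dim_col (block_diag r s a d) = dim_col a + dim_col d"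
  "dim_row (block_lower r s X) = r + s" "dim_col (block_lower r s X) = r + s"
  "dim_row (block_upper r s Y) = r + s" "dim_col (block_upper r s Y) = r + s"
  by (auto simp: block_defs)

lemma block_diag_mult:
  assumes "dim_row a = r" "dim_col a = r" "dim_row a' = r" "dim_col a' = r"
    "dim_row d = s" "dim_col d = s" "dim_row d' = s" "dim_col d' = s"
  shows "block_diag r s a d * block_diag r s a' d' = block_diag r s (a * a') (d * d')"
  using assms by (simp add: block_diag_def mult_four_block_dim[of _ r _ s] mat_dim_laws)

lemma inverse_pair_block_diag:
  assumes "inverse_pair r a a'" "inverse_pair s d d'"
  shows "inverse_pair (r + s) (block_diag r s a d) (block_diag r s a' d')"
  unfolding inverse_pair_def block_diag_def
  using inverse_pairD[OF assms(1)] inverse_pairD[OF assms(2)]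
  by (auto simp: mult_four_block_dim[of _ r _ s] mat_dim_laws)

lemma inverse_pair_block_lower:
  assumes "X \<in> carrier_mat s r"
  shows "inverse_pair (r + s) (block_lower r s X) (block_lower r s (- X))"
  unfolding inverse_pair_def block_lower_def
  using assms by (auto simp: mult_four_block_dim[of _ r _ s] mat_dim_laws)

lemma inverse_pair_block_upper:
  assumes "Y \<in> carrier_mat r s"
  shows "inverse_pair (r + s) (block_upper r s Y) (block_upper r s (- Y))"
  unfolding inverse_pair_def block_upper_def
  using assms by (auto simp: mult_four_block_dim[of _ r _ s] mat_dim_laws)

lemma four_block_inj:
  assumes "four_block_mat A B C D = four_block_mat A' B' C' D'"
    "A \<in> carrier_mat r r" "B \<in> carrier_mat r s" "C \<in> carrier_mat s r" "D \<in> carrier_mat s s"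
    "A' \<in> carrier_mat r r" "B' \<in> carrier_mat r s" "C' \<in> carrier_mat s r" "D' \<in> carrier_mat s s"
  shows "A = A'" "B = B'" "C = C'" "D = D'"
proof -
  have eq: "four_block_mat A B C D $$ (i, j) = four_block_mat A' B' C' D' $$ (i, j)" for i j
    using assms(1) by simp
  show "A = A'" using assms(2-) eq by (intro eq_matI) (auto, metis index_mat_four_block(1) carrier_matD trans_less_add1)
  show "B = B'"
  proof (rule eq_matI)
    fix i j assume "i < dim_row B'" "j < dim_col B'"
    then show "B $$ (i, j) = B' $$ (i, j)" using eq[of i "r + j"] assms(2-) by auto
  qed (use assms in auto)
  show "C = C'"
  proof (rule eq_matI)
    fix i j assume "i < dim_row C'" "j < dim_col C'"
    then show "C $$ (i, j) = C' $$ (i, j)" using eq[of "r + i" j] assms(2-) by auto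
  qed (use assms in auto)
  show "D = D'"
  proof (rule eq_matI)
    fix i j assume "i < dim_row D'" "j < dim_col D'"
    then show "D $$ (i, j) = D' $$ (i, j)" using eq[of "r + i" "r + j"] assms(2-) by auto
  qed (use assms in auto)
qed

lemma ex_four_block:
  assumes "M \<in> carrier_mat (r + s) (r + s)"
  shows "\<exists>A B C D. M = four_block_mat A B C D \<and> A \<in> carrier_mat r r \<and> B \<in> carrier_mat r s \<and>
    C \<in> carrier_mat s r \<and> D \<in> carrier_mat s s"
proof -
  obtain A B C D where "split_block M r r = (A, B, C, D)" by (metis prod_cases4)
  from split_block[OF this, of s s] assms show ?thesis by auto
qed

text \<open>Gaussian elimination with full pivoting: split off a nonzero entry and recurse on its
  Schur complement.\<close>

lemma rank_normal_form:
  fixes M :: "'k::field mat"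
  assumes "M \<in> carrier_mat n n"
  shows "\<exists>r s P P' Q Q'. r + s = n \<and> inverse_pair n P P' \<and> inverse_pair n Q Q' \<and>
    M = P * block_diag r s (1\<^sub>m r) (0\<^sub>m s s) * Q"
  using assms
proof (induction n arbitrary: M)
  case 0
  then show ?case
    by (intro exI[of _ 0] exI[of _ "1\<^sub>m 0"]) (auto simp: inverse_pair_one block_diag_def intro!: eq_matI)
next
  case (Suc m M)
  show ?case
  proof (cases "M = 0\<^sub>m (Suc m) (Suc m)")
    case True
    have "M = 1\<^sub>m (Suc m) * block_diag 0 (Suc m) (1\<^sub>m 0) (0\<^sub>m (Suc m) (Suc m)) * 1\<^sub>m (Suc m)"
      unfolding True by (rule eq_matI) (auto simp: block_diag_def mat_dim_laws)
    then show ?thesis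
      by (intro exI[of _ 0] exI[of _ "Suc m"] exI[of _ "1\<^sub>m (Suc m)"]) (auto simp: inverse_pair_one)
  next
    case False
    then obtain i j where ij: "i < Suc m" "j < Suc m" "M $$ (i, j) \<noteq> 0"
      using Suc.prems by (metis carrier_matD eq_matI index_zero_mat)
    \<comment> \<open>Two transpositions, each its own inverse, move the pivot from
      \<open>(i, j)\<close> to \<open>(0, 0)\<close>.\<close>
    define S where "S = (swaprows_mat (Suc m) 0 i :: 'k mat)"
    define T where "T = (swaprows_mat (Suc m) 0 j :: 'k mat)"
    have S: "inverse_pair (Suc m) S S" and T: "inverse_pair (Suc m) T T"
      using ij swaprows_mat_inv[of 0 "Suc m"] by (auto simp: inverse_pair_def S_def T_def)
    define N where "N = S * M * T"
    have NC: "N \<in> carrier_mat (1 + m) (1 + m)"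
      using S T Suc.prems by (auto simp: N_def inverse_pair_def)
    have MN: "M = S * N * T"
      using inverse_pairD[OF S] inverse_pairD[OF T] Suc.prems by (simp add: N_def mat_dim_laws)
    have "(S * M) $$ (0, k) = M $$ (i, k)" if "k < Suc m" for k
      unfolding S_def using ij that Suc.prems by (simp add: swaprows_mat[OF Suc.prems, symmetric])
    moreover have "N $$ (0, 0) = (\<Sum>k<Suc m. (S * M) $$ (0, k) * T $$ (k, 0))"
      unfolding N_def
      by (subst mult_mat_entry) (use inverse_pairD(3,4)[OF S] inverse_pairD(3,4)[OF T] Suc.prems in auto)
    moreover have "T $$ (k, 0) = (if k = j then 1 else 0)" if "k < Suc m" for k
      using that ij by (auto simp: T_def)
    ultimately have "N $$ (0, 0) = (\<Sum>k<Suc m. M $$ (i, k) * (if k = j then 1 else 0))"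
      by (simp del: sum.lessThan_Suc)
    also have "\<dots> = (\<Sum>k<Suc m. if k = j then M $$ (i, k) else 0)" by (rule sum.cong) auto
    finally have N00: "N $$ (0, 0) = M $$ (i, j)" using ij by (simp del: sum.lessThan_Suc)
    obtain A B C D where N: "N = four_block_mat A B C D" and carr: "A \<in> carrier_mat 1 1"
      "B \<in> carrier_mat 1 m" "C \<in> carrier_mat m 1" "D \<in> carrier_mat m m"
      using ex_four_block[OF NC] by blast
    have "A $$ (0, 0) \<noteq> 0" using N00 ij(3) carr by (simp add: N)
    then have "det A \<noteq> 0" using carr(1) det_single by metis
    then obtain A' where A': "inverse_pair 1 A A'" using inverse_pair_adj_mat carr(1) by blast
    \<comment> \<open>The Schur complement of the pivot block.\<close>
    define E where "E = D - C * A' * B"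
    have "E \<in> carrier_mat m m" using carr A' by (auto simp: E_def inverse_pair_def)
    from Suc.IH[OF this] obtain r s P P' Q Q' where IH: "r + s = m" "inverse_pair m P P'"
      "inverse_pair m Q Q'" "E = P * block_diag r s (1\<^sub>m r) (0\<^sub>m s s) * Q" by blast
    \<comment> \<open>The split-off 1 joins the identity block of the smaller normal form. The pivot
      value itself goes into the left factor, as \<open>block_diag 1 m A P\<close>.\<close>
    have shift: "block_diag (Suc r) s (1\<^sub>m (Suc r)) (0\<^sub>m s s) =
      block_diag 1 m (1\<^sub>m 1) (block_diag r s (1\<^sub>m r) (0\<^sub>m s s) :: 'k mat)"
      using IH(1) by (intro eq_matI) (auto simp: block_diag_def)
    note dims = carr inverse_pairD[OF A'] inverse_pairD[OF IH(2)] inverse_pairD[OF IH(3)]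
    let ?F = "block_diag r s (1\<^sub>m r) (0\<^sub>m s s) :: 'k mat"
    have F: "dim_row ?F = m" "dim_col ?F = m" using IH(1) by (auto simp: block_diag_def)
    have N': "N = block_lower 1 m (C * A') * block_diag 1 m A E * block_upper 1 m (A' * B)"
      using dims by (auto simp: N block_defs mult_four_block_dim[of _ 1 _ m] mat_dim_laws E_def)
    have "block_diag 1 m A E = block_diag 1 m A P * block_diag 1 m (1\<^sub>m 1) ?F * block_diag 1 m (1\<^sub>m 1) Q"
      using dims F by (simp add: block_diag_mult mat_dim_laws IH(4))
    then have "N = block_lower 1 m (C * A') * (block_diag 1 m A P * block_diag (Suc r) s (1\<^sub>m (Suc r)) (0\<^sub>m s s)
      * block_diag 1 m (1\<^sub>m 1) Q) * block_upper 1 m (A' * B)"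
      unfolding shift N' by simp
    moreover define P1 where "P1 = S * (block_lower 1 m (C * A') * block_diag 1 m A P)"
    moreover define Q1 where "Q1 = block_diag 1 m (1\<^sub>m 1) Q * block_upper 1 m (A' * B) * T"
    ultimately have "M = P1 * block_diag (Suc r) s (1\<^sub>m (Suc r)) (0\<^sub>m s s) * Q1"
      using dims inverse_pairD[OF S] inverse_pairD[OF T] IH(1) F
      by (simp add: MN mat_dim_laws block_dims)
    moreover have "\<exists>P1'. inverse_pair (Suc m) P1 P1'" "\<exists>Q1'. inverse_pair (Suc m) Q1 Q1'"
      unfolding P1_def Q1_def
      using inverse_pair_mult[OF S inverse_pair_mult[OF
          inverse_pair_block_lower[of "C * A'" m 1] inverse_pair_block_diag[OF A' IH(2)], simplified]]
        inverse_pair_mult[OF inverse_pair_mult[OF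
          inverse_pair_block_diag[OF inverse_pair_one IH(3)] inverse_pair_block_upper[of "A' * B" 1 m]], simplified, OF _ T]
        carr A' by (auto simp: inverse_pair_def)
    ultimately show ?thesis using IH(1) by (intro exI[of _ "Suc r"] exI[of _ s]) auto
  qed
qed

section \<open>Polynomial families of matrices\<close>

definition poly_mat :: "('a \<Rightarrow> 'k::comm_ring_1) set \<Rightarrow> nat \<Rightarrow> nat \<Rightarrow> ('a \<Rightarrow> 'k mat) \<Rightarrow> bool" where
  "poly_mat G nr nc X \<longleftrightarrow> (\<forall>w. X w \<in> carrier_mat nr nc) \<and>
     (\<forall>i<nr. \<forall>j<nc. (\<lambda>w. X w $$ (i, j)) \<in> polys G)"

lemma poly_matD:
  assumes "poly_mat G nr nc X"
  shows "X w \<in> carrier_mat nr nc" "dim_row (X w) = nr" "dim_col (X w) = nc"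
    "i < nr \<Longrightarrow> j < nc \<Longrightarrow> (\<lambda>w. X w $$ (i, j)) \<in> polys G"
  using assms by (auto simp: poly_mat_def)

lemma poly_mat_const: "A \<in> carrier_mat nr nc \<Longrightarrow> poly_mat G nr nc (\<lambda>_. A)"
  by (auto simp: poly_mat_def)

lemma poly_mat_add:
  assumes "poly_mat G nr nc X" "poly_mat G nr nc Y"
  shows "poly_mat G nr nc (\<lambda>w. X w + Y w)"
  unfolding poly_mat_def
proof (intro conjI allI impI)
  fix i j assume "i < nr" "j < nc"
  then show "(\<lambda>w. (X w + Y w) $$ (i, j)) \<in> polys G"
    by (simp add: poly_matD(2,3)[OF assms(1)] poly_matD(2,3)[OF assms(2)] polys_add poly_matD(4)[OF assms(1)] poly_matD(4)[OF assms(2)])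
qed (use poly_matD(1)[OF assms(1)] poly_matD(1)[OF assms(2)] in auto)

lemma poly_mat_uminus:
  assumes "poly_mat G nr nc X"
  shows "poly_mat G nr nc (\<lambda>w. - X w)"
  unfolding poly_mat_def
proof (intro conjI allI impI)
  fix i j assume "i < nr" "j < nc"
  then show "(\<lambda>w. (- X w) $$ (i, j)) \<in> polys G"
    by (simp add: poly_matD(2,3)[OF assms(1)] polys_uminus poly_matD(4)[OF assms(1)])
qed (use poly_matD(1)[OF assms(1)] in auto)

lemma poly_mat_minus:
  assumes "poly_mat G nr nc X" "poly_mat G nr nc Y"
  shows "poly_mat G nr nc (\<lambda>w. X w - Y w)"
  unfolding poly_mat_def
proof (intro conjI allI impI)
  fix i j assume "i < nr" "j < nc"
  then show "(\<lambda>w. (X w - Y w) $$ (i, j)) \<in> polys G"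
    by (simp add: poly_matD(2,3)[OF assms(1)] poly_matD(2,3)[OF assms(2)] polys_diff poly_matD(4)[OF assms(1)] poly_matD(4)[OF assms(2)])
qed (rule minus_carrier_mat[OF poly_matD(1)[OF assms(2)]])

lemma poly_mat_smult:
  assumes "f \<in> polys G" "poly_mat G nr nc X"
  shows "poly_mat G nr nc (\<lambda>w. f w \<cdot>\<^sub>m X w)"
  unfolding poly_mat_def
proof (intro conjI allI impI)
  fix i j assume "i < nr" "j < nc"
  then show "(\<lambda>w. (f w \<cdot>\<^sub>m X w) $$ (i, j)) \<in> polys G"
    by (simp add: poly_matD(2,3)[OF assms(2)] polys_mult poly_matD(4)[OF assms(2)] assms(1))
qed (use poly_matD(1)[OF assms(2)] in auto)

lemma poly_mat_mult:
  assumes "poly_mat G nr n X" "poly_mat G n nc Y"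
  shows "poly_mat G nr nc (\<lambda>w. X w * Y w)"
  unfolding poly_mat_def
proof (intro conjI allI impI)
  fix i j assume ij: "i < nr" "j < nc"
  have "(\<lambda>w. (X w * Y w) $$ (i, j)) = (\<lambda>w. \<Sum>k<n. X w $$ (i, k) * Y w $$ (k, j))"
    using ij poly_matD(2,3)[OF assms(1)] poly_matD(2,3)[OF assms(2)] by (intro ext) (simp add: mult_mat_entry del: index_mult_mat(1))
  moreover have "(\<lambda>w. \<Sum>k<n. X w $$ (i, k) * Y w $$ (k, j)) \<in> polys G"
    by (intro polys_sum polys_mult poly_matD(4)[OF assms(1)] poly_matD(4)[OF assms(2)]) (use ij in auto)
  ultimately show "(\<lambda>w. (X w * Y w) $$ (i, j)) \<in> polys G" by simp
qed (rule mult_carrier_mat[OF poly_matD(1)[OF assms(1)] poly_matD(1)[OF assms(2)]])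

lemma poly_mat_four_block:
  assumes "poly_mat G r r A" "poly_mat G r s B" "poly_mat G s r C" "poly_mat G s s D"
  shows "poly_mat G (r + s) (r + s) (\<lambda>w. four_block_mat (A w) (B w) (C w) (D w))"
  unfolding poly_mat_def
proof (intro conjI allI impI)
  fix i j assume ij: "i < r + s" "j < r + s"
  note dims = poly_matD(2,3)[OF assms(1)] poly_matD(2,3)[OF assms(2)]
    poly_matD(2,3)[OF assms(3)] poly_matD(2,3)[OF assms(4)]
  show "(\<lambda>w. four_block_mat (A w) (B w) (C w) (D w) $$ (i, j)) \<in> polys G"
    using ij poly_matD(4)[OF assms(1), of i j] poly_matD(4)[OF assms(2), of i "j - r"]
      poly_matD(4)[OF assms(3), of "i - r" j] poly_matD(4)[OF assms(4), of "i - r" "j - r"]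
    by (cases "i < r"; cases "j < r") (simp_all add: dims)
qed (use poly_matD(1)[OF assms(1)] poly_matD(1)[OF assms(4)] in auto)

lemma polys_det:
  assumes "poly_mat G n n X"
  shows "(\<lambda>w. det (X w)) \<in> polys G"
  unfolding det_def'[OF poly_matD(1)[OF assms]]
proof (intro polys_sum polys_mult polys_const polys_prod poly_matD(4)[OF assms])
  fix p i assume "p \<in> {p. p permutes {0..<n}}" "i \<in> {0..<n}"
  then show "i < n" "p i < n" using permutes_in_image[of p "{0..<n}" i] by auto
qed

text \<open>Cofactors are determinants, hence polynomial. In the curves below the adjugate therefore
  replaces the inverse, with the determinant kept as a separate denominator.\<close>

lemma poly_mat_adj_mat:
  assumes "poly_mat G n n X"
  shows "poly_mat G n n (\<lambda>w. adj_mat (X w))"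
  unfolding poly_mat_def
proof (intro conjI allI impI)
  fix i j assume ij: "i < n" "j < n"
  have "poly_mat G (n - 1) (n - 1) (\<lambda>w. mat_delete (X w) j i)"
    unfolding poly_mat_def
  proof (intro conjI allI impI)
    fix i' j' assume "i' < n - 1" "j' < n - 1"
    moreover from this have "(if i' < j then i' else Suc i') < n" "(if j' < i then j' else Suc j') < n"
      by auto
    ultimately show "(\<lambda>w. mat_delete (X w) j i $$ (i', j')) \<in> polys G"
      unfolding mat_delete_def using poly_matD(4)[OF assms] by (simp add: poly_matD(2,3)[OF assms])
  qed (rule mat_delete_carrier[OF poly_matD(1)[OF assms]])
  then have "(\<lambda>w. cofactor (X w) j i) \<in> polys G"
    unfolding cofactor_def by (intro polys_mult polys_const polys_det)
  then show "(\<lambda>w. adj_mat (X w) $$ (i, j)) \<in> polys G"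
    using ij by (simp add: adj_mat_def poly_matD(2,3)[OF assms])
qed (rule adj_mat(1)[OF poly_matD(1)[OF assms]])

section \<open>Coordinates of pairs of matrices, and curves of pairs\<close>

lemma mat_pair_vec_index:
  assumes "l < 2 * n\<^sup>2"
  shows "\<exists>i j. i < n \<and> j < n \<and> ((\<forall>A B :: 'k mat. mat_pair_vec n (A, B) $ l = A $$ (i, j)) \<or>
    (\<forall>A B :: 'k mat. mat_pair_vec n (A, B) $ l = B $$ (i, j)))"
proof -
  have aux: "l div n < n \<and> l mod n < n" if "l < n\<^sup>2" for l
  proof -
    have "n > 0" using that by (cases n) auto
    then show ?thesis using that by (simp add: less_mult_imp_div_less power2_eq_square)
  qed
  show ?thesis
  proof (cases "l < n\<^sup>2")
    case True
    then show ?thesis using aux[OF True] assms by (intro exI[of _ "l div n"] exI[of _ "l mod n"]) (auto simp: mat_pair_vec_def)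
  next
    case False
    then have "l - n\<^sup>2 < n\<^sup>2" using assms by simp
    from aux[OF this] show ?thesis using assms False
      by (intro exI[of _ "(l - n\<^sup>2) div n"] exI[of _ "(l - n\<^sup>2) mod n"]) (auto simp: mat_pair_vec_def)
  qed
qed

lemma mat_pair_vec_carrier: "mat_pair_vec n p \<in> carrier_vec (2 * n\<^sup>2)"
  by (cases p) (auto simp: mat_pair_vec_def)

lemma polys_mat_pair_vec:
  assumes "poly_mat G n n A" "poly_mat G n n B" "l < 2 * n\<^sup>2"
  shows "(\<lambda>w. mat_pair_vec n (A w, B w) $ l) \<in> polys G"
proof -
  obtain i j where ij: "i < n" "j < n"
    "(\<forall>A B :: 'b mat. mat_pair_vec n (A, B) $ l = A $$ (i, j)) \<or>
     (\<forall>A B :: 'b mat. mat_pair_vec n (A, B) $ l = B $$ (i, j))"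
    using mat_pair_vec_index[OF assms(3)] by blast
  then show ?thesis using poly_matD(4)[OF assms(1) ij(1,2)] poly_matD(4)[OF assms(2) ij(1,2)] by auto
qed

lemma rational_pair_curve_in_zcl:
  fixes A B :: "'k::alg_closed_field \<Rightarrow> 'k mat"
  assumes A: "poly_mat {\<lambda>t. t} n n A" and B: "poly_mat {\<lambda>t. t} n n B"
    and q: "q \<in> polys {\<lambda>t. t}" "q 0 \<noteq> 0"
    and "MOST t. mat_pair_vec n ((1 / q t) \<cdot>\<^sub>m A t, (1 / q t) \<cdot>\<^sub>m B t) \<in> zcl (2 * n\<^sup>2) S"
  shows "mat_pair_vec n ((1 / q 0) \<cdot>\<^sub>m A 0, (1 / q 0) \<cdot>\<^sub>m B 0) \<in> zcl (2 * n\<^sup>2) S"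
proof (rule rational_curve_in_zcl[where x = "\<lambda>t. mat_pair_vec n ((1 / q t) \<cdot>\<^sub>m A t, (1 / q t) \<cdot>\<^sub>m B t)",
    OF mat_pair_vec_carrier q _ assms(5)])
  fix l assume l: "l < 2 * n\<^sup>2"
  have "q t * mat_pair_vec n ((1 / q t) \<cdot>\<^sub>m A t, (1 / q t) \<cdot>\<^sub>m B t) $ l = mat_pair_vec n (A t, B t) $ l"
    if "q t \<noteq> 0" for t
  proof -
    obtain i j where "i < n" "j < n"
      "(\<forall>A B :: 'k mat. mat_pair_vec n (A, B) $ l = A $$ (i, j)) \<or>
       (\<forall>A B :: 'k mat. mat_pair_vec n (A, B) $ l = B $$ (i, j))"
      using mat_pair_vec_index[OF l] by blast
    then show ?thesis using that by (auto simp: poly_matD(2,3)[OF A] poly_matD(2,3)[OF B])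
  qed
  then show "\<exists>p\<in>polys {\<lambda>t. t}. \<forall>t. q t \<noteq> 0 \<longrightarrow>
      q t * mat_pair_vec n ((1 / q t) \<cdot>\<^sub>m A t, (1 / q t) \<cdot>\<^sub>m B t) $ l = p t"
    by (intro bexI[OF _ polys_mat_pair_vec[OF A B l]]) simp
qed

text \<open>This determinant is the value at \<open>t\<close> of the characteristic polynomial of
  \<open>- H\<close>, which is monic.\<close>

lemma MOST_det_add_smult_one:
  fixes H :: "'k::field mat"
  assumes "H \<in> carrier_mat r r"
  shows "MOST t. det (H + t \<cdot>\<^sub>m 1\<^sub>m r) \<noteq> 0"
proof -
  have mH: "- H \<in> carrier_mat r r" using assms by auto
  have "char_poly (- H) \<noteq> 0" using degree_monic_char_poly[OF mH] by auto
  then have "finite {t. poly (char_poly (- H)) t = 0}" by (rule poly_roots_finite)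
  moreover have "poly (char_poly (- H)) t = det (H + t \<cdot>\<^sub>m 1\<^sub>m r)" for t
  proof -
    have "- char_matrix (- H) t = H + t \<cdot>\<^sub>m 1\<^sub>m r"
      using assms by (intro eq_matI) (auto simp: char_matrix_def)
    then show ?thesis using char_poly_matrix[OF mH, of t] by simp
  qed
  ultimately show ?thesis by (simp add: MOST_iff_cofinite)
qed

section \<open>Simultaneously block-diagonalizable pairs\<close>

definition conj_pairs :: "nat \<Rightarrow> nat \<Rightarrow> ('k::comm_ring_1 mat \<times> 'k mat) set" where
  "conj_pairs r s = {(g * block_diag r s a d * g', g * block_diag r s a' d' * g') | g g' a d a' d'.
     inverse_pair (r + s) g g' \<and> a \<in> carrier_mat r r \<and> d \<in> carrier_mat s s \<and>
     a' \<in> carrier_mat r r \<and> d' \<in> carrier_mat s s}"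

definition lu_conj :: "nat \<Rightarrow> nat \<Rightarrow> 'k::comm_ring_1 mat \<Rightarrow> 'k mat \<Rightarrow> 'k mat \<Rightarrow> 'k mat \<Rightarrow> 'k mat" where
  "lu_conj r s X Y a d = block_lower r s X * block_upper r s Y * block_diag r s a d *
     (block_upper r s (- Y) * block_lower r s (- X))"

text \<open>The number \<open>c\<close> selects one of the six matrices of \<open>lu_pair\<close>: 0
  and 1 are the unipotent parameters \<open>X\<close> and \<open>Y\<close> shared by both members, 2
  and 3 the diagonal blocks of the first member, 4 and 5 those of the second.\<close>

definition param_mat :: "(nat \<times> nat \<times> nat \<Rightarrow> 'k) \<Rightarrow> nat \<Rightarrow> nat \<Rightarrow> nat \<Rightarrow> 'k mat" where
  "param_mat w c p q = mat p q (\<lambda>(i, j). w (c, i, j))"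

definition lu_pair :: "nat \<Rightarrow> nat \<Rightarrow> (nat \<times> nat \<times> nat \<Rightarrow> 'k::comm_ring_1) \<Rightarrow> 'k mat \<times> 'k mat" where
  "lu_pair r s w =
     (lu_conj r s (param_mat w 0 s r) (param_mat w 1 r s) (param_mat w 2 r r) (param_mat w 3 s s),
      lu_conj r s (param_mat w 0 s r) (param_mat w 1 r s) (param_mat w 4 r r) (param_mat w 5 s s))"

lemma param_mat_carrier [simp]: "param_mat w c p q \<in> carrier_mat p q"
  by (simp add: param_mat_def)

lemma lu_pair_surj:
  assumes "X \<in> carrier_mat s r" "Y \<in> carrier_mat r s" "a \<in> carrier_mat r r" "d \<in> carrier_mat s s"
    "a' \<in> carrier_mat r r" "d' \<in> carrier_mat s s"
  shows "(lu_conj r s X Y a d, lu_conj r s X Y a' d') \<in> range (lu_pair r s)"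
proof -
  define w where "w = (\<lambda>(c, i, j). ([X, Y, a, d, a', d'] ! c) $$ (i, j))"
  have "param_mat w 0 s r = X" "param_mat w 1 r s = Y" "param_mat w 2 r r = a" "param_mat w 3 s s = d"
    "param_mat w 4 r r = a'" "param_mat w 5 s s = d'"
    using assms by (auto simp: param_mat_def w_def numeral_eq_Suc intro!: eq_matI)
  then have "lu_pair r s w = (lu_conj r s X Y a d, lu_conj r s X Y a' d')" by (simp add: lu_pair_def)
  then show ?thesis by (metis rangeI)
qed

text \<open>Block elimination with the invertible corner \<open>p\<close> as pivot. Its Schur
  complement \<open>e\<close> is invertible because the determinant of \<open>h\<close> is nonzero,
  and \<open>Y\<close> is then obtained from \<open>q\<close> by dividing by
  \<open>e\<close>.\<close>

lemma ex_lu_decomposition: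
  fixes h :: "'k::field mat"
  assumes "inverse_pair (r + s) h h'" "h = four_block_mat p q v w"
    and carr: "p \<in> carrier_mat r r" "q \<in> carrier_mat r s" "v \<in> carrier_mat s r" "w \<in> carrier_mat s s"
    and "det p \<noteq> 0"
  shows "\<exists>X Y p' e e'. X \<in> carrier_mat s r \<and> Y \<in> carrier_mat r s \<and> inverse_pair r p p' \<and>
    inverse_pair s e e' \<and> h = block_lower r s X * block_upper r s Y * block_diag r s p e"
proof -
  obtain p' where p': "inverse_pair r p p'" using inverse_pair_adj_mat[OF carr(1) assms(7)] by blast
  define X where "X = v * p'"
  define e where "e = w - X * q"
  note dims = carr inverse_pairD[OF p']
  have X: "X \<in> carrier_mat s r" and e: "e \<in> carrier_mat s s"
    using carr p' by (auto simp: X_def e_def inverse_pair_def)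
  have h: "h = block_lower r s X * four_block_mat p q (0\<^sub>m s r) e"
    using dims by (auto simp: assms(2) block_defs mult_four_block_dim[of _ r _ s] mat_dim_laws X_def e_def)
  have "det (four_block_mat p q (0\<^sub>m s r) e) \<noteq> 0"
  proof
    assume "det (four_block_mat p q (0\<^sub>m s r) e) = 0"
    moreover have "block_lower r s X \<in> carrier_mat (r + s) (r + s)"
      "four_block_mat p q (0\<^sub>m s r) e \<in> carrier_mat (r + s) (r + s)"
      using carr e by (auto simp: block_defs)
    ultimately have "det h = 0" unfolding h by (subst det_mult) auto
    then show False using inverse_pair_det[OF assms(1)] by simp
  qed
  then have "det e \<noteq> 0"
    using det_four_block_mat_lower_left_zero[OF carr(1,2) _ e] by auto
  then obtain e' where e': "inverse_pair s e e'" using inverse_pair_adj_mat[OF e] by blast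
  have Y: "q * e' \<in> carrier_mat r s" using carr e' by (auto simp: inverse_pair_def)
  have "h = block_lower r s X * block_upper r s (q * e') * block_diag r s p e"
    unfolding h using dims inverse_pairD[OF e'] X Y
    by (auto simp: block_defs mult_four_block_dim[of _ r _ s] mat_dim_laws)
  then show ?thesis using X Y p' e' by blast
qed

text \<open>The block diagonal factor of \<open>h\<close> only conjugates the two diagonal blocks,
  so it contributes nothing beyond the blocks themselves.\<close>

lemma conj_eq_lu_conj:
  fixes h :: "'k::field mat"
  assumes "inverse_pair (r + s) h h'" "X \<in> carrier_mat s r" "Y \<in> carrier_mat r s"
    and p: "inverse_pair r p p'" and e: "inverse_pair s e e'"
    and h: "h = block_lower r s X * block_upper r s Y * block_diag r s p e"
    and carr: "a \<in> carrier_mat r r" "d \<in> carrier_mat s s"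
  shows "h * block_diag r s a d * h' = lu_conj r s X Y (p * a * p') (e * d * e')"
proof -
  let ?g = "block_lower r s X * block_upper r s Y"
  let ?g' = "block_upper r s (- Y) * block_lower r s (- X)"
  have g: "inverse_pair (r + s) ?g ?g'"
    by (rule inverse_pair_mult[OF inverse_pair_block_lower[OF assms(2)] inverse_pair_block_upper[OF assms(3)]])
  have "h' = block_diag r s p' e' * ?g'"
    by (rule inverse_pair_unique[OF assms(1)[unfolded h] inverse_pair_mult[OF g inverse_pair_block_diag[OF p e]]])
  moreover have "block_diag r s (p * a * p') (e * d * e') =
      block_diag r s p e * block_diag r s a d * block_diag r s p' e'"
    using carr inverse_pairD[OF p] inverse_pairD[OF e] by (simp add: block_diag_mult)
  ultimately show ?thesis
    unfolding lu_conj_def h using carr inverse_pairD[OF p] inverse_pairD[OF e] assms(2,3)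
    by (simp add: mat_dim_laws block_dims)
qed

text \<open>The conjugating matrix is moved along the line \<open>g + t\<close>. For almost all
  \<open>t\<close> both it and its upper left corner are invertible, so the block factorization
  exists there even if it fails at \<open>g\<close>.\<close>

lemma conj_pairs_subset_zcl:
  "mat_pair_vec (r + s) ` conj_pairs r s \<subseteq>
    zcl (2 * (r + s)\<^sup>2) (mat_pair_vec (r + s) ` range (lu_pair r s :: _ \<Rightarrow> ('k::alg_closed_field mat \<times> _)))"
  (is "_ \<subseteq> zcl _ ?S")
proof (clarsimp simp: conj_pairs_def)
  fix g g' a d a' d' :: "'k mat"
  assume g: "inverse_pair (r + s) g g'"
    and carr: "a \<in> carrier_mat r r" "d \<in> carrier_mat s s" "a' \<in> carrier_mat r r" "d' \<in> carrier_mat s s"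
  define h where "h t = g + t \<cdot>\<^sub>m 1\<^sub>m (r + s)" for t
  \<comment> \<open>The numerator of the conjugated matrix: the adjugate stands in for the inverse,
    and division by \<open>det (h t)\<close> restores the conjugate.\<close>
  define F where "F a d t = h t * block_diag r s a d * adj_mat (h t)" for a d t
  have id: "(\<lambda>t. t) \<in> polys {\<lambda>t. t :: 'k}" by (rule polys_gen) simp
  have hP: "poly_mat {\<lambda>t. t} (r + s) (r + s) h"
    unfolding h_def using inverse_pairD(1)[OF g] id
    by (intro poly_mat_add poly_mat_smult poly_mat_const) auto
  have FP: "poly_mat {\<lambda>t. t} (r + s) (r + s) (F a d)"
    if "a \<in> carrier_mat r r" "d \<in> carrier_mat s s" for a d
    unfolding F_def using that
    by (intro poly_mat_mult[of _ _ "r + s"] hP poly_mat_adj_mat poly_mat_const) (auto simp: block_diag_def)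
  have hC: "h t \<in> carrier_mat (r + s) (r + s)" for t by (rule poly_matD(1)[OF hP])
  have h0: "h 0 = g" using inverse_pairD[OF g] by (auto simp: h_def intro!: eq_matI)
  have F: "(1 / det (h t)) \<cdot>\<^sub>m F a d t = h t * block_diag r s a d * ((1 / det (h t)) \<cdot>\<^sub>m adj_mat (h t))"
    if "a \<in> carrier_mat r r" "d \<in> carrier_mat s s" for a d t
    using that hC[of t] adj_mat(1)[OF hC[of t]] by (simp add: F_def mat_dim_laws block_dims)
  have q0: "det (h 0) \<noteq> 0" using inverse_pair_det[OF g] by (simp add: h0)
  have F0: "(1 / det (h 0)) \<cdot>\<^sub>m F a d 0 = g * block_diag r s a d * g'"
    if "a \<in> carrier_mat r r" "d \<in> carrier_mat s s" for a d
    using F[OF that, of 0] inverse_pair_unique[OF g] inverse_pair_adj_mat[OF hC q0] by (simp add: h0)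
  obtain p q v w where pq: "g = four_block_mat p q v w" "p \<in> carrier_mat r r" "q \<in> carrier_mat r s"
    "v \<in> carrier_mat s r" "w \<in> carrier_mat s s"
    using ex_four_block[OF inverse_pairD(1)[OF g]] by blast
  have hb: "h t = four_block_mat (p + t \<cdot>\<^sub>m 1\<^sub>m r) q v (w + t \<cdot>\<^sub>m 1\<^sub>m s)" for t
    using pq by (auto simp: h_def intro!: eq_matI)
  have in_S: "mat_pair_vec (r + s) ((1 / det (h t)) \<cdot>\<^sub>m F a d t, (1 / det (h t)) \<cdot>\<^sub>m F a' d' t) \<in> ?S"
    if t: "det (h t) \<noteq> 0" "det (p + t \<cdot>\<^sub>m 1\<^sub>m r) \<noteq> 0" for t
  proof -
    let ?h' = "(1 / det (h t)) \<cdot>\<^sub>m adj_mat (h t)"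
    have inv: "inverse_pair (r + s) (h t) ?h'" by (rule inverse_pair_adj_mat[OF hC t(1)])
    have pC: "p + t \<cdot>\<^sub>m 1\<^sub>m r \<in> carrier_mat r r" "w + t \<cdot>\<^sub>m 1\<^sub>m s \<in> carrier_mat s s" using pq by auto
    obtain X Y p' e e' where *: "X \<in> carrier_mat s r" "Y \<in> carrier_mat r s"
      "inverse_pair r (p + t \<cdot>\<^sub>m 1\<^sub>m r) p'" "inverse_pair s e e'"
      "h t = block_lower r s X * block_upper r s Y * block_diag r s (p + t \<cdot>\<^sub>m 1\<^sub>m r) e"
      using ex_lu_decomposition[OF inv hb pC(1) pq(3,4) pC(2) t(2)] by blast
    show ?thesis
      unfolding F[OF carr(1,2)] F[OF carr(3,4)]
        conj_eq_lu_conj[OF inv * carr(1,2)] conj_eq_lu_conj[OF inv * carr(3,4)]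
      by (intro imageI lu_pair_surj *(1,2))
        (use carr inverse_pairD(1,2)[OF *(3)] inverse_pairD(1,2)[OF *(4)] in auto)
  qed
  have "MOST t. det (h t) \<noteq> 0" by (rule MOST_polys_neq_0[OF polys_det[OF hP] q0])
  moreover have "MOST t. det (p + t \<cdot>\<^sub>m 1\<^sub>m r) \<noteq> 0" by (rule MOST_det_add_smult_one[OF pq(2)])
  ultimately have "MOST t. mat_pair_vec (r + s) ((1 / det (h t)) \<cdot>\<^sub>m F a d t, (1 / det (h t)) \<cdot>\<^sub>m F a' d' t)
      \<in> zcl (2 * (r + s)\<^sup>2) ?S"
  proof eventually_elim
    case (elim t)
    have "?S \<subseteq> zcl (2 * (r + s)\<^sup>2) ?S" by (rule zcl_superset) (auto simp: mat_pair_vec_carrier)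
    then show ?case using in_S[OF elim] by blast
  qed
  from rational_pair_curve_in_zcl[OF FP[OF carr(1,2)] FP[OF carr(3,4)] polys_det[OF hP] q0 this]
  show "mat_pair_vec (r + s) (g * block_diag r s a d * g', g * block_diag r s a' d' * g')
      \<in> zcl (2 * (r + s)\<^sup>2) ?S"
    by (simp add: F0 carr)
qed

section \<open>Deforming commuting pairs to block diagonal ones\<close>

text \<open>After conjugation, \<open>M\<close> has the block rows \<open>(H1, H2)\<close> and \<open>0\<close>, with right inverse \<open>(R1, R2)\<close> of
  the first one, and a matrix commuting with \<open>M\<close> has the block rows \<open>(a, b)\<close> and \<open>(0, d)\<close>. Replacing
  \<open>M\<close> by the block rows \<open>(H1 + t, H2)\<close> and \<open>0\<close> makes its kernel, the graph of \<open>Y\<close>, a complement of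
  its image; the conclusion says that the deformed matrix with block rows \<open>(a, b')\<close> and \<open>(0, d')\<close> preserves that graph.\<close>

lemma invariant_complement_equation:
  fixes H1 :: "'k::comm_ring_1 mat"
  assumes carr: "a \<in> carrier_mat r r" "b \<in> carrier_mat r s" "d \<in> carrier_mat s s"
    "H1 \<in> carrier_mat r r" "H2 \<in> carrier_mat r s" "R1 \<in> carrier_mat r r" "R2 \<in> carrier_mat s r"
    and comm: "a * H1 = H1 * a" "a * H2 = H1 * b + H2 * d" "H1 * R1 + H2 * R2 = 1\<^sub>m r"
    and T: "inverse_pair r (1\<^sub>m r + t \<cdot>\<^sub>m R1) T" and J: "inverse_pair r (H1 + t \<cdot>\<^sub>m 1\<^sub>m r) J"
  defines "b' \<equiv> T * b"
  defines "d' \<equiv> d - t \<cdot>\<^sub>m (R2 * b')" and "Y \<equiv> - (J * H2)"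
  shows "b' = Y * d' - a * Y"
proof -
  define K where "K = H1 + t \<cdot>\<^sub>m 1\<^sub>m r"
  note dims = carrier_matD[OF carr(1)] carrier_matD[OF carr(2)] carrier_matD[OF carr(3)]
    carrier_matD[OF carr(4)] carrier_matD[OF carr(5)] carrier_matD[OF carr(6)] carrier_matD[OF carr(7)]
    inverse_pairD(5,6)[OF T] inverse_pairD(5,6)[OF J]
  have Kd: "dim_row K = r" "dim_col K = r" using dims by (auto simp: K_def)
  have b'd: "dim_row b' = r" "dim_col b' = s" using dims by (auto simp: b'_def)
  have d'd: "dim_row d' = s" "dim_col d' = s" using dims b'd by (auto simp: d'_def)
  have Yd: "dim_row Y = r" "dim_col Y = s" using dims by (auto simp: Y_def)
  have "(1\<^sub>m r + t \<cdot>\<^sub>m R1) * b' = b"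
    unfolding b'_def using inverse_pairD(9)[OF T] dims by simp
  then have b: "b = b' + t \<cdot>\<^sub>m (R1 * b')" using dims b'd by (simp add: mat_dim_laws)
  \<comment> \<open>By construction \<open>b' = b - t R1 b'\<close> and
    \<open>d' = d - t R2 b'\<close>. Applying \<open>(H1, H2)\<close> to the two corrections gives
    \<open>- t b'\<close> in total, which cancels the term \<open>t b'\<close> contributed by
    \<open>K\<close>. Thus the deformed matrix commutes with the deformed \<open>M\<close>; this is
    the equation \<open>main\<close>.\<close>
  have "(H1 * R1 + H2 * R2) * b' = b'" unfolding comm(3) using b'd by (simp add: mat_dim_laws)
  then have "b' = H2 * (R2 * b') + H1 * (R1 * b')" using dims b'd by (simp add: mat_dim_laws)
  then have tb: "t \<cdot>\<^sub>m b' = t \<cdot>\<^sub>m (H2 * (R2 * b')) + t \<cdot>\<^sub>m (H1 * (R1 * b'))"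
    using dims b'd by (metis smult_add_dim index_mult_mat(2,3))
  have reorder: "x + (u + v) + (y + - u) = (x + v) + y"
    if "x \<in> carrier_mat r s" "y \<in> carrier_mat r s" "u \<in> carrier_mat r s" "v \<in> carrier_mat r s"
    for x y u v :: "'k mat"
    using that by (intro eq_matI) auto
  have "K * b' + H2 * d' = (H1 * b' + t \<cdot>\<^sub>m b') + (H2 * d + - (t \<cdot>\<^sub>m (H2 * (R2 * b'))))"
    using dims b'd by (simp add: K_def d'_def mat_dim_laws)
  also have "\<dots> = (H1 * b' + t \<cdot>\<^sub>m (H1 * (R1 * b'))) + H2 * d"
    unfolding tb by (rule reorder) (use dims b'd in auto)
  also have "H1 * b' + t \<cdot>\<^sub>m (H1 * (R1 * b')) = H1 * b"
    unfolding b using dims b'd by (simp add: mat_dim_laws)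
  also have "H1 * b + H2 * d = a * H2" by (simp add: comm)
  finally have main: "K * b' + H2 * d' = a * H2" .
  have KJ: "K * (J * Z) = Z" "J * (K * Z) = Z" if "dim_row Z = r" for Z
    unfolding K_def using inverse_pairD(9,10)[OF J] that by auto
  have aK: "K * a = a * K" using dims comm(1) by (simp add: K_def mat_dim_laws)
  have "K * (a * Y) = a * (K * Y)"
    using mult_assoc_dim[of K a Y] mult_assoc_dim[of a K Y] dims Kd Yd aK by simp
  then have KaY: "K * (a * Y) = - (a * H2)"
    using dims KJ Kd by (simp add: Y_def mat_dim_laws)
  have KYd: "K * (Y * d') = - (H2 * d')"
    using dims KJ Kd d'd by (simp add: Y_def mat_dim_laws)
  \<comment> \<open>The matrix \<open>Y\<close> is determined by \<open>K * Y = - H2\<close>, so the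
    claim is verified after multiplying by the invertible \<open>K\<close>.\<close>
  have "K * (Y * d' - a * Y) = - (H2 * d') + a * H2"
    using dims d'd Yd Kd by (simp add: mat_dim_laws KaY KYd)
  also have "\<dots> = - (H2 * d') + (K * b' + H2 * d')" unfolding main ..
  also have "\<dots> = K * b'" using dims d'd Kd b'd by (intro eq_matI) auto
  finally have "J * (K * (Y * d' - a * Y)) = J * (K * b')" by simp
  then show ?thesis using KJ(2) dims d'd Yd b'd by simp
qed

lemma block_upper_conj:
  assumes "a \<in> carrier_mat r r" "d \<in> carrier_mat s s" "Y \<in> carrier_mat r s"
  shows "block_upper r s Y * block_diag r s a d * block_upper r s (- Y) =
    four_block_mat a (Y * d - a * Y) (0\<^sub>m s r) d"
  using assms by (auto simp: block_defs mult_four_block_dim[of _ r _ s] mat_dim_laws)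

text \<open>The block row \<open>(H1, H2)\<close> has a right inverse, so the image of the product
  is the whole first summand. A commuting matrix preserves this image, which forces its lower left
  block to vanish.\<close>

lemma commuting_blocks:
  fixes H :: "'k::comm_ring_1 mat"
  assumes A: "A \<in> carrier_mat (r + s) (r + s)"
    and Hb: "H = four_block_mat H1 H2 H3 H4" "H1 \<in> carrier_mat r r" "H2 \<in> carrier_mat r s"
      "H3 \<in> carrier_mat s r" "H4 \<in> carrier_mat s s"
    and R: "R1 \<in> carrier_mat r r" "R2 \<in> carrier_mat s r" "H1 * R1 + H2 * R2 = 1\<^sub>m r"
    and comm: "A * (block_diag r s (1\<^sub>m r) (0\<^sub>m s s) * H) = (block_diag r s (1\<^sub>m r) (0\<^sub>m s s) * H) * A"
  shows "\<exists>a b d. a \<in> carrier_mat r r \<and> b \<in> carrier_mat r s \<and> d \<in> carrier_mat s s \<and>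
    A = four_block_mat a b (0\<^sub>m s r) d \<and> a * H1 = H1 * a \<and> a * H2 = H1 * b + H2 * d"
proof -
  obtain a b c d where Ab: "A = four_block_mat a b c d" "a \<in> carrier_mat r r" "b \<in> carrier_mat r s"
    "c \<in> carrier_mat s r" "d \<in> carrier_mat s s"
    using ex_four_block[OF A] by blast
  note dims = Ab(2-) Hb(2-) R(1,2)
  have "block_diag r s (1\<^sub>m r) (0\<^sub>m s s) * H = four_block_mat H1 H2 (0\<^sub>m s r) (0\<^sub>m s s)"
    using dims by (auto simp: Hb(1) block_diag_def mult_four_block_dim[of _ r _ s] mat_dim_laws)
  then have "four_block_mat (a * H1) (a * H2) (c * H1) (c * H2) =
    four_block_mat (H1 * a + H2 * c) (H1 * b + H2 * d) (0\<^sub>m s r) (0\<^sub>m s s)"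
    using comm dims by (auto simp: Ab(1) mult_four_block_dim[of _ r _ s] mat_dim_laws)
  note eqs = four_block_inj[OF this, of r s]
  have 1: "a * H1 = H1 * a + H2 * c" by (rule eqs(1)) (use dims in auto)
  have 2: "a * H2 = H1 * b + H2 * d" by (rule eqs(2)) (use dims in auto)
  have 3: "c * H1 = 0\<^sub>m s r" by (rule eqs(3)) (use dims in auto)
  have 4: "c * H2 = 0\<^sub>m s s" by (rule eqs(4)) (use dims in auto)
  have "c = c * (H1 * R1 + H2 * R2)" using dims by (simp add: R(3))
  also have "\<dots> = (c * H1) * R1 + (c * H2) * R2" using dims by (simp add: mat_dim_laws)
  also have "\<dots> = 0\<^sub>m s r" unfolding 3 4 using dims by (simp add: mat_dim_laws)
  finally have c: "c = 0\<^sub>m s r" .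
  have "a * H1 = H1 * a" using 1 dims by (simp add: c mat_dim_laws)
  then show ?thesis using Ab 2 c by blast
qed

lemma singular_shift_exists:
  fixes C :: "'k::alg_closed_field mat"
  assumes C: "C \<in> carrier_mat n n" "\<not> scalar_mat n C"
  shows "\<exists>M\<in>carrier_mat n n. det M = 0 \<and> M \<noteq> 0\<^sub>m n n \<and>
    (\<forall>A\<in>carrier_mat n n. A * C = C * A \<longrightarrow> A * M = M * A)"
proof -
  \<comment> \<open>In size 0 every matrix is scalar; positive size is needed for the characteristic
    polynomial to have a root.\<close>
  have "n > 0"
  proof (rule ccontr)
    assume "\<not> n > 0"
    then have "C = 0 \<cdot>\<^sub>m 1\<^sub>m n" using C(1) by (intro eq_matI) auto
    then show False using C(2) by (auto simp: scalar_mat_def)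
  qed
  then have "degree (char_poly C) > 0" using degree_monic_char_poly[OF C(1)] by simp
  then obtain c where "poly (char_poly C) c = 0" using alg_closed_imp_poly_has_root by blast
  then have det: "det (char_matrix C c) = 0"
    using eigenvalue_root_char_poly[OF C(1)] eigenvalue_det[OF C(1)] by simp
  have M: "char_matrix C c = C + (- c) \<cdot>\<^sub>m 1\<^sub>m n"
    using C(1) by (intro eq_matI) (auto simp: char_matrix_def)
  have "char_matrix C c \<noteq> 0\<^sub>m n n"
  proof
    assume "char_matrix C c = 0\<^sub>m n n"
    then have *: "C + (- c) \<cdot>\<^sub>m 1\<^sub>m n = 0\<^sub>m n n" by (simp add: M)
    have "C = c \<cdot>\<^sub>m 1\<^sub>m n"
    proof (rule eq_matI)
      fix i j assume ij: "i < dim_row (c \<cdot>\<^sub>m 1\<^sub>m n)" "j < dim_col (c \<cdot>\<^sub>m 1\<^sub>m n)"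
      have "(C + (- c) \<cdot>\<^sub>m 1\<^sub>m n) $$ (i, j) = 0" unfolding * using ij by simp
      then show "C $$ (i, j) = (c \<cdot>\<^sub>m 1\<^sub>m n) $$ (i, j)" using ij C(1) by (auto split: if_splits)
    qed (use C(1) in auto)
    then show False using C(2) by (auto simp: scalar_mat_def)
  qed
  moreover have "A * char_matrix C c = char_matrix C c * A"
    if "A \<in> carrier_mat n n" "A * C = C * A" for A
    using that C(1) by (simp add: M mat_dim_laws)
  ultimately show ?thesis using det char_matrix_closed[OF C(1)] by blast
qed

text \<open>The graph of \<open>Y\<close> depends only on \<open>M\<close> and \<open>t\<close>, so
  one conjugating matrix serves both members of the deformed pair. Both blocks are nonempty:
  \<open>0 < r\<close> because \<open>M\<close> is nonzero, \<open>0 < s\<close> because it is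
  singular.\<close>

lemma commuting_pair_in_zcl:
  fixes A B C :: "'k::alg_closed_field mat"
  assumes carr: "A \<in> carrier_mat n n" "B \<in> carrier_mat n n" "C \<in> carrier_mat n n"
    and C: "\<not> scalar_mat n C" "A * C = C * A" "B * C = C * B"
  shows "\<exists>r s. r + s = n \<and> 0 < r \<and> 0 < s \<and>
    mat_pair_vec n (A, B) \<in> zcl (2 * n\<^sup>2) (mat_pair_vec n ` conj_pairs r s)"
proof -
  obtain M where M: "M \<in> carrier_mat n n" "det M = 0" "M \<noteq> 0\<^sub>m n n" "A * M = M * A" "B * M = M * B"
    using singular_shift_exists[OF carr(3) C(1)] carr C by blast
  obtain r s P P' Q Q' where n: "r + s = n" and P: "inverse_pair n P P'" and Q: "inverse_pair n Q Q'"
    and Mn: "M = P * block_diag r s (1\<^sub>m r) (0\<^sub>m s s) * Q"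
    using rank_normal_form[OF M(1)] by blast
  let ?D = "block_diag r s (1\<^sub>m r) (0\<^sub>m s s) :: 'k mat"
  note Pd = inverse_pairD[OF P] and Qd = inverse_pairD[OF Q]
  have Dd: "dim_row ?D = n" "dim_col ?D = n" using n by (auto simp: block_dims)
  have "r \<noteq> 0"
  proof
    assume "r = 0"
    then have "?D = 0\<^sub>m n n" using n by (intro eq_matI) (auto simp: block_diag_def)
    then show False using M(3) Pd Qd by (simp add: Mn mat_dim_laws)
  qed
  have "s \<noteq> 0"
  proof
    assume "s = 0"
    then have "?D = 1\<^sub>m n" using n by (intro eq_matI) (auto simp: block_diag_def)
    then have "M = P * Q" using Pd by (simp add: Mn mat_dim_laws)
    then show False using inverse_pair_det[OF inverse_pair_mult[OF P Q]] M(2) by simp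
  qed
  \<comment> \<open>In the basis given by \<open>P\<close>, the matrix \<open>M\<close> becomes
    \<open>?D * H\<close>, whose nonzero block row is the first one of \<open>H\<close>. The inverse
    of \<open>H\<close> supplies the right inverse \<open>(R1, R2)\<close> of that row.\<close>
  define H where "H = Q * P"
  have H: "inverse_pair (r + s) H (P' * Q')"
    unfolding H_def n by (rule inverse_pair_mult[OF Q P])
  obtain H1 H2 H3 H4 where Hb: "H = four_block_mat H1 H2 H3 H4" "H1 \<in> carrier_mat r r"
    "H2 \<in> carrier_mat r s" "H3 \<in> carrier_mat s r" "H4 \<in> carrier_mat s s"
    using ex_four_block[OF inverse_pairD(1)[OF H]] by blast
  obtain R1 R3 R2 R4 where Rb: "P' * Q' = four_block_mat R1 R3 R2 R4" "R1 \<in> carrier_mat r r"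
    "R3 \<in> carrier_mat r s" "R2 \<in> carrier_mat s r" "R4 \<in> carrier_mat s s"
    using ex_four_block[OF inverse_pairD(2)[OF H]] by blast
  have "four_block_mat (H1 * R1 + H2 * R2) (H1 * R3 + H2 * R4) (H3 * R1 + H4 * R2) (H3 * R3 + H4 * R4) =
      four_block_mat (1\<^sub>m r) (0\<^sub>m r s) (0\<^sub>m s r) (1\<^sub>m s)"
    using inverse_pairD(7)[OF H] Hb(2-) Rb(2-) by (simp add: Hb(1) Rb(1) mult_four_block_dim[of _ r _ s])
  then have HR: "H1 * R1 + H2 * R2 = 1\<^sub>m r"
    by (rule four_block_inj(1)[of _ _ _ _ _ _ _ _ r s]) (use Hb(2-) Rb(2-) in auto)
  have blocks: "\<exists>a b d. a \<in> carrier_mat r r \<and> b \<in> carrier_mat r s \<and> d \<in> carrier_mat s s \<and>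
      P' * A * P = four_block_mat a b (0\<^sub>m s r) d \<and> a * H1 = H1 * a \<and> a * H2 = H1 * b + H2 * d"
    if A: "A \<in> carrier_mat n n" "A * M = M * A" for A
  proof (rule commuting_blocks[OF _ Hb Rb(2,4) HR])
    have DH: "?D * H = P' * M * P" using Pd Qd Dd by (simp add: Mn H_def mat_dim_laws)
    have "P' * A * P * (P' * M * P) = P' * (A * M) * P"
      using Pd A(1) M(1) by (simp add: mat_dim_laws)
    also have "\<dots> = P' * M * P * (P' * A * P)" unfolding A(2) using Pd A(1) M(1) by (simp add: mat_dim_laws)
    finally show "P' * A * P * (?D * H) = ?D * H * (P' * A * P)" unfolding DH .
  qed (use Pd A n in auto)
  obtain a b d where abd: "a \<in> carrier_mat r r" "b \<in> carrier_mat r s" "d \<in> carrier_mat s s"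
    "a * H1 = H1 * a" "a * H2 = H1 * b + H2 * d" and PAP: "P' * A * P = four_block_mat a b (0\<^sub>m s r) d"
    using blocks[OF carr(1) M(4)] by blast
  obtain a' b' d' where abd': "a' \<in> carrier_mat r r" "b' \<in> carrier_mat r s" "d' \<in> carrier_mat s s"
    "a' * H1 = H1 * a'" "a' * H2 = H1 * b' + H2 * d'" and PBP: "P' * B * P = four_block_mat a' b' (0\<^sub>m s r) d'"
    using blocks[OF carr(2) M(5)] by blast
  \<comment> \<open>The matrix to be inverted in the equation for \<open>b'\<close>. It is the
    identity at \<open>t = 0\<close>, so the curve is defined there and starts at the given
    pair.\<close>
  define K where "K t = 1\<^sub>m r + t \<cdot>\<^sub>m R1" for t
  define T where "T t = (1 / det (K t)) \<cdot>\<^sub>m adj_mat (K t)" for t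
  \<comment> \<open>The deformed matrix in the original basis, multiplied by
    \<open>det (K t)\<close> to be polynomial in \<open>t\<close>.\<close>
  define F where "F a b d t = P * four_block_mat (det (K t) \<cdot>\<^sub>m a) (adj_mat (K t) * b) (0\<^sub>m s r)
      (det (K t) \<cdot>\<^sub>m d - t \<cdot>\<^sub>m (R2 * (adj_mat (K t) * b))) * P'" for a b d t
  have id: "(\<lambda>t. t) \<in> polys {\<lambda>t. t :: 'k}" by (rule polys_gen) simp
  have KP: "poly_mat {\<lambda>t. t} r r K"
    unfolding K_def using Rb(2) id by (intro poly_mat_add poly_mat_smult poly_mat_const) auto
  note detP = polys_det[OF KP] and adjP = poly_mat_adj_mat[OF KP]
  have FP: "poly_mat {\<lambda>t. t} n n (F a b d)"
    if "a \<in> carrier_mat r r" "b \<in> carrier_mat r s" "d \<in> carrier_mat s s" for a b d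
  proof -
    have "poly_mat {\<lambda>t. t} n n (\<lambda>t. four_block_mat (det (K t) \<cdot>\<^sub>m a) (adj_mat (K t) * b) (0\<^sub>m s r)
      (det (K t) \<cdot>\<^sub>m d - t \<cdot>\<^sub>m (R2 * (adj_mat (K t) * b))))"
      unfolding n[symmetric]
      by (intro poly_mat_four_block poly_mat_minus poly_mat_smult poly_mat_mult[OF adjP]
        poly_mat_mult[OF poly_mat_const[OF Rb(4)]] detP id poly_mat_const that) simp
    then show ?thesis
      unfolding F_def by (intro poly_mat_mult[of _ n n] poly_mat_const Pd(1,2))
  qed
  have KC: "K t \<in> carrier_mat r r" for t by (rule poly_matD(1)[OF KP])
  have F: "(1 / det (K t)) \<cdot>\<^sub>m F a b d t =
      P * four_block_mat a (T t * b) (0\<^sub>m s r) (d - t \<cdot>\<^sub>m (R2 * (T t * b))) * P'"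
    if "a \<in> carrier_mat r r" "b \<in> carrier_mat r s" "d \<in> carrier_mat s s" "det (K t) \<noteq> 0" for a b d t
  proof -
    note adjd = carrier_matD[OF adj_mat(1)[OF KC[of t]]]
    let ?Z = "four_block_mat (det (K t) \<cdot>\<^sub>m a) (adj_mat (K t) * b) (0\<^sub>m s r)
      (det (K t) \<cdot>\<^sub>m d - t \<cdot>\<^sub>m (R2 * (adj_mat (K t) * b)))"
    have "(1 / det (K t)) \<cdot>\<^sub>m F a b d t = P * ((1 / det (K t)) \<cdot>\<^sub>m ?Z) * P'"
      unfolding F_def using Pd that Rb adjd n by (simp add: mat_dim_laws)
    also have "(1 / det (K t)) \<cdot>\<^sub>m ?Z =
      four_block_mat a (T t * b) (0\<^sub>m s r) (d - t \<cdot>\<^sub>m (R2 * (T t * b)))"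
    proof -
      have "(1 / det (K t)) \<cdot>\<^sub>m ?Z = four_block_mat ((1 / det (K t)) \<cdot>\<^sub>m (det (K t) \<cdot>\<^sub>m a))
        ((1 / det (K t)) \<cdot>\<^sub>m (adj_mat (K t) * b)) ((1 / det (K t)) \<cdot>\<^sub>m 0\<^sub>m s r)
        ((1 / det (K t)) \<cdot>\<^sub>m (det (K t) \<cdot>\<^sub>m d - t \<cdot>\<^sub>m (R2 * (adj_mat (K t) * b))))"
        by (rule smult_four_block_mat[of _ r r _ s _ s]) (use that adjd Rb in auto)
      also have "\<dots> = four_block_mat a (T t * b) (0\<^sub>m s r) (d - t \<cdot>\<^sub>m (R2 * (T t * b)))"
        unfolding T_def using that adjd Rb
        by (intro cong_four_block_mat) (simp_all add: mat_dim_laws mult.commute)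
      finally show ?thesis .
    qed
    finally show ?thesis .
  qed
  have K0: "K 0 = 1\<^sub>m r" using Rb(2) by (auto simp: K_def intro!: eq_matI)
  then have q0: "det (K 0) \<noteq> 0" by simp
  have T0: "T 0 = 1\<^sub>m r"
    using inverse_pair_unique[OF inverse_pair_one inverse_pair_adj_mat[OF KC q0, unfolded K0]]
    by (simp add: T_def K0)
  have F0: "(1 / det (K 0)) \<cdot>\<^sub>m F a b d 0 = A"
    if "a \<in> carrier_mat r r" "b \<in> carrier_mat r s" "d \<in> carrier_mat s s"
      "P' * A * P = four_block_mat a b (0\<^sub>m s r) d" "A \<in> carrier_mat n n" for a b d A
  proof -
    have "d - 0 \<cdot>\<^sub>m (R2 * (T 0 * b)) = d" using that Rb by (intro eq_matI) (auto simp: T0)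
    moreover have "T 0 * b = b" using that by (simp add: T0)
    ultimately have "(1 / det (K 0)) \<cdot>\<^sub>m F a b d 0 = P * (P' * A * P) * P'"
      unfolding F[OF that(1-3) q0] that(4) by simp
    then show ?thesis using Pd that(5) by (simp add: mat_dim_laws)
  qed
  have in_conj: "((1 / det (K t)) \<cdot>\<^sub>m F a b d t, (1 / det (K t)) \<cdot>\<^sub>m F a' b' d' t) \<in> conj_pairs r s"
    if t: "det (K t) \<noteq> 0" "det (H1 + t \<cdot>\<^sub>m 1\<^sub>m r) \<noteq> 0" for t
  proof -
    have T: "inverse_pair r (1\<^sub>m r + t \<cdot>\<^sub>m R1) (T t)"
      using inverse_pair_adj_mat[OF KC t(1)] by (simp add: T_def K_def)
    obtain J where J: "inverse_pair r (H1 + t \<cdot>\<^sub>m 1\<^sub>m r) J"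
      using inverse_pair_adj_mat[of "H1 + t \<cdot>\<^sub>m 1\<^sub>m r" r] t(2) by auto
    \<comment> \<open>The kernel of the deformed \<open>M\<close> is the graph of this
      \<open>Y\<close>, and \<open>block_upper r s Y\<close> carries the second summand onto
      it.\<close>
    define Y where "Y = - (J * H2)"
    have Y: "Y \<in> carrier_mat r s" using inverse_pairD(2)[OF J] Hb(3) by (auto simp: Y_def)
    define e where "e b d = d - t \<cdot>\<^sub>m (R2 * (T t * b))" for b d
    have e: "e b d \<in> carrier_mat s s" if "b \<in> carrier_mat r s" "d \<in> carrier_mat s s" for b d
      using that Rb(4) inverse_pairD(2)[OF T] by (auto simp: e_def)
    let ?g = "P * block_upper r s Y" and ?g' = "block_upper r s (- Y) * P'"
    have g: "inverse_pair (r + s) ?g ?g'"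
      using inverse_pair_mult[OF P[folded n] inverse_pair_block_upper[OF Y]] .
    have "(1 / det (K t)) \<cdot>\<^sub>m F a b d t = ?g * block_diag r s a (e b d) * ?g'"
      if abd: "a \<in> carrier_mat r r" "b \<in> carrier_mat r s" "d \<in> carrier_mat s s"
        "a * H1 = H1 * a" "a * H2 = H1 * b + H2 * d" for a b d
    proof -
      have eq: "T t * b = Y * e b d - a * Y"
        unfolding Y_def e_def
        by (rule invariant_complement_equation[OF abd(1-3) Hb(2,3) Rb(2,4) abd(4,5) HR T J])
      have "(1 / det (K t)) \<cdot>\<^sub>m F a b d t = P * four_block_mat a (T t * b) (0\<^sub>m s r) (e b d) * P'"
        unfolding F[OF abd(1-3) t(1)] e_def ..
      also have "\<dots> = P * (block_upper r s Y * block_diag r s a (e b d) * block_upper r s (- Y)) * P'"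
        unfolding block_upper_conj[OF abd(1) e[OF abd(2,3)] Y] eq ..
      also have "\<dots> = ?g * block_diag r s a (e b d) * ?g'"
        using Pd e[OF abd(2,3)] abd(1) Y n by (simp add: mat_dim_laws block_dims)
      finally show ?thesis .
    qed
    from this[OF abd] this[OF abd'] show ?thesis
      unfolding conj_pairs_def using g abd(1-3) abd'(1-3) e by blast
  qed
  have "MOST t. det (K t) \<noteq> 0" by (rule MOST_polys_neq_0[OF detP q0])
  moreover have "MOST t. det (H1 + t \<cdot>\<^sub>m 1\<^sub>m r) \<noteq> 0" by (rule MOST_det_add_smult_one[OF Hb(2)])
  ultimately have "MOST t. mat_pair_vec n ((1 / det (K t)) \<cdot>\<^sub>m F a b d t, (1 / det (K t)) \<cdot>\<^sub>m F a' b' d' t)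
      \<in> zcl (2 * n\<^sup>2) (mat_pair_vec n ` conj_pairs r s)"
  proof eventually_elim
    case (elim t)
    have "mat_pair_vec n ` conj_pairs r s \<subseteq> zcl (2 * n\<^sup>2) (mat_pair_vec n ` conj_pairs r s :: 'k vec set)"
      by (rule zcl_superset) (auto simp: mat_pair_vec_carrier)
    then show ?case using in_conj[OF elim] by blast
  qed
  from rational_pair_curve_in_zcl[OF FP[OF abd(1-3)] FP[OF abd'(1-3)] detP q0 this]
  have "mat_pair_vec n (A, B) \<in> zcl (2 * n\<^sup>2) (mat_pair_vec n ` conj_pairs r s)"
    unfolding F0[OF abd(1-3) PAP carr(1)] F0[OF abd'(1-3) PBP carr(2)] .
  then show ?thesis using n \<open>r \<noteq> 0\<close> \<open>s \<noteq> 0\<close> by blast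
qed

section \<open>The commuting distance\<close>

lemma graph_dist_le_2D:
  assumes "graph_dist E a b \<le> 2"
  shows "a = b \<or> (a, b) \<in> E \<or> (\<exists>c. (a, c) \<in> E \<and> (c, b) \<in> E)"
proof -
  have "\<exists>l\<le>2. (a, b) \<in> E ^^ l"
  proof (rule ccontr)
    assume *: "\<not> ?thesis"
    have "3 \<le> graph_dist E a b"
      unfolding graph_dist_def
    proof (rule Inf_greatest, clarify)
      fix l assume "(a, b) \<in> E ^^ l"
      with * have "\<not> l \<le> 2" by auto
      then have "3 \<le> l" by simp
      then show "3 \<le> enat l" by (metis enat_ord_simps(1) numeral_eq_enat)
    qed
    then have "(3 :: enat) \<le> 2" using assms by (rule order_trans)
    then show False by simp
  qed
  then obtain l where "l \<le> 2" "(a, b) \<in> E ^^ l" by blast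
  moreover from this have "l = 0 \<or> l = 1 \<or> l = 2" by auto
  ultimately show ?thesis by (auto simp: numeral_2_eq_2)
qed

lemma scalar_mat_commute:
  assumes "scalar_mat n A" "B \<in> carrier_mat n n"
  shows "A * B = B * A"
  using assms by (auto simp: scalar_mat_def mat_dim_laws)

lemma ex_nonscalar_mat:
  assumes "n \<ge> 2"
  shows "\<exists>C\<in>carrier_mat n n. \<not> scalar_mat n (C :: 'k::comm_ring_1 mat)"
proof -
  let ?C = "mat n n (\<lambda>(i, j). if i = 0 \<and> j = 0 then 1 else 0) :: 'k mat"
  have "\<not> scalar_mat n ?C"
  proof
    assume "scalar_mat n ?C"
    then obtain c where c: "?C = c \<cdot>\<^sub>m 1\<^sub>m n" by (auto simp: scalar_mat_def)
    have "?C $$ (0, 0) = c" "?C $$ (1, 1) = c" unfolding c using assms by auto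
    then show False using assms by auto
  qed
  then show ?thesis by (intro bexI[of _ ?C]) auto
qed

text \<open>A single \<open>C\<close> covers all cases: for a walk of length 2 it is the middle
  vertex, for adjacent or equal matrices one of them, and if both are scalar any non-scalar matrix,
  which exists since \<open>n\<close> is at least 2. Conversely, \<open>C\<close> may coincide with
  \<open>A\<close> or \<open>B\<close>, and then these are equal, adjacent or involve a
  scalar.\<close>

lemma commuting_variety2_iff:
  fixes A B :: "'k::comm_ring_1 mat"
  assumes "n \<ge> 2"
  shows "(A, B) \<in> commuting_variety2 n \<longleftrightarrow> A \<in> carrier_mat n n \<and> B \<in> carrier_mat n n \<and>
    (\<exists>C\<in>carrier_mat n n. \<not> scalar_mat n C \<and> A * C = C * A \<and> B * C = C * B)"
proof (intro iffI conjI)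
  assume AB: "(A, B) \<in> commuting_variety2 n"
  then show carr: "A \<in> carrier_mat n n" "B \<in> carrier_mat n n" by (auto simp: commuting_variety2_def)
  have dist: "commuting_dist n A B \<le> 2" using AB by (auto simp: commuting_variety2_def)
  obtain C0 :: "'k mat" where C0: "C0 \<in> carrier_mat n n" "\<not> scalar_mat n C0"
    using ex_nonscalar_mat[OF assms] by blast
  show "\<exists>C\<in>carrier_mat n n. \<not> scalar_mat n C \<and> A * C = C * A \<and> B * C = C * B"
  proof (cases "scalar_mat n A \<or> scalar_mat n B \<or> A = B")
    case True
    note comm = scalar_mat_commute[of n A] scalar_mat_commute[of n B]
    consider "scalar_mat n A" "scalar_mat n B" | "\<not> scalar_mat n A" "scalar_mat n B \<or> A = B"
      | "\<not> scalar_mat n B" "scalar_mat n A"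
      using True by blast
    then show ?thesis
    proof cases
      case 1
      then show ?thesis using comm[OF _ C0(1)] C0 by blast
    next
      case 2
      then show ?thesis using comm(2)[OF _ carr(1)] carr by (intro bexI[of _ A]) auto
    next
      case 3
      then show ?thesis using comm(1)[OF _ carr(2)] carr by (intro bexI[of _ B]) auto
    qed
  next
    case False
    then have "graph_dist (commuting_graph n) A B \<le> 2" using dist by (simp add: commuting_dist_def)
    from graph_dist_le_2D[OF this] False
    consider "(A, B) \<in> commuting_graph n" | C where "(A, C) \<in> commuting_graph n" "(C, B) \<in> commuting_graph n"
      by blast
    then show ?thesis
    proof cases
      case 1
      then show ?thesis by (intro bexI[of _ A]) (auto simp: commuting_graph_def)
    next
      case (2 C)
      then show ?thesis by (intro bexI[of _ C]) (auto simp: commuting_graph_def)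
    qed
  qed
next
  assume *: "A \<in> carrier_mat n n \<and> B \<in> carrier_mat n n \<and>
    (\<exists>C\<in>carrier_mat n n. \<not> scalar_mat n C \<and> A * C = C * A \<and> B * C = C * B)"
  then obtain C where carr: "A \<in> carrier_mat n n" "B \<in> carrier_mat n n" "C \<in> carrier_mat n n"
    and C: "\<not> scalar_mat n C" "A * C = C * A" "B * C = C * B" by blast
  have "commuting_dist n A B \<le> 2"
  proof (cases "A = B \<or> scalar_mat n A \<or> scalar_mat n B")
    case True
    then show ?thesis by (auto simp: commuting_dist_def one_le_numeral)
  next
    case False
    have "\<exists>l\<le>2. (A, B) \<in> commuting_graph n ^^ l"
    proof (cases "C = A \<or> C = B")
      case True
      then have "(A, B) \<in> commuting_graph n ^^ 1" using False carr C by (auto simp: commuting_graph_def)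
      then show ?thesis by (intro exI[of _ 1]) auto
    next
      case nC: False
      then have "(A, C) \<in> commuting_graph n" "(C, B) \<in> commuting_graph n"
        using False carr C by (auto simp: commuting_graph_def)
      then show ?thesis by (intro exI[of _ 2]) (auto simp: numeral_2_eq_2)
    qed
    then obtain l where l: "l \<le> 2" "(A, B) \<in> commuting_graph n ^^ l" by blast
    have "graph_dist (commuting_graph n) A B \<le> enat l"
      unfolding graph_dist_def using l(2) by (intro Inf_lower) blast
    also have "\<dots> \<le> 2" using l(1) by (metis enat_ord_simps(1) numeral_eq_enat)
    finally show ?thesis using False by (simp add: commuting_dist_def)
  qed
  then show "(A, B) \<in> commuting_variety2 n" using carr by (auto simp: commuting_variety2_def)
qed

section \<open>The parametrization\<close>

definition param_idx :: "nat \<Rightarrow> nat \<Rightarrow> (nat \<times> nat \<times> nat) set" where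
  "param_idx r s = {0} \<times> {..<s} \<times> {..<r} \<union> {1} \<times> {..<r} \<times> {..<s} \<union> {2, 4} \<times> {..<r} \<times> {..<r}
     \<union> {3, 5} \<times> {..<s} \<times> {..<s}"

lemma card_param_idx_le: "card (param_idx r s) \<le> (r + s)\<^sup>2 + r\<^sup>2 + s\<^sup>2"
proof -
  have "card (param_idx r s) \<le> s * r + r * s + 2 * (r * r) + 2 * (s * s)"
    unfolding param_idx_def
    by (rule order_trans[OF card_Un_le] add_mono)+ (auto simp: card_cartesian_product)
  also have "\<dots> = (r + s)\<^sup>2 + r\<^sup>2 + s\<^sup>2" by (simp add: power2_eq_square algebra_simps)
  finally show ?thesis .
qed

lemma finite_param_idx: "finite (param_idx r s)"
  by (auto simp: param_idx_def)

lemma poly_mat_param_mat: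
  assumes "{c} \<times> {..<p} \<times> {..<q} \<subseteq> Q"
  shows "poly_mat ((\<lambda>p w. w p) ` Q) p q (\<lambda>w. param_mat w c p q)"
  unfolding poly_mat_def using assms by (auto simp: param_mat_def intro!: polys_gen)

lemma poly_mat_lu_conj:
  assumes "poly_mat G s r X" "poly_mat G r s Y" "poly_mat G r r a" "poly_mat G s s d"
  shows "poly_mat G (r + s) (r + s) (\<lambda>w. lu_conj r s (X w) (Y w) (a w) (d w))"
  unfolding lu_conj_def block_defs
  by (intro poly_mat_mult[of _ "r + s" "r + s"] poly_mat_four_block poly_mat_uminus assms poly_mat_const) auto

lemma polys_lu_pair:
  assumes "l < 2 * (r + s)\<^sup>2"
  shows "(\<lambda>w. mat_pair_vec (r + s) (lu_pair r s w) $ l) \<in> polys ((\<lambda>p w. w p) ` param_idx r s)"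
  unfolding lu_pair_def
  by (intro polys_mat_pair_vec poly_mat_lu_conj poly_mat_param_mat assms) (auto simp: param_idx_def)

lemma growth_le_lu_pair:
  "growth_le (coords (2 * (r + s)\<^sup>2))
    (mat_pair_vec (r + s) ` range (lu_pair r s :: _ \<Rightarrow> ('k::field mat \<times> _))) ((r + s)\<^sup>2 + r\<^sup>2 + s\<^sup>2)"
proof -
  have "growth_le (coords (2 * (r + s)\<^sup>2)) (range (\<lambda>w :: _ \<Rightarrow> 'k. mat_pair_vec (r + s) (lu_pair r s w)))
    (card ((\<lambda>p (w :: _ \<Rightarrow> 'k). w p) ` param_idx r s))"
    by (rule growth_le_image) (use polys_lu_pair finite_param_idx in auto)
  moreover have "card ((\<lambda>p (w :: _ \<Rightarrow> 'k). w p) ` param_idx r s) \<le> (r + s)\<^sup>2 + r\<^sup>2 + s\<^sup>2"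
    using card_image_le[OF finite_param_idx] card_param_idx_le order_trans by blast
  ultimately show ?thesis by (simp add: image_image growth_le_mono)
qed

text \<open>For fixed \<open>X\<close> and \<open>Y\<close> the construction is a conjugation, hence
  multiplicative and additive in the blocks. The commutator of a pair is therefore the conjugate of
  the blockwise commutators.\<close>

lemma lu_conj_mult:
  fixes X :: "'k::comm_ring_1 mat"
  assumes "X \<in> carrier_mat s r" "Y \<in> carrier_mat r s" "a \<in> carrier_mat r r" "d \<in> carrier_mat s s"
    "a' \<in> carrier_mat r r" "d' \<in> carrier_mat s s"
  shows "lu_conj r s X Y a d * lu_conj r s X Y a' d' = lu_conj r s X Y (a * a') (d * d')"
proof -
  define g g' where "g = block_lower r s X * block_upper r s Y"
    and "g' = block_upper r s (- Y) * block_lower r s (- X)"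
  have g: "inverse_pair (r + s) g g'"
    unfolding g_def g'_def
    by (rule inverse_pair_mult[OF inverse_pair_block_lower[OF assms(1)] inverse_pair_block_upper[OF assms(2)]])
  have "g * block_diag r s a d * g' * (g * block_diag r s a' d' * g') =
    g * (block_diag r s a d * block_diag r s a' d') * g'"
    using inverse_pairD[OF g] assms by (simp add: mat_dim_laws block_dims)
  then show ?thesis using assms by (simp add: lu_conj_def g_def g'_def block_diag_mult)
qed

lemma lu_conj_minus:
  fixes X :: "'k::comm_ring_1 mat"
  assumes "X \<in> carrier_mat s r" "Y \<in> carrier_mat r s" "a \<in> carrier_mat r r" "d \<in> carrier_mat s s"
    "a' \<in> carrier_mat r r" "d' \<in> carrier_mat s s"
  shows "lu_conj r s X Y a d - lu_conj r s X Y a' d' = lu_conj r s X Y (a - a') (d - d')"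
proof -
  have "block_diag r s (a - a') (d - d') = block_diag r s a d + - block_diag r s a' d'"
    using assms by (intro eq_matI) (auto simp: block_diag_def)
  then show ?thesis unfolding lu_conj_def using assms by (simp add: mat_dim_laws block_dims)
qed

lemma lu_conj_carrier:
  assumes "a \<in> carrier_mat r r" "d \<in> carrier_mat s s"
  shows "lu_conj r s X Y a d \<in> carrier_mat (r + s) (r + s)"
  using assms by (auto simp: lu_conj_def block_dims)

lemma lu_conj_blocks:
  fixes X :: "'k::comm_ring_1 mat"
  assumes "X \<in> carrier_mat s r" "Y \<in> carrier_mat r s" "a \<in> carrier_mat r r" "d \<in> carrier_mat s s"
  defines "b \<equiv> Y * d - a * Y"
  shows "lu_conj r s X Y a d = four_block_mat (a - b * X) b (X * a - (X * b + d) * X) (X * b + d)"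
proof -
  have b: "dim_row b = r" "dim_col b = s" using assms by (auto simp: b_def)
  have u: "block_upper r s Y * block_diag r s a d * block_upper r s (- Y) = four_block_mat a b (0\<^sub>m s r) d"
    unfolding b_def by (rule block_upper_conj[OF assms(3,4,2)])
  have "lu_conj r s X Y a d = block_lower r s X * (block_upper r s Y * block_diag r s a d * block_upper r s (- Y))
      * block_lower r s (- X)"
    unfolding lu_conj_def using assms(1-4) by (simp add: mat_dim_laws block_dims)
  also have "\<dots> = four_block_mat (a - b * X) b (X * a - (X * b + d) * X) (X * b + d)"
    unfolding u using assms(1-4) b by (auto simp: block_lower_def mult_four_block_dim[of _ r _ s] mat_dim_laws)
  finally show ?thesis .
qed

text \<open>The common commuting matrix is the conjugate of the idempotent
  \<open>block_diag r s 1 0\<close>; it is not scalar because both blocks are nonempty.\<close>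

lemma lu_pair_in_commuting_variety2:
  fixes w :: "_ \<Rightarrow> 'k::field"
  assumes "r > 0" "s > 0"
  shows "lu_pair r s w \<in> commuting_variety2 (r + s)"
proof -
  let ?X = "param_mat w 0 s r" and ?Y = "param_mat w 1 r s"
  let ?C = "lu_conj r s ?X ?Y (1\<^sub>m r) (0\<^sub>m s s)"
  have C: "?C \<in> carrier_mat (r + s) (r + s)" by (rule lu_conj_carrier) auto
  have comm: "lu_conj r s ?X ?Y a d * ?C = ?C * lu_conj r s ?X ?Y a d"
    if "a \<in> carrier_mat r r" "d \<in> carrier_mat s s" for a d
    using that by (simp add: lu_conj_mult mat_dim_laws)
  have "\<not> scalar_mat (r + s) ?C"
  proof
    define g g' where "g = block_lower r s ?X * block_upper r s ?Y"
      and "g' = block_upper r s (- ?Y) * block_lower r s (- ?X)"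
    have g: "inverse_pair (r + s) g g'"
      unfolding g_def g'_def
      by (rule inverse_pair_mult[OF inverse_pair_block_lower inverse_pair_block_upper]) auto
    assume "scalar_mat (r + s) ?C"
    then obtain c where c: "?C = c \<cdot>\<^sub>m 1\<^sub>m (r + s)" by (auto simp: scalar_mat_def)
    let ?E = "block_diag r s (1\<^sub>m r) (0\<^sub>m s s) :: 'k mat"
    have "?E = g' * ?C * g"
      unfolding lu_conj_def g_def[symmetric] g'_def[symmetric]
      using inverse_pairD[OF g] by (simp add: mat_dim_laws block_dims)
    also have "\<dots> = c \<cdot>\<^sub>m 1\<^sub>m (r + s)"
      unfolding c using inverse_pairD[OF g] by (simp add: mat_dim_laws)
    finally have E: "?E = c \<cdot>\<^sub>m 1\<^sub>m (r + s)" .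
    have "?E $$ (0, 0) = c" "?E $$ (r, r) = c" unfolding E using assms by auto
    then show False using assms by (auto simp: block_diag_def)
  qed
  then show ?thesis
    unfolding lu_pair_def using assms C comm by (subst commuting_variety2_iff) (auto intro!: lu_conj_carrier)
qed

text \<open>For diagonal \<open>d\<close> with distinct entries, the commutator scales entry
  \<open>(i, j)\<close> of \<open>d'\<close> by \<open>f i - f j\<close>. Any matrix with zero
  diagonal is thus reached, in particular the permutation matrix of an \<open>m\<close>-cycle, which
  has no fixed point once \<open>m\<close> is at least 2.\<close>

lemma ex_invertible_commutator:
  assumes "m \<ge> 2"
  shows "\<exists>d\<in>carrier_mat m m. \<exists>d'\<in>carrier_mat m m. det (d * d' - d' * d :: 'k::alg_closed_field mat) \<noteq> 0"
proof -
  obtain f :: "nat \<Rightarrow> 'k" where f: "inj f"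
    using infinite_countable_subset[OF infinite_UNIV_alg_closed_field] by blast
  define \<sigma> where "\<sigma> i = Suc i mod m" for i
  have \<sigma>: "\<sigma> i < m" "\<sigma> i \<noteq> i" if "i < m" for i
    using that assms by (auto simp: \<sigma>_def mod_Suc)
  have inj: "\<sigma> i = \<sigma> j \<longleftrightarrow> i = j" if "i < m" "j < m" for i j
    using that by (auto simp: \<sigma>_def mod_Suc split: if_splits)
  define d where "d = mat m m (\<lambda>(i, j). if i = j then f i else 0)"
  define d' where "d' = mat m m (\<lambda>(i, j). if j = \<sigma> i then 1 / (f i - f j) else 0)"
  define K :: "'k mat" where "K = mat m m (\<lambda>(i, j). if j = \<sigma> i then 1 else 0)"
  have K: "d * d' - d' * d = K"
  proof (rule eq_matI)
    fix i j assume "i < dim_row K" "j < dim_col K"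
    then have ij: "i < m" "j < m" by (auto simp: K_def)
    have dims: "dim_row d = m" "dim_col d = m" "dim_row d' = m" "dim_col d' = m"
      by (auto simp: d_def d'_def)
    have "(d * d') $$ (i, j) = (\<Sum>k<m. d $$ (i, k) * d' $$ (k, j))"
      using ij dims by (subst mult_mat_entry) auto
    also have "\<dots> = (\<Sum>k<m. if k = i then f i * d' $$ (k, j) else 0)"
      by (rule sum.cong) (use ij in \<open>auto simp: d_def\<close>)
    finally have 1: "(d * d') $$ (i, j) = f i * d' $$ (i, j)" using ij by simp
    have "(d' * d) $$ (i, j) = (\<Sum>k<m. d' $$ (i, k) * d $$ (k, j))"
      using ij dims by (subst mult_mat_entry) auto
    also have "\<dots> = (\<Sum>k<m. if k = j then d' $$ (i, k) * f j else 0)"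
      by (rule sum.cong) (use ij in \<open>auto simp: d_def\<close>)
    finally have 2: "(d' * d) $$ (i, j) = f j * d' $$ (i, j)" using ij by simp
    have "(d * d' - d' * d) $$ (i, j) = (d * d') $$ (i, j) - (d' * d) $$ (i, j)"
      using ij dims by (subst index_minus_mat) auto
    then have "(d * d' - d' * d) $$ (i, j) = (f i - f j) * d' $$ (i, j)"
      unfolding 1 2 by (simp add: algebra_simps)
    also have "\<dots> = K $$ (i, j)"
      using ij \<sigma>[OF ij(1)] f by (auto simp: d'_def K_def inj_eq)
    finally show "(d * d' - d' * d) $$ (i, j) = K $$ (i, j)" .
  qed (auto simp: K_def d_def d'_def)
  \<comment> \<open>Permutation matrices are orthogonal, which gives invertibility without computing
    a sign.\<close>
  have "K * K\<^sup>T = 1\<^sub>m m"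
  proof (rule eq_matI)
    fix i j assume "i < dim_row (1\<^sub>m m :: 'k mat)" "j < dim_col (1\<^sub>m m :: 'k mat)"
    then have ij: "i < m" "j < m" by auto
    have "(K * K\<^sup>T) $$ (i, j) = (\<Sum>k<m. K $$ (i, k) * K\<^sup>T $$ (k, j))"
      using ij by (subst mult_mat_entry) (auto simp: K_def)
    also have "\<dots> = (\<Sum>k<m. if k = \<sigma> i then (if \<sigma> i = \<sigma> j then 1 else 0) else 0)"
      by (rule sum.cong) (use ij in \<open>auto simp: K_def\<close>)
    finally show "(K * K\<^sup>T) $$ (i, j) = 1\<^sub>m m $$ (i, j)" using ij \<sigma>[OF ij(1)] inj[OF ij] by simp
  qed (auto simp: K_def)
  then have "det K * det K\<^sup>T = 1"
    by (subst det_mult[symmetric, of _ m]) (auto simp: K_def)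
  then have "det K \<noteq> 0" by auto
  then show ?thesis using K by (intro bexI[of _ d] bexI[of _ d']) (auto simp: d_def d'_def)
qed

section \<open>A chain of maximal length\<close>

text \<open>Together with \<open>snd_mat\<close> this inverts \<open>mat_pair_vec\<close>. The
  entries are coordinates, so expressions in the two matrices are polynomial functions of the
  point.\<close>

definition fst_mat :: "nat \<Rightarrow> 'k vec \<Rightarrow> 'k mat" where
  "fst_mat n x = mat n n (\<lambda>(i, j). x $ (i * n + j))"

definition snd_mat :: "nat \<Rightarrow> 'k vec \<Rightarrow> 'k mat" where
  "snd_mat n x = mat n n (\<lambda>(i, j). x $ (n\<^sup>2 + (i * n + j)))"

lemma fst_snd_mat_pair_vec:
  assumes "A \<in> carrier_mat n n" "B \<in> carrier_mat n n"
  shows "fst_mat n (mat_pair_vec n (A, B)) = A" "snd_mat n (mat_pair_vec n (A, B)) = B"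
  using assms by (auto simp: fst_mat_def snd_mat_def mat_pair_vec_entry intro!: eq_matI)

lemma poly_mat_fst_snd_mat:
  "poly_mat (coords (2 * n\<^sup>2)) n n (fst_mat n :: 'k::comm_ring_1 vec \<Rightarrow> _)"
  "poly_mat (coords (2 * n\<^sup>2)) n n (snd_mat n :: 'k::comm_ring_1 vec \<Rightarrow> _)"
proof -
  have "i * n + j < n\<^sup>2" if "i < n" "j < n" for i j
  proof -
    have "Suc i * n \<le> n * n" using that(1) by (intro mult_le_mono1) simp
    then show ?thesis using that(2) by (simp add: power2_eq_square)
  qed
  then show "poly_mat (coords (2 * n\<^sup>2)) n n (fst_mat n :: 'k vec \<Rightarrow> _)"
    "poly_mat (coords (2 * n\<^sup>2)) n n (snd_mat n :: 'k vec \<Rightarrow> _)"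
    by (force simp: poly_mat_def fst_mat_def snd_mat_def coords_def intro!: polys_gen)+
qed

definition commutator_of :: "nat \<Rightarrow> 'k::comm_ring_1 vec \<Rightarrow> 'k mat" where
  "commutator_of n x = fst_mat n x * snd_mat n x - snd_mat n x * fst_mat n x"

lemma poly_mat_commutator_of: "poly_mat (coords (2 * n\<^sup>2)) n n (commutator_of n)"
  unfolding commutator_of_def
  by (intro poly_mat_minus poly_mat_mult[of _ _ n] poly_mat_fst_snd_mat)

definition lower_right :: "nat \<Rightarrow> 'k mat \<Rightarrow> 'k mat" where
  "lower_right m M = mat m m (\<lambda>(i, j). M $$ (Suc i, Suc j))"

definition upper_right :: "nat \<Rightarrow> 'k mat \<Rightarrow> 'k mat" where
  "upper_right m M = mat 1 m (\<lambda>(i, j). M $$ (0, Suc j))"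

definition lower_left :: "nat \<Rightarrow> 'k mat \<Rightarrow> 'k mat" where
  "lower_left m M = mat m 1 (\<lambda>(i, j). M $$ (Suc i, 0))"

lemma corners_four_block:
  assumes "A \<in> carrier_mat 1 1" "B \<in> carrier_mat 1 m" "C \<in> carrier_mat m 1" "D \<in> carrier_mat m m"
  shows "lower_right m (four_block_mat A B C D) = D" "upper_right m (four_block_mat A B C D) = B"
    "lower_left m (four_block_mat A B C D) = C"
  using assms by (auto simp: lower_right_def upper_right_def lower_left_def intro!: eq_matI)

lemma poly_mat_corners:
  assumes "poly_mat G (1 + m) (1 + m) X"
  shows "poly_mat G m m (\<lambda>x. lower_right m (X x))" "poly_mat G 1 m (\<lambda>x. upper_right m (X x))"
    "poly_mat G m 1 (\<lambda>x. lower_left m (X x))"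
  using poly_matD(4)[OF assms]
  by (auto simp: poly_mat_def lower_right_def upper_right_def lower_left_def)

text \<open>The commutator of a generic pair in the family has a one-dimensional kernel and cokernel. They
  recover the parameters \<open>X\<close> and \<open>Y\<close> up to the common denominator \<open>det K\<close>.\<close>

lemma commutator_of_lu_pair:
  fixes w :: "nat \<times> nat \<times> nat \<Rightarrow> 'k::field" and m :: nat
  defines "M \<equiv> commutator_of (1 + m) (mat_pair_vec (1 + m) (lu_pair 1 m w))"
    and "X \<equiv> param_mat w 0 m 1" and "Y \<equiv> param_mat w 1 1 m"
    and "K \<equiv> param_mat w 3 m m * param_mat w 5 m m - param_mat w 5 m m * param_mat w 3 m m"
  shows "lower_right m M = X * (Y * K) + K" "upper_right m M = Y * K"
    "lower_left m M = - (lower_right m M * X)"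
proof -
  let ?a = "param_mat w 2 1 1" and ?a' = "param_mat w 4 1 1"
  let ?d = "param_mat w 3 m m" and ?d' = "param_mat w 5 m m"
  have carr: "X \<in> carrier_mat m 1" "Y \<in> carrier_mat 1 m" "K \<in> carrier_mat m m"
    unfolding X_def Y_def K_def by (intro minus_carrier_mat mult_carrier_mat[of _ m m] param_mat_carrier)+
  let ?A = "lu_conj 1 m X Y ?a ?d" and ?B = "lu_conj 1 m X Y ?a' ?d'"
  \<comment> \<open>Here \<open>r = 1\<close> enters: blocks of size 1 commute, so the commutator of
    the pair is conjugate to a block diagonal matrix with blocks 0 and \<open>K\<close>.\<close>
  have aa: "?a * ?a' - ?a' * ?a = 0\<^sub>m 1 1"
    by (intro eq_matI) (auto simp: param_mat_def scalar_prod_def)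
  have A: "?A \<in> carrier_mat (1 + m) (1 + m)" and B: "?B \<in> carrier_mat (1 + m) (1 + m)"
    by (intro lu_conj_carrier param_mat_carrier)+
  have "M = ?A * ?B - ?B * ?A"
    unfolding M_def commutator_of_def lu_pair_def X_def[symmetric] Y_def[symmetric]
      fst_snd_mat_pair_vec[OF A B] ..
  also have "\<dots> = lu_conj 1 m X Y (?a * ?a') (?d * ?d') - lu_conj 1 m X Y (?a' * ?a) (?d' * ?d)"
    by (simp only: lu_conj_mult carr param_mat_carrier)
  also have "\<dots> = lu_conj 1 m X Y (?a * ?a' - ?a' * ?a) K"
    unfolding K_def
    by (intro lu_conj_minus carr mult_carrier_mat[of _ 1 1] mult_carrier_mat[of _ m m] param_mat_carrier)
  finally have "M = lu_conj 1 m X Y (0\<^sub>m 1 1) K" unfolding aa .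
  also have "\<dots> = four_block_mat (- (Y * K * X)) (Y * K) (- ((X * (Y * K) + K) * X)) (X * (Y * K) + K)"
    using carr by (simp add: lu_conj_blocks mat_dim_laws)
  finally have M: "M = four_block_mat (- (Y * K * X)) (Y * K) (- ((X * (Y * K) + K) * X)) (X * (Y * K) + K)" .
  have "lower_right m M = X * (Y * K) + K" "upper_right m M = Y * K"
    "lower_left m M = - ((X * (Y * K) + K) * X)"
    unfolding M by (rule corners_four_block; use carr in auto)+
  then show "lower_right m M = X * (Y * K) + K" "upper_right m M = Y * K"
    "lower_left m M = - (lower_right m M * X)" by auto
qed

definition recover_Y :: "nat \<Rightarrow> 'k::comm_ring_1 vec \<Rightarrow> 'k mat" where
  "recover_Y m x = upper_right m (commutator_of (1 + m) x) * adj_mat (lower_right m (commutator_of (1 + m) x))"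

definition recover_X :: "nat \<Rightarrow> 'k::comm_ring_1 vec \<Rightarrow> 'k mat" where
  "recover_X m x = adj_mat (lower_right m (commutator_of (1 + m) x)) * lower_left m (commutator_of (1 + m) x)"

lemma poly_mat_recover:
  "poly_mat (coords (2 * (1 + m)\<^sup>2)) 1 m (recover_Y m)" "poly_mat (coords (2 * (1 + m)\<^sup>2)) m 1 (recover_X m)"
  unfolding recover_Y_def recover_X_def
  by (intro poly_mat_mult[of _ _ m] poly_mat_adj_mat poly_mat_corners poly_mat_commutator_of)+

text \<open>The lower left corner is minus the lower right corner times \<open>X\<close> for every
  choice of parameters, so multiplying by the adjugate isolates \<open>X\<close>. The denominator is
  the determinant of that corner, which involves \<open>X\<close> and \<open>Y\<close> as
  well.\<close>

lemma recover_X_lu_pair: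
  fixes w :: "nat \<times> nat \<times> nat \<Rightarrow> 'k::field"
  shows "recover_X m (mat_pair_vec (1 + m) (lu_pair 1 m w)) =
    (- det (lower_right m (commutator_of (1 + m) (mat_pair_vec (1 + m) (lu_pair 1 m w))))) \<cdot>\<^sub>m param_mat w 0 m 1"
proof -
  let ?K = "lower_right m (commutator_of (1 + m) (mat_pair_vec (1 + m) (lu_pair 1 m w)))"
  have K: "?K \<in> carrier_mat m m" by (simp add: lower_right_def)
  note adj = adj_mat[OF K]
  have "recover_X m (mat_pair_vec (1 + m) (lu_pair 1 m w)) = - (adj_mat ?K * ?K * param_mat w 0 m 1)"
    unfolding recover_X_def commutator_of_lu_pair(3)
    using carrier_matD[OF K] carrier_matD[OF adj(1)] by (simp add: mat_dim_laws param_mat_def)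
  also have "\<dots> = (- det ?K) \<cdot>\<^sub>m param_mat w 0 m 1"
    unfolding adj(3) by (intro eq_matI) (auto simp: mat_dim_laws param_mat_def)
  finally show ?thesis .
qed

text \<open>With \<open>X = 0\<close> the lower right corner is just \<open>K\<close>, and the
  adjugate cancels it from the upper right corner \<open>Y * K\<close>.\<close>

lemma recover_Y_lu_pair:
  fixes w :: "nat \<times> nat \<times> nat \<Rightarrow> 'k::field"
  assumes "param_mat w 0 m 1 = 0\<^sub>m m 1"
  defines "K \<equiv> param_mat w 3 m m * param_mat w 5 m m - param_mat w 5 m m * param_mat w 3 m m"
  shows "recover_Y m (mat_pair_vec (1 + m) (lu_pair 1 m w)) = det K \<cdot>\<^sub>m param_mat w 1 1 m"
proof -
  have K: "K \<in> carrier_mat m m"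
    unfolding K_def by (intro minus_carrier_mat mult_carrier_mat[of _ m m] param_mat_carrier)
  note adj = adj_mat[OF K]
  have lr: "lower_right m (commutator_of (1 + m) (mat_pair_vec (1 + m) (lu_pair 1 m w))) = K"
    unfolding commutator_of_lu_pair(1) assms(1) K_def[symmetric] using K
    by (simp add: mat_dim_laws param_mat_def)
  have "recover_Y m (mat_pair_vec (1 + m) (lu_pair 1 m w)) = param_mat w 1 1 m * (K * adj_mat K)"
    unfolding recover_Y_def lr commutator_of_lu_pair(2) K_def[symmetric]
    using carrier_matD[OF K] carrier_matD[OF adj(1)] by (simp add: mat_dim_laws param_mat_def)
  then show ?thesis unfolding adj(2) by (simp add: mat_dim_laws param_mat_def)
qed

lemma lower_right_lu_pair_Y_zero:
  fixes w :: "nat \<times> nat \<times> nat \<Rightarrow> 'k::field"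
  assumes "param_mat w 1 1 m = 0\<^sub>m 1 m"
  shows "lower_right m (commutator_of (1 + m) (mat_pair_vec (1 + m) (lu_pair 1 m w))) =
    param_mat w 3 m m * param_mat w 5 m m - param_mat w 5 m m * param_mat w 3 m m"
  unfolding commutator_of_lu_pair(1) assms
  by (simp add: mat_dim_laws param_mat_def)

text \<open>Each release needs a polynomial function that equals the new parameter, up to a factor,
  on all pairs available so far. It vanishes before the release, and a witness afterwards must make
  both the parameter and the factor nonzero.\<close>

lemma variety_dim_commuting_variety2_ge:
  assumes "m \<ge> 2"
  shows "enat (2 + 2 * m\<^sup>2 + m + m) \<le> variety_dim (2 * (1 + m)\<^sup>2)
    (mat_pair_vec (1 + m) ` (commuting_variety2 (1 + m) :: ('k::alg_closed_field mat \<times> 'k mat) set))"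
proof -
  let ?N = "2 * (1 + m)\<^sup>2"
  define \<phi> :: "(nat \<times> nat \<times> nat \<Rightarrow> 'k) \<Rightarrow> 'k vec" where "\<phi> w = mat_pair_vec (1 + m) (lu_pair 1 m w)" for w
  \<comment> \<open>The positions of the four diagonal blocks, two of size 1 and two of size
    \<open>m\<close>, hence \<open>2 + 2 * m^2\<close> parameters.\<close>
  define Q :: "(nat \<times> nat \<times> nat) set" where "Q = {2, 4} \<times> {0} \<times> {0} \<union> {3, 5} \<times> {..<m} \<times> {..<m}"
  define q where "q = 2 + 2 * m\<^sup>2"
  have "card Q = q"
    unfolding Q_def q_def by (subst card_Un_disjoint) (auto simp: card_cartesian_product power2_eq_square)
  moreover have "finite Q" by (auto simp: Q_def)
  ultimately obtain h where h: "bij_betw h {..<q} Q"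
    using ex_bij_betw_nat_finite[of Q] by (metis atLeast0LessThan)
  define D where "D = q + m + m"
  \<comment> \<open>The order of release: block entries in an arbitrary order, then the row
    \<open>Y\<close>, then the column \<open>X\<close>.\<close>
  define e where "e k = (if k < q then h k else if k < q + m then (1, 0, k - q) else (0, k - q - m, 0))" for k
  have hQ: "h k \<in> Q" if "k < q" for k using h that by (auto simp: bij_betw_def)
  have e1: "e (q + j) = (1, 0, j)" if "j < m" for j using that by (simp add: e_def)
  have e0: "e (q + m + j) = (0, j, 0)" for j by (simp add: e_def)
  have inj: "e k \<noteq> e i" if "i < k" for i k
  proof (cases "k < q")
    case True
    then show ?thesis
      using that inj_onD[OF bij_betw_imp_inj_on[OF h], of k i] by (auto simp: e_def)
  next
    case False
    then show ?thesis using that hQ[of i] by (auto simp: e_def Q_def)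
  qed
  \<comment> \<open>The first \<open>i\<close> parameters are free and the later ones are
    zero.\<close>
  define S where "S i = \<phi> ` {w. \<forall>p\<in>e ` {i..<D}. w p = 0}" for i
  obtain d d' :: "'k mat" where dd: "d \<in> carrier_mat m m" "d' \<in> carrier_mat m m" "det (d * d' - d' * d) \<noteq> 0"
    using ex_invertible_commutator[OF assms] by blast
  \<comment> \<open>The base point has \<open>X = Y = 0\<close> and an invertible commutator of the
    large blocks, so that the determinant factors do not vanish near the released parameter.\<close>
  define w0 where "w0 = (\<lambda>(c, i, j). if c = (3::nat) then d $$ (i, j) else if c = 5 then d' $$ (i, j) else 0)"
  have w0e: "w0 (e k) = 0" if "q \<le> k" for k using that by (auto simp: w0_def e_def)
  have "enat D \<le> variety_dim ?N (mat_pair_vec (1 + m) ` commuting_variety2 (1 + m) :: 'k vec set)"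
  proof (rule variety_dim_ge[where S = S])
    fix i
    have "\<phi> w \<in> carrier_vec ?N" for w by (simp add: \<phi>_def mat_pair_vec_carrier)
    moreover have "(\<lambda>w. \<phi> w $ l) \<in> polys (range (\<lambda>p w. w p))" if "l < ?N" for l
      unfolding \<phi>_def
      by (rule polys_compose[OF polys_lu_pair[OF that], where \<phi> = "\<lambda>w. w"]) (auto intro!: polys_gen)
    ultimately show "irreducible_in (zariski ?N) (S i)"
      unfolding S_def by (rule irreducible_in_range_linear_space)
    show "S i \<subseteq> S (Suc i)" unfolding S_def by (intro image_mono) auto
  next
    show "S D \<subseteq> mat_pair_vec (1 + m) ` commuting_variety2 (1 + m)"
      unfolding S_def \<phi>_def using lu_pair_in_commuting_variety2[of 1 m] assms by auto
  next
    fix i assume i: "i < D"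
    \<comment> \<open>The base point with the newly released parameter set to 1.\<close>
    define w1 where "w1 p = (if p = e i then 1 else w0 p)" for p
    have w1_i: "w1 (e i) = 1" by (simp add: w1_def)
    have w1_in: "\<phi> w1 \<in> S (Suc i)" if "q \<le> i"
    proof -
      have "w1 (e k) = 0" if "k \<in> {Suc i..<D}" for k
        using that \<open>q \<le> i\<close> inj[of i k] w0e[of k] by (auto simp: w1_def)
      then show ?thesis unfolding S_def by blast
    qed
    have w1d: "param_mat w1 3 m m = d" "param_mat w1 5 m m = d'" if "q \<le> i"
      using that dd by (auto simp: param_mat_def w1_def w0_def e_def intro!: eq_matI)
    consider "i < q" | j where "i = q + j" "j < m" | j where "i = q + m + j" "j < m"
    proof -
      have "i < q \<or> (i = q + (i - q) \<and> i - q < m) \<or> (i = q + m + (i - q - m) \<and> i - q - m < m)"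
        using i by (auto simp: D_def)
      then show ?thesis using that by blast
    qed
    then show "\<exists>f\<in>poly_funs ?N. (\<forall>x\<in>S i. f x = 0) \<and> (\<exists>x\<in>S (Suc i). f x \<noteq> 0)"
    proof cases
      case 1
      \<comment> \<open>While \<open>X\<close> and \<open>Y\<close> are still zero the pair is
        literally block diagonal, and every parameter is an entry of one of the two
        matrices.\<close>
      have diag: "lu_pair 1 m w = (block_diag 1 m (param_mat w 2 1 1) (param_mat w 3 m m),
          block_diag 1 m (param_mat w 4 1 1) (param_mat w 5 m m))"
        if w: "\<forall>p\<in>e ` {Suc i..<D}. w p = 0" for w :: "nat \<times> nat \<times> nat \<Rightarrow> 'k"
      proof -
        have "w (1, 0, j) = 0" if "j < m" for j
          using w 1 that e1[OF that, symmetric] by (force simp: D_def)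
        moreover have "w (0, j, 0) = 0" if "j < m" for j
          using w 1 that e0[of j, symmetric] by (force simp: D_def)
        ultimately have "param_mat w 0 m 1 = 0\<^sub>m m 1" "param_mat w 1 1 m = 0\<^sub>m 1 m"
          by (auto simp: param_mat_def intro!: eq_matI)
        then show ?thesis
          by (simp add: lu_pair_def lu_conj_blocks mat_dim_laws block_diag_def param_mat_def)
      qed
      have ei: "e i = h i" "h i \<in> Q" using 1 hQ by (auto simp: e_def)
      have ex: "\<exists>f\<in>poly_funs ?N. \<forall>w :: _ \<Rightarrow> 'k. (\<forall>p\<in>e ` {Suc i..<D}. w p = 0) \<longrightarrow> f (\<phi> w) = w (e i)"
      proof -
        let ?n = "1 + m"
        obtain c a b where cab: "e i = (c, a, b)" by (metis prod_cases3)
        \<comment> \<open>Position of the parameter in the full matrix: a block of size 1 occupies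
          \<open>(0, 0)\<close>, and a block of size \<open>m\<close> starts one row and one column
          later.\<close>
        define a' b' where "a' = (if c \<in> {2, 4} then 0 else Suc a)" and "b' = (if c \<in> {2, 4} then 0 else Suc b)"
        have ab: "a' < ?n" "b' < ?n" and c: "c \<in> {2, 3, 4, 5}"
          using ei cab by (auto simp: Q_def a'_def b'_def)
        define f :: "'k vec \<Rightarrow> 'k" where
          "f x = (if c \<in> {2, 3} then fst_mat ?n x else snd_mat ?n x) $$ (a', b')" for x
        have "f \<in> poly_funs ?N"
          unfolding f_def polys_coords[symmetric]
          using poly_matD(4)[OF poly_mat_fst_snd_mat(1) ab] poly_matD(4)[OF poly_mat_fst_snd_mat(2) ab]
          by (cases "c \<in> {2, 3}") simp_all
        moreover have "f (\<phi> w) = w (e i)" if "\<forall>p\<in>e ` {Suc i..<D}. w p = 0" for w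
        proof -
          have "block_diag 1 m (param_mat w c1 1 1) (param_mat w c2 m m) \<in> carrier_mat ?n ?n" for c1 c2
            unfolding block_diag_def by (intro four_block_carrier_mat param_mat_carrier)
          then have "fst_mat ?n (\<phi> w) = block_diag 1 m (param_mat w 2 1 1) (param_mat w 3 m m)"
            "snd_mat ?n (\<phi> w) = block_diag 1 m (param_mat w 4 1 1) (param_mat w 5 m m)"
            unfolding \<phi>_def diag[OF that] by (auto simp: fst_snd_mat_pair_vec)
          then show ?thesis
            using ei cab c by (auto simp: f_def block_diag_def param_mat_def a'_def b'_def Q_def)
        qed
        ultimately show ?thesis by blast
      qed
      then obtain f where f: "f \<in> poly_funs ?N"
        "\<And>w :: _ \<Rightarrow> 'k. (\<forall>p\<in>e ` {Suc i..<D}. w p = 0) \<Longrightarrow> f (\<phi> w) = w (e i)" by blast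
      have "f (\<phi> w) = 0" if "\<forall>p\<in>e ` {i..<D}. w p = 0" for w
        using f(2)[of w] that i by auto
      \<comment> \<open>No determinant factor occurs in this case, so a point with a single nonzero
        parameter suffices.\<close>
      moreover define v :: "_ \<Rightarrow> 'k" where "v p = (if p = e i then 1 else 0)" for p
      have v: "\<forall>p\<in>e ` {Suc i..<D}. v p = 0" using inj[of i] by (auto simp: v_def)
      moreover have "f (\<phi> v) \<noteq> 0" unfolding f(2)[OF v] by (simp add: v_def)
      ultimately show ?thesis using f(1) unfolding S_def by blast
    next
      case (2 j)
      define f :: "'k vec \<Rightarrow> 'k" where "f x = recover_Y m x $$ (0, j)" for x
      have X0: "param_mat w 0 m 1 = 0\<^sub>m m 1" if "\<forall>p\<in>e ` {Suc i..<D}. w p = 0"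
        for w :: "nat \<times> nat \<times> nat \<Rightarrow> 'k"
      proof -
        have "w (0, j, 0) = 0" if "j < m" for j
          using \<open>\<forall>p\<in>e ` {Suc i..<D}. w p = 0\<close> 2 that e0[of j, symmetric] by (force simp: D_def)
        then show ?thesis by (auto simp: param_mat_def intro!: eq_matI)
      qed
      have fval: "f (\<phi> w) = det (param_mat w 3 m m * param_mat w 5 m m - param_mat w 5 m m * param_mat w 3 m m)
          * w (e i)" if "\<forall>p\<in>e ` {Suc i..<D}. w p = 0" for w
        unfolding f_def \<phi>_def recover_Y_lu_pair[OF X0[OF that]] using 2 e1[of j]
        by (simp add: param_mat_def)
      have "f \<in> poly_funs ?N"
        unfolding f_def polys_coords[symmetric] using poly_matD(4)[OF poly_mat_recover(1), of 0 j m] 2 by simp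
      moreover have "f x = 0" if "x \<in> S i" for x
        using that fval i by (auto simp: S_def)
      moreover have "f (\<phi> w1) \<noteq> 0"
      proof -
        have "\<forall>p\<in>e ` {Suc i..<D}. w1 p = 0" 
          using 2 inj[of i] w0e by (auto simp: w1_def)
        from fval[OF this] show ?thesis using w1d 2(1) dd(3) unfolding w1_i by simp
      qed
      ultimately show ?thesis using w1_in 2 by auto
    next
      case (3 j)
      define f :: "'k vec \<Rightarrow> 'k" where "f x = recover_X m x $$ (j, 0)" for x
      \<comment> \<open>This holds for every \<open>w\<close>, with \<open>Y\<close> already free.
        Only the witness needs a nonzero factor, and there \<open>Y\<close> is zero again.\<close>
      have fval: "f (\<phi> w) = - det (lower_right m (commutator_of (1 + m) (\<phi> w))) * w (e i)" for w
        unfolding f_def \<phi>_def recover_X_lu_pair using 3 e0[of j] by (simp add: param_mat_def)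
      have "f \<in> poly_funs ?N"
        unfolding f_def polys_coords[symmetric] using poly_matD(4)[OF poly_mat_recover(2), of j m 0] 3 by simp
      moreover have "f x = 0" if "x \<in> S i" for x
        using that i by (auto simp: S_def fval)
      moreover have "f (\<phi> w1) \<noteq> 0"
      proof -
        have Y0: "param_mat w1 1 1 m = 0\<^sub>m 1 m"
          using 3 e0[of j] by (auto simp: param_mat_def w1_def w0_def intro!: eq_matI)
        have "lower_right m (commutator_of (1 + m) (\<phi> w1)) = d * d' - d' * d"
          unfolding \<phi>_def lower_right_lu_pair_Y_zero[OF Y0] using w1d 3 by simp
        then show ?thesis unfolding fval w1_i using dd(3) by simp
      qed
      ultimately show ?thesis using w1_in 3 by auto
    qed
  qed
  then show ?thesis by (simp add: D_def q_def)
qed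

section \<open>The upper bound and the dimension formula\<close>

lemma variety_dim_commuting_variety2_le:
  assumes "n \<ge> 2"
  shows "variety_dim (2 * n\<^sup>2) (mat_pair_vec n ` (commuting_variety2 n :: ('k::alg_closed_field mat \<times> 'k mat) set))
    \<le> enat (n\<^sup>2 + 1\<^sup>2 + (n - 1)\<^sup>2)"
proof (rule variety_dim_le)
  let ?S = "\<lambda>r. mat_pair_vec n ` range (lu_pair r (n - r) :: _ \<Rightarrow> ('k mat \<times> _))"
  show "finite {1..<n}" by simp
  show "mat_pair_vec n ` commuting_variety2 n \<subseteq> (\<Union>r\<in>{1..<n}. zcl (2 * n\<^sup>2) (?S r))"
  proof clarify
    fix A B :: "'k mat" assume "(A, B) \<in> commuting_variety2 n"
    then obtain C where "A \<in> carrier_mat n n" "B \<in> carrier_mat n n" "C \<in> carrier_mat n n"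
      "\<not> scalar_mat n C" "A * C = C * A" "B * C = C * B"
      using commuting_variety2_iff[OF assms] by blast
    from commuting_pair_in_zcl[OF this] obtain r s where rs: "r + s = n" "0 < r" "0 < s"
      "mat_pair_vec n (A, B) \<in> zcl (2 * n\<^sup>2) (mat_pair_vec n ` conj_pairs r s)" by blast
    have "zcl (2 * n\<^sup>2) (mat_pair_vec n ` conj_pairs r s) \<subseteq>
        zcl (2 * n\<^sup>2) (mat_pair_vec n ` range (lu_pair r s :: _ \<Rightarrow> ('k mat \<times> _)))"
      by (rule zcl_least[OF closedin_zcl conj_pairs_subset_zcl[of r s, unfolded rs(1)]])
    moreover have "n - r = s" "r \<in> {1..<n}" using rs by auto
    ultimately show "mat_pair_vec n (A, B) \<in> (\<Union>r\<in>{1..<n}. zcl (2 * n\<^sup>2) (?S r))" using rs(4) by blast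
  qed
  fix r assume r: "r \<in> {1..<n}"
  have "growth_le (coords (2 * n\<^sup>2)) (?S r) (n\<^sup>2 + r\<^sup>2 + (n - r)\<^sup>2)"
    using growth_le_lu_pair[of r "n - r", where ?'k = 'k] r by simp
  moreover have "r\<^sup>2 + (n - r)\<^sup>2 \<le> 1\<^sup>2 + (n - 1)\<^sup>2"
  proof -
    \<comment> \<open>With \<open>r = a + 1\<close> and \<open>n - r = b + 1\<close> the two sides
      differ by \<open>2 * a * b\<close>; the extreme splitting is the largest.\<close>
    obtain a b where "r = Suc a" "n - r = Suc b" using r by (metis Suc_diff_Suc atLeastLessThan_iff Suc_le_D One_nat_def)
    moreover from this have "n - 1 = a + b + 1" by simp
    ultimately show ?thesis by (simp add: power2_eq_square algebra_simps)
  qed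
  ultimately show "growth_le (coords (2 * n\<^sup>2)) (?S r) (n\<^sup>2 + 1\<^sup>2 + (n - 1)\<^sup>2)"
    by (elim growth_le_mono) simp
qed

theorem mainTheorem5:
  fixes n :: nat
  assumes "n \<ge> 3"
  shows "variety_dim (2 * n\<^sup>2)
      (mat_pair_vec n ` (commuting_variety2 n :: ('k::alg_closed_field mat \<times> 'k mat) set))
      = enat (n\<^sup>2 + 1\<^sup>2 + (n - 1)\<^sup>2)
    \<and> n\<^sup>2 + 1\<^sup>2 + (n - 1)\<^sup>2 = 2 * n\<^sup>2 - 2 * n + 2"
proof -
  define m where "m = n - 1"
  have m: "1 + m = n" "m \<ge> 2" using assms by (auto simp: m_def)
  have eq: "n\<^sup>2 + 1\<^sup>2 + (n - 1)\<^sup>2 = 2 + 2 * m\<^sup>2 + m + m"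
    unfolding m(1)[symmetric] by (simp add: power2_eq_square)
  have "enat (n\<^sup>2 + 1\<^sup>2 + (n - 1)\<^sup>2) \<le> variety_dim (2 * n\<^sup>2)
      (mat_pair_vec n ` (commuting_variety2 n :: ('k mat \<times> 'k mat) set))"
    using variety_dim_commuting_variety2_ge[OF m(2), where ?'k = 'k] unfolding m(1) eq .
  moreover have "n\<^sup>2 + 1\<^sup>2 + (n - 1)\<^sup>2 = 2 * n\<^sup>2 - 2 * n + 2"
    unfolding m(1)[symmetric] by (simp add: power2_eq_square)
  ultimately show ?thesis
    using variety_dim_commuting_variety2_le[of n, where ?'k = 'k] assms by (simp add: order_antisym)
qed

end
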